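(* Let $n\geq 2$, let $s\geq 3$ be odd, and let $N=N_s\times N_2$ be a finite abelian group of order $2^ns$, where $N_s$ is cyclic of order $s$ and $N_2$ has order $2^n$. Let $J\cong Q_{2^ns}$ or $J\cong D_{2^ns}$, and let $J_2$ be a Sylow $2$-subgroup of $J$. If $J\cong Q_{2^ns}$ with $n\neq 3$, or $J\cong D_{2^ns}$ with $n\neq 2$, then $r(N,J)=r(N_2,J_2)$ and $c(N,J)=c(N_2,J_2)$. If $J\cong Q_{8s}$ or $J\cong D_{4s}$, then $r(N,J)=3\,r(N_2,J_2)$. Also, for $n=3$ we have $c(N,Q_{8s})=c(C_3\times N_2,Q_{24})$, and for $n=2$ we have $c(N,D_{4s})=c(C_3\times N_2,D_{12})$.
   Context: $C_k$ denotes the cyclic group of order $k$. For $n\ge 2$ and $s$ odd, $Q_{2^ns}=\langle x,y: x^{2^{n-1}s}=1,\ yx=x^{-1}y,\ y^2=x^{2^{n-2}s}\rangle$ and $D_{2^ns}=\langle x,y: x^{2^{n-1}s}=1,\ yx=x^{-1}y,\ y^2=1\rangle$, both of order $2^ns$. The holomorph $\mathrm{Hol}(N)=N\rtimes\mathrm{Aut}(N)$ is viewed as a group of permutations of $N$ (with $N$ acting by translations); a subgroup is regular if for any $x,y\in N$ it contains a unique element taking $x$ to $y$. For an abelian group $N$ and a group $J$ of the same finite order, $r(N,J)$ is the number of regular subgroups of $\mathrm{Hol}(N)$ isomorphic to $J$, and $c(N,J)$ is the number of isomorphism classes of braces with additive group isomorphic to $N$ and multiplicative group isomorphic to $J$;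 equivalently, $c(N,J)$ is the number of orbits, under conjugation by $\mathrm{Aut}(N)$, of regular subgroups of $\mathrm{Hol}(N)$ isomorphic to $J$. Here a (left) brace $(B,+,\circ)$ is a set with an abelian group operation $+$ (giving the additive group) and a group operation $\circ$ (giving the multiplicative group) satisfying $a\circ(b+c)=a\circ b-a+a\circ c$ for all $a,b,c\in B$. *)

theory Defs
  imports "HOL-Algebra.Algebra"
begin

section \<open>Groups given by generators and relations\<close>

text \<open>
  A word over generators of type \<open>'g\<close> is a list of letters; \<open>(g, True)\<close> stands for the
  generator \<open>g\<close> and \<open>(g, False)\<close> for its formal inverse. A relation \<open>u = v\<close> is the pair \<open>(u, v)\<close>.
\<close>

type_synonym 'g word = "('g \<times> bool) list"

inductive word_eq :: "('g word \<times> 'g word) set \<Rightarrow> 'g word \<Rightarrow> 'g word \<Rightarrow> bool"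
  for R :: "('g word \<times> 'g word) set" where
  relation: "(u, v) \<in> R \<Longrightarrow> word_eq R u v"
| cancel: "word_eq R [(g, b), (g, \<not> b)] []"
| refl: "word_eq R u u"
| sym: "word_eq R u v \<Longrightarrow> word_eq R v u"
| trans: "word_eq R u v \<Longrightarrow> word_eq R v w \<Longrightarrow> word_eq R u w"
| append: "word_eq R u v \<Longrightarrow> word_eq R u' v' \<Longrightarrow> word_eq R (u @ u') (v @ v')"

definition word_rel :: "('g word \<times> 'g word) set \<Rightarrow> ('g word \<times> 'g word) set" where
  "word_rel R = {(u, v). word_eq R u v}"

definition presented_group :: "('g word \<times> 'g word) set \<Rightarrow> 'g word set monoid" where
  "presented_group R =
    \<lparr>carrier = UNIV // word_rel R,
     monoid.mult = (\<lambda>A B. \<Union>u\<in>A. \<Union>v\<in>B. word_rel R `` {u @ v}),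
     one = word_rel R `` {[]}\<rparr>"

lemma equiv_word_rel: "equiv UNIV (word_rel R)"
proof (rule equivI)
  show "refl (word_rel R)"
    by (rule refl_onI) (simp add: word_rel_def word_eq.refl)
  show "sym (word_rel R)"
    by (rule symI) (simp add: word_rel_def word_eq.sym)
  show "trans (word_rel R)"
    by (rule transI) (unfold word_rel_def mem_Collect_eq case_prod_conv, rule word_eq.trans)
qed simp

lemma mult_presented_group:
  "word_rel R `` {u} \<otimes>\<^bsub>presented_group R\<^esub> word_rel R `` {v} = word_rel R `` {u @ v}"
proof -
  have "word_rel R `` {u @ v} = word_rel R `` {u' @ v'}"
    if "(u, u') \<in> word_rel R" "(v, v') \<in> word_rel R" for u v u' v'
    using that by (intro equiv_class_eq[OF equiv_word_rel]) (simp add: word_rel_def word_eq.append)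
  then have "congruent2 (word_rel R) (word_rel R) (\<lambda>u v. word_rel R `` {u @ v})"
    by (intro congruent2I') simp
  then show ?thesis
    by (simp add: presented_group_def UN_equiv_class2[OF equiv_word_rel equiv_word_rel])
qed

lemma word_eq_inverse: "word_eq R (rev (map (\<lambda>(g, b). (g, \<not> b)) u) @ u) []"
proof (induction u)
  case Nil
  show ?case by (simp add: word_eq.refl)
next
  case (Cons a u)
  obtain g b where a: "a = (g, b)" by force
  let ?w = "rev (map (\<lambda>(g, b). (g, \<not> b)) u)"
  have "word_eq R ([(g, \<not> b), (g, b)] @ u) ([] @ u)"
    using word_eq.append[OF word_eq.cancel[of R g "\<not> b"] word_eq.refl[of R u]] by simp
  then have "word_eq R (?w @ [(g, \<not> b), (g, b)] @ u) (?w @ [] @ u)"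
    by (rule word_eq.append[OF word_eq.refl])
  then show ?case
    using Cons.IH a by (auto intro: word_eq.trans)
qed

lemma group_presented_group: "group (presented_group R)" (is "group ?G")
proof -
  let ?c = "\<lambda>u. word_rel R `` {u}"
  have closed: "?c u \<in> carrier ?G" for u
    unfolding presented_group_def by (simp add: quotientI)
  have rep: "\<exists>u. A = ?c u" if "A \<in> carrier ?G" for A
    using that unfolding presented_group_def quotient_def by auto
  have one: "\<one>\<^bsub>?G\<^esub> = ?c []"
    unfolding presented_group_def by simp
  show ?thesis
  proof (rule groupI)
    fix A B assume "A \<in> carrier ?G" "B \<in> carrier ?G"
    then obtain u v where "A = ?c u" "B = ?c v"
      using rep by metis
    then show "A \<otimes>\<^bsub>?G\<^esub> B \<in> carrier ?G"
      by (simp only: mult_presented_group closed)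
  next
    show "\<one>\<^bsub>?G\<^esub> \<in> carrier ?G"
      by (simp only: one closed)
  next
    fix A B C assume "A \<in> carrier ?G" "B \<in> carrier ?G" "C \<in> carrier ?G"
    then obtain u v w where "A = ?c u" "B = ?c v" "C = ?c w"
      using rep by metis
    then show "A \<otimes>\<^bsub>?G\<^esub> B \<otimes>\<^bsub>?G\<^esub> C = A \<otimes>\<^bsub>?G\<^esub> (B \<otimes>\<^bsub>?G\<^esub> C)"
      by (simp only: mult_presented_group append_assoc)
  next
    fix A assume "A \<in> carrier ?G"
    then obtain u where u: "A = ?c u"
      using rep by metis
    show "\<one>\<^bsub>?G\<^esub> \<otimes>\<^bsub>?G\<^esub> A = A"
      by (simp only: u one mult_presented_group append_Nil)
    have "?c (rev (map (\<lambda>(g, b). (g, \<not> b)) u) @ u) = ?c []"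
      by (rule equiv_class_eq[OF equiv_word_rel])
        (simp only: word_rel_def mem_Collect_eq case_prod_conv word_eq_inverse)
    then show "\<exists>B\<in>carrier ?G. B \<otimes>\<^bsub>?G\<^esub> A = \<one>\<^bsub>?G\<^esub>"
      unfolding u one mult_presented_group[symmetric] using closed by blast
  qed
qed


section \<open>Generalised quaternion and dihedral groups\<close>

datatype gen = Gx | Gy

text \<open>\<open>gen_quaternion n s\<close> and \<open>gen_dihedral n s\<close> are the groups $Q_{2^n s}$ and $D_{2^n s}$;
  the presentations are meant for \<open>n \<ge> 2\<close> and \<open>s\<close> odd, when the index is the order of the group.\<close>

definition gen_quaternion :: "nat \<Rightarrow> nat \<Rightarrow> gen word set monoid" where
  "gen_quaternion n s = presented_group
    {(replicate (2 ^ (n - 1) * s) (Gx, True), []),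
     ([(Gy, True), (Gx, True)], [(Gx, False), (Gy, True)]),
     ([(Gy, True), (Gy, True)], replicate (2 ^ (n - 2) * s) (Gx, True))}"

definition gen_dihedral :: "nat \<Rightarrow> nat \<Rightarrow> gen word set monoid" where
  "gen_dihedral n s = presented_group
    {(replicate (2 ^ (n - 1) * s) (Gx, True), []),
     ([(Gy, True), (Gx, True)], [(Gx, False), (Gy, True)]),
     ([(Gy, True), (Gy, True)], [])}"


section \<open>Sylow subgroups\<close>

definition sylow_subgroup :: "nat \<Rightarrow> ('a, 'm) monoid_scheme \<Rightarrow> 'a set \<Rightarrow> bool" where
  "sylow_subgroup p G H \<longleftrightarrow> subgroup H G \<and> card H = p ^ multiplicity p (order G)"


section \<open>Regular subgroups of the holomorph\<close>

text \<open>The pair \<open>(a, f)\<close> of the semidirect product of \<open>N\<close> and its automorphism group acts on \<open>N\<close>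
  by \<open>x \<mapsto> a \<otimes> f x\<close>; \<open>BijGroup\<close> makes permutations extensional, so that each one is counted once.\<close>

definition holomorph :: "('a, 'm) monoid_scheme \<Rightarrow> ('a \<Rightarrow> 'a) monoid" where
  "holomorph N = (BijGroup (carrier N))
    \<lparr>carrier := {\<lambda>x\<in>carrier N. a \<otimes>\<^bsub>N\<^esub> f x | a f. a \<in> carrier N \<and> f \<in> auto N}\<rparr>"

definition regular_on :: "'a set \<Rightarrow> ('a \<Rightarrow> 'a) set \<Rightarrow> bool" where
  "regular_on S G \<longleftrightarrow> (\<forall>x\<in>S. \<forall>y\<in>S. \<exists>!g. g \<in> G \<and> g x = y)"

definition num_regular :: "('a, 'm) monoid_scheme \<Rightarrow> ('b, 'k) monoid_scheme \<Rightarrow> nat" where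
  "num_regular N J = card {G. subgroup G (holomorph N) \<and> regular_on (carrier N) G
     \<and> (holomorph N)\<lparr>carrier := G\<rparr> \<cong> J}"


section \<open>Braces\<close>

text \<open>A brace is stored in a ring record: \<open>\<oplus>\<close> is its addition and \<open>\<otimes>\<close> its circle operation.
  With this encoding isomorphisms of braces are the elements of \<open>ring_iso\<close>, which is defined
  for arbitrary ring records.\<close>

locale brace = abelian_group B + group B for B (structure) +
  assumes brace_law: "\<lbrakk>a \<in> carrier B; b \<in> carrier B; c \<in> carrier B\<rbrakk>
    \<Longrightarrow> a \<otimes> (b \<oplus> c) = (a \<otimes> b \<ominus> a) \<oplus> a \<otimes> c"

definition braces :: "('a, 'm) monoid_scheme \<Rightarrow> ('b, 'k) monoid_scheme \<Rightarrow> 'a ring set" where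
  "braces N J = {B. brace B \<and> add_monoid B \<cong> N \<and> B \<cong> J}"

text \<open>Every brace with additive group isomorphic to \<open>N\<close> is isomorphic to one whose carrier is that
  of \<open>N\<close>, so restricting to braces on subsets of the type \<open>'a\<close> loses no isomorphism class.\<close>

definition num_braces :: "('a, 'm) monoid_scheme \<Rightarrow> ('b, 'k) monoid_scheme \<Rightarrow> nat" where
  "num_braces N J = card (braces N J // {(B, B'). B \<in> braces N J \<and> B' \<in> braces N J \<and> B \<simeq> B'})"

end

theory Submission
  imports Defs "HOL-Number_Theory.Cong"
begin

text \<open>
  A regular subgroup of the holomorph of an abelian group \<open>N\<close> is the same thing as a brace operation
  \<open>c\<close> on \<open>N\<close>, so both counts concern such operations. Quaternion and dihedral groups are
  characterised by a cyclic subgroup \<open>K\<close> of index 2 inverted by every element outside it.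
  Let \<open>c\<close> be a brace operation of this kind on \<open>N\<^sub>s \<times> N\<^sub>2\<close>. Both factors are invariant under the
  maps \<open>\<lambda>\<^sub>a x = - a + a \<circ> x\<close>, the factor \<open>N\<^sub>s\<close> lies in \<open>K\<close> because elements outside \<open>K\<close> have
  4th power 1, and since automorphisms of a cyclic group commute, inversion by an element outside
  \<open>K\<close> forces \<open>\<lambda>\<^sub>b\<^sup>2 = 1\<close>, hence \<open>\<lambda>\<^sub>b = 1\<close>, for \<open>b \<in> N\<^sub>s\<close>. So \<open>c\<close> is determined by its restriction to
  \<open>N\<^sub>2\<close> together with \<open>K \<inter> N\<^sub>2\<close>, whose complement acts on \<open>N\<^sub>s\<close> by inversion, and every such pair
  occurs. Given the operation on \<open>N\<^sub>2\<close> there is one choice of \<open>K \<inter> N\<^sub>2\<close>, except for the quaternion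
  group of order 8 and the Klein four-group, which have three.
\<close>

section \<open>Inverted cyclic subgroups\<close>

text \<open>Describing the groups by \<open>K\<close> instead of by presentations lets the same
  property be read in \<open>J\<close>, in its Sylow subgroup and in the operation induced on
  \<open>N2\<close>. It also covers s = 1, where Q_4 is cyclic of order 4 and D_4 is the Klein
  four-group, so the 2-group side needs no separate theory. The obstacle is that an operation on
  \<open>N2\<close> does not say which elements invert \<open>Ns\<close>; hence pairs (operation,
  subgroup) are counted. The subgroup can be recovered from the product because \<open>Ns\<close> is
  nontrivial of odd order and so has an element different from its inverse. The passage from
  \<lambda>_b^2 = 1 to \<lambda>_b = 1 rests on odd order again: b is a circle power of its circle
  square. Pairs also explain the shape of the result. If the subgroup is unique, pairs are
  operations, up to isomorphism too. If there are three, the number of operations is multiplied by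
  3, but isomorphism classes are not, since brace automorphisms may permute the three choices. What
  survives is that classes of pairs depend on \<open>N2\<close> only, so the odd factor may be
  exchanged for the smallest one, of order 3.\<close>

text \<open>
  \<open>q\<close> tells the quaternion type from the dihedral one. Index 2 is expressed by products of outside
  elements, a condition inherited by subgroups, and \<open>x \<otimes> y \<otimes> x = y\<close> says that \<open>y\<close> inverts \<open>x\<close>.
\<close>

definition inverted_cyclic :: "bool \<Rightarrow> ('a, 'm) monoid_scheme \<Rightarrow> 'a set \<Rightarrow> bool" where
  "inverted_cyclic q G K \<longleftrightarrow> subgroup K G \<and> (\<exists>x\<in>K. \<forall>z\<in>K. \<exists>k::nat. z = x [^]\<^bsub>G\<^esub> k) \<and>
     K \<noteq> carrier G \<and>
     (\<forall>y\<in>carrier G - K. (\<forall>y'\<in>carrier G - K. y \<otimes>\<^bsub>G\<^esub> y' \<in> K) \<and>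
        (\<forall>x\<in>K. x \<otimes>\<^bsub>G\<^esub> y \<otimes>\<^bsub>G\<^esub> x = y) \<and> (y \<otimes>\<^bsub>G\<^esub> y = \<one>\<^bsub>G\<^esub> \<longleftrightarrow> \<not> q))"

lemma inverted_cyclicI:
  assumes "subgroup K G" "x \<in> K" "\<And>z. z \<in> K \<Longrightarrow> \<exists>k::nat. z = x [^]\<^bsub>G\<^esub> k" "K \<noteq> carrier G"
    and "\<And>y y'. \<lbrakk>y \<in> carrier G; y \<notin> K; y' \<in> carrier G; y' \<notin> K\<rbrakk> \<Longrightarrow> y \<otimes>\<^bsub>G\<^esub> y' \<in> K"
    and "\<And>x y. \<lbrakk>x \<in> K; y \<in> carrier G; y \<notin> K\<rbrakk> \<Longrightarrow> x \<otimes>\<^bsub>G\<^esub> y \<otimes>\<^bsub>G\<^esub> x = y"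
    and "\<And>y. \<lbrakk>y \<in> carrier G; y \<notin> K\<rbrakk> \<Longrightarrow> y \<otimes>\<^bsub>G\<^esub> y = \<one>\<^bsub>G\<^esub> \<longleftrightarrow> \<not> q"
  shows "inverted_cyclic q G K"
  unfolding inverted_cyclic_def using assms(1,4-) by (auto intro!: bexI[OF _ assms(2)] dest: assms(3))

lemma inverted_cyclicD:
  assumes "inverted_cyclic q G K"
  shows "subgroup K G" "\<exists>x\<in>K. \<forall>z\<in>K. \<exists>k::nat. z = x [^]\<^bsub>G\<^esub> k" "\<exists>y\<in>carrier G. y \<notin> K"
    and "\<And>y y'. \<lbrakk>y \<in> carrier G; y \<notin> K; y' \<in> carrier G; y' \<notin> K\<rbrakk> \<Longrightarrow> y \<otimes>\<^bsub>G\<^esub> y' \<in> K"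
    and "\<And>x y. \<lbrakk>x \<in> K; y \<in> carrier G; y \<notin> K\<rbrakk> \<Longrightarrow> x \<otimes>\<^bsub>G\<^esub> y \<otimes>\<^bsub>G\<^esub> x = y"
    and "\<And>y. \<lbrakk>y \<in> carrier G; y \<notin> K\<rbrakk> \<Longrightarrow> y \<otimes>\<^bsub>G\<^esub> y = \<one>\<^bsub>G\<^esub> \<longleftrightarrow> \<not> q"
  using assms subgroup.subset[of K G] unfolding inverted_cyclic_def by blast+

context group
begin

lemma inverted_cyclic_commute:
  assumes "inverted_cyclic q G K" "a \<in> K" "b \<in> K"
  shows "a \<otimes> b = b \<otimes> a"
proof -
  obtain x where x: "x \<in> K" "\<forall>z\<in>K. \<exists>k::nat. z = x [^] k"
    using inverted_cyclicD(2)[OF assms(1)] by blast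
  then have "x \<in> carrier G"
    using subgroup.mem_carrier[OF inverted_cyclicD(1)[OF assms(1)]] by blast
  moreover obtain i j :: nat where "a = x [^] i" "b = x [^] j"
    using x assms by blast
  ultimately show ?thesis
    by (simp add: nat_pow_comm)
qed

text \<open>The square of \<open>y\<close> lies in \<open>K\<close>, so \<open>y\<close> inverts it;
  but \<open>y\<close> also commutes with its own square. Hence the square equals its
  inverse.\<close>

lemma inverted_cyclic_pow4:
  assumes "inverted_cyclic q G K" "y \<in> carrier G" "y \<notin> K"
  shows "(y \<otimes> y) \<otimes> (y \<otimes> y) = \<one>"
proof -
  have "(y \<otimes> y) \<otimes> y \<otimes> (y \<otimes> y) = y"
    using inverted_cyclicD(4,5)[OF assms(1)] assms by blast
  then have "y \<otimes> ((y \<otimes> y) \<otimes> (y \<otimes> y)) = y \<otimes> \<one>"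
    using assms(2) by (simp add: m_assoc)
  then show ?thesis
    using assms(2) by (metis l_cancel m_closed one_closed)
qed

lemma inverted_cyclic_coset:
  assumes "inverted_cyclic q G K" "y \<in> carrier G" "y \<notin> K"
  shows "carrier G - K = (\<lambda>x. x \<otimes> y) ` K"
proof -
  interpret K: subgroup K G using assms(1) by (rule inverted_cyclicD)
  have inv: "inv z \<notin> K" if "z \<in> carrier G" "z \<notin> K" for z
    using K.m_inv_closed[of "inv z"] that by auto
  show ?thesis
  proof (intro equalityI subsetI)
    fix g assume g: "g \<in> carrier G - K"
    then have "g \<otimes> inv y \<in> K"
      using inverted_cyclicD(4)[OF assms(1)] inv assms(2,3) by auto
    moreover have "g = (g \<otimes> inv y) \<otimes> y"
      using g assms(2) by (simp add: m_assoc)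
    ultimately show "g \<in> (\<lambda>x. x \<otimes> y) ` K" by blast
  next
    fix g assume "g \<in> (\<lambda>x. x \<otimes> y) ` K"
    then obtain x where x: "x \<in> K" "g = x \<otimes> y" by blast
    have "x \<otimes> y \<notin> K"
    proof
      assume "x \<otimes> y \<in> K"
      then have "inv x \<otimes> (x \<otimes> y) \<in> K" using x by blast
      then show False using x assms(2,3) by (simp add: m_assoc[symmetric])
    qed
    then show "g \<in> carrier G - K" using x assms(2) by simp
  qed
qed

lemma inverted_cyclic_order:
  assumes "inverted_cyclic q G K" "finite (carrier G)"
  shows "order G = 2 * card K"
proof -
  interpret K: subgroup K G using assms(1) by (rule inverted_cyclicD)
  obtain y where y: "y \<in> carrier G" "y \<notin> K" using inverted_cyclicD(3)[OF assms(1)] by blast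
  have "card (carrier G - K) = card K"
    unfolding inverted_cyclic_coset[OF assms(1) y]
    by (rule card_image) (auto intro!: inj_onI simp: y)
  moreover have "card (carrier G - K) = order G - card K"
    unfolding order_def using K.subset assms(2) by (metis card_Diff_subset finite_subset)
  moreover have "card K \<le> order G"
    unfolding order_def using K.subset assms(2) by (simp add: card_mono)
  ultimately show ?thesis by simp
qed

text \<open>In a finite group natural powers already fill the generated subgroup, so the exponent
  description of \<open>K\<close> yields a generator of order \<open>card K\<close>.\<close>

lemma inverted_cyclic_generator:
  assumes "inverted_cyclic q G K" "finite (carrier G)"
  obtains x where "x \<in> K" "K = range (\<lambda>k::nat. x [^] k)" "ord x = card K"
proof -
  interpret K: subgroup K G using assms(1) by (rule inverted_cyclicD)
  obtain x where x: "x \<in> K" "\<forall>z\<in>K. \<exists>k::nat. z = x [^] k"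
    using inverted_cyclicD(2)[OF assms(1)] by blast
  have xc: "x \<in> carrier G" using x by simp
  have pow: "x [^] k \<in> K" for k :: nat
    by (induction k) (use x in auto)
  have K: "K = range (\<lambda>k::nat. x [^] k)"
    using pow x by blast
  have "generate G {x} = range (\<lambda>k::nat. x [^] k)"
    using generate_pow_nat[OF xc] ord_ge_1[OF assms(2) xc] by auto
  then have "ord x = card K"
    using generate_pow_card[OF xc] K by simp
  with x K that show ?thesis by blast
qed

lemma inverted_cyclic_iso:
  assumes "group H" "h \<in> iso G H" "inverted_cyclic q G K"
  shows "inverted_cyclic q H (h ` K)"
proof -
  interpret H: group H by fact
  interpret h: group_hom G H h
    using assms(2) by unfold_locales (simp add: iso_def)
  note K = inverted_cyclicD[OF assms(3)]
  interpret K: subgroup K G by (rule K)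
  have inj: "inj_on h (carrier G)" and img: "h ` carrier G = carrier H"
    using assms(2) by (auto simp: iso_def bij_betw_def)
  obtain x where x: "x \<in> K" "\<forall>z\<in>K. \<exists>k::nat. z = x [^] k" using K(2) by blast
  have mem: "h a \<in> h ` K \<longleftrightarrow> a \<in> K" if "a \<in> carrier G" for a
    using that inj K.subset by (meson inj_on_image_mem_iff)
  show ?thesis
  proof (rule inverted_cyclicI[where x = "h x"])
    show "subgroup (h ` K) H" by (rule h.subgroup_img_is_subgroup[OF K(1)])
    show "h x \<in> h ` K" using x by simp
    show "\<exists>k::nat. z = h x [^]\<^bsub>H\<^esub> k" if "z \<in> h ` K" for z
      using that x by (auto simp flip: h.hom_nat_pow)
    show "h ` K \<noteq> carrier H"
      using K(3) mem img by blast
  next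
    fix y y' assume "y \<in> carrier H" "y \<notin> h ` K" "y' \<in> carrier H" "y' \<notin> h ` K"
    then obtain a a' where "y = h a" "y' = h a'" "a \<in> carrier G" "a' \<in> carrier G" "a \<notin> K" "a' \<notin> K"
      using img by blast
    then show "y \<otimes>\<^bsub>H\<^esub> y' \<in> h ` K"
      using K(4)[of a a'] by (simp flip: h.hom_mult)
  next
    fix z y assume *: "z \<in> h ` K" "y \<in> carrier H" "y \<notin> h ` K"
    then obtain a b where ab: "y = h a" "a \<in> carrier G" "a \<notin> K" "z = h b" "b \<in> K"
      using img by blast
    then show "z \<otimes>\<^bsub>H\<^esub> y \<otimes>\<^bsub>H\<^esub> z = y"
      using K(5)[of b a] by (simp flip: h.hom_mult)
  next
    fix y assume *: "y \<in> carrier H" "y \<notin> h ` K"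
    then obtain a where ab: "y = h a" "a \<in> carrier G" "a \<notin> K"
      using img by blast
    have "h (a \<otimes> a) = h \<one> \<longleftrightarrow> a \<otimes> a = \<one>"
      using inj ab by (metis inj_on_eq_iff m_closed one_closed)
    then show "y \<otimes>\<^bsub>H\<^esub> y = \<one>\<^bsub>H\<^esub> \<longleftrightarrow> \<not> q"
      using K(6)[of a] ab by (simp flip: h.hom_mult)
  qed
qed

text \<open>Serves both for the Sylow subgroup of \<open>J\<close> and for the copy of
  \<open>N2\<close> inside the product. Only cyclicity of \<open>H \<inter> K\<close> needs an
  argument; an element of \<open>H\<close> outside \<open>K\<close> keeps the intersection
  proper.\<close>

lemma inverted_cyclic_restrict:
  assumes "finite (carrier G)" "inverted_cyclic q G K" "subgroup H G" "\<not> H \<subseteq> K"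
  shows "inverted_cyclic q (G\<lparr>carrier := H\<rparr>) (H \<inter> K)"
proof -
  note K = inverted_cyclicD[OF assms(2)]
  interpret K: subgroup K G by (rule K)
  interpret H: subgroup H G by fact
  interpret HG: group "G\<lparr>carrier := H\<rparr>" by (rule H.subgroup_is_group) unfold_locales
  obtain x where x: "x \<in> K" "K = range (\<lambda>k::nat. x [^] k)" "ord x = card K"
    using inverted_cyclic_generator[OF assms(2,1)] by blast
  have xc: "x \<in> carrier G" using x by simp
  \<comment> \<open>The least positive \<open>d\<close> with \<open>x [^] d\<close> in
    \<open>H\<close> will give the generator, by division with remainder.\<close>
  define P where "P d \<longleftrightarrow> d > 0 \<and> x [^] d \<in> H" for d :: nat
  define d where "d = (LEAST d. P d)"
  have "P (ord x)"
    using ord_ge_1[OF assms(1) xc] xc by (simp add: P_def)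
  then have "P d" unfolding d_def by (rule LeastI)
  then have d: "d > 0" "x [^] d \<in> H" by (auto simp: P_def)
  have powH: "(x [^] d) [^] k \<in> H" for k :: nat
    by (induction k) (use d in auto)
  have gen: "\<exists>k::nat. z = (x [^] d) [^] k" if z: "z \<in> H \<inter> K" for z
  proof -
    obtain j where j: "z = x [^] (j::nat)" using z x(2) by blast
    have "x [^] j = (x [^] d) [^] (j div d) \<otimes> x [^] (j mod d)"
      using xc by (simp add: nat_pow_pow nat_pow_mult)
    then have "x [^] (j mod d) = inv ((x [^] d) [^] (j div d)) \<otimes> x [^] j"
      using xc by (simp add: m_assoc[symmetric])
    then have "x [^] (j mod d) \<in> H"
      using powH j z by simp
    then have "j mod d = 0"
      using not_less_Least[of "j mod d" P] d(1) by (fastforce simp: P_def d_def[symmetric])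
    then have "z = (x [^] d) [^] (j div d)"
      using j xc by (metis mult_div_mod_eq add_0_right nat_pow_pow)
    then show ?thesis ..
  qed
  show ?thesis
  proof (rule inverted_cyclicI[where x = "x [^] d"])
    show "subgroup (H \<inter> K) (G\<lparr>carrier := H\<rparr>)"
      by (rule subgroup_incl) (auto intro: subgroups_Inter_pair assms K)
    show "x [^] d \<in> H \<inter> K" using d x(2) by blast
    show "\<exists>k::nat. z = (x [^] d) [^]\<^bsub>G\<lparr>carrier := H\<rparr>\<^esub> k" if "z \<in> H \<inter> K" for z
      using gen[OF that] by (simp flip: nat_pow_consistent)
    show "H \<inter> K \<noteq> carrier (G\<lparr>carrier := H\<rparr>)" using assms(4) by auto
  qed (use K in auto)
qed

end

section \<open>Presentations\<close>

fun eval_word :: "('a, 'm) monoid_scheme \<Rightarrow> ('g \<Rightarrow> 'a) \<Rightarrow> 'g word \<Rightarrow> 'a" where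
  "eval_word G \<phi> [] = \<one>\<^bsub>G\<^esub>"
| "eval_word G \<phi> ((g, b) # u) = (if b then \<phi> g else inv\<^bsub>G\<^esub> \<phi> g) \<otimes>\<^bsub>G\<^esub> eval_word G \<phi> u"

context group
begin

lemma eval_word_closed: "(\<And>g. \<phi> g \<in> carrier G) \<Longrightarrow> eval_word G \<phi> u \<in> carrier G"
  by (induction u) auto

lemma eval_word_append:
  "(\<And>g. \<phi> g \<in> carrier G) \<Longrightarrow> eval_word G \<phi> (u @ v) = eval_word G \<phi> u \<otimes> eval_word G \<phi> v"
  by (induction u) (auto simp: eval_word_closed m_assoc)

lemma eval_word_replicate:
  "(\<And>g. \<phi> g \<in> carrier G) \<Longrightarrow> eval_word G \<phi> (replicate k (g, True)) = \<phi> g [^] k"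
  by (induction k) (simp_all add: nat_pow_Suc2[symmetric] del: nat_pow_Suc Group.nat_pow_Suc)

lemma eval_word_eq:
  assumes "\<And>g. \<phi> g \<in> carrier G" "\<And>u v. (u, v) \<in> R \<Longrightarrow> eval_word G \<phi> u = eval_word G \<phi> v"
    and "word_eq R u v"
  shows "eval_word G \<phi> u = eval_word G \<phi> v"
  using assms(3) by induction (auto simp: assms(1,2) eval_word_append)

text \<open>Von Dyck's theorem. The representative chosen in a class is harmless because evaluation
  respects \<open>word_eq\<close>.\<close>

lemma presented_group_hom:
  assumes "\<And>g. \<phi> g \<in> carrier G" "\<And>u v. (u, v) \<in> R \<Longrightarrow> eval_word G \<phi> u = eval_word G \<phi> v"
  obtains h where "h \<in> hom (presented_group R) G"
    and "\<And>u. h (word_rel R `` {u}) = eval_word G \<phi> u"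
proof -
  define h where "h A = eval_word G \<phi> (SOME u. u \<in> A)" for A
  have h: "h (word_rel R `` {u}) = eval_word G \<phi> u" for u
  proof -
    have "u \<in> word_rel R `` {u}"
      by (simp add: word_rel_def word_eq.refl)
    then have "(SOME v. v \<in> word_rel R `` {u}) \<in> word_rel R `` {u}"
      by (rule someI)
    then have "word_eq R u (SOME v. v \<in> word_rel R `` {u})"
      by (simp add: word_rel_def)
    then show ?thesis
      unfolding h_def by (metis eval_word_eq[OF assms])
  qed
  have "h \<in> hom (presented_group R) G"
  proof (rule homI)
    fix A assume "A \<in> carrier (presented_group R)"
    then obtain u where "A = word_rel R `` {u}"
      unfolding presented_group_def quotient_def by auto
    then show "h A \<in> carrier G" by (simp add: h eval_word_closed assms(1))
  next
    fix A B assume "A \<in> carrier (presented_group R)" "B \<in> carrier (presented_group R)"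
    then obtain u v where "A = word_rel R `` {u}" "B = word_rel R `` {v}"
      unfolding presented_group_def quotient_def by auto
    then show "h (A \<otimes>\<^bsub>presented_group R\<^esub> B) = h A \<otimes> h B"
      by (simp add: mult_presented_group h eval_word_append assms(1))
  qed
  with h that show ?thesis by blast
qed

end

text \<open>One family for both types: \<open>e = m div 2\<close> is the quaternion relation, and
  \<open>e = 0\<close> the dihedral one because \<open>replicate 0\<close> is the empty
  word.\<close>

definition dicyclic_rels :: "nat \<Rightarrow> nat \<Rightarrow> (gen word \<times> gen word) set" where
  "dicyclic_rels m e =
    {(replicate m (Gx, True), []),
     ([(Gy, True), (Gx, True)], [(Gx, False), (Gy, True)]),
     ([(Gy, True), (Gy, True)], replicate e (Gx, True))}"

lemma (in group) dicyclic_pow_swap: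
  assumes "x \<in> carrier G" "y \<in> carrier G" "y \<otimes> x = inv x \<otimes> y"
  shows "y \<otimes> x [^] (k::nat) = inv x [^] k \<otimes> y"
proof (induction k)
  case (Suc k)
  have "y \<otimes> x [^] Suc k = (y \<otimes> x [^] k) \<otimes> x"
    using assms by (simp add: m_assoc)
  also have "\<dots> = inv x [^] k \<otimes> (y \<otimes> x)"
    using Suc assms by (simp add: m_assoc)
  also have "\<dots> = inv x [^] Suc k \<otimes> y"
    using assms by (simp add: m_assoc)
  finally show ?case .
qed (use assms in simp)

lemma (in group) nat_pow_mod:
  assumes "x \<in> carrier G" "x [^] (m::nat) = \<one>"
  shows "x [^] (k mod m) = x [^] k"
proof -
  have "x [^] (m * (k div m)) = \<one>"
    using assms by (simp flip: nat_pow_pow)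
  moreover have "x [^] k = x [^] (m * (k div m)) \<otimes> x [^] (k mod m)"
    using assms by (simp add: nat_pow_mult)
  ultimately show ?thesis using assms by simp
qed

text \<open>Normal forms x^k and x^k y with k < m. An upper bound is all that is asked of the
  presentation: a surjection onto a group with 2m elements then has to be injective.\<close>

lemma card_dicyclic_presentation:
  assumes m: "m > 0" and e: "m dvd 2 * e"
  shows "finite (carrier (presented_group (dicyclic_rels m e)))"
    and "card (carrier (presented_group (dicyclic_rels m e))) \<le> 2 * m"
proof -
  let ?R = "dicyclic_rels m e"
  define P where "P = presented_group ?R"
  define c where "c u = word_rel ?R `` {u}" for u
  interpret P: group P unfolding P_def by (rule group_presented_group)
  have c_app: "c (u @ v) = c u \<otimes>\<^bsub>P\<^esub> c v" for u v
    unfolding c_def P_def by (simp only: mult_presented_group)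
  have c_Nil: "c [] = \<one>\<^bsub>P\<^esub>" by (simp add: c_def P_def presented_group_def)
  have cc: "c u \<in> carrier P" for u
    by (simp add: c_def P_def presented_group_def quotientI)
  have carr: "carrier P = range c"
    unfolding P_def c_def presented_group_def quotient_def by auto
  have c_eq: "c u = c v" if "word_eq ?R u v" for u v
    unfolding c_def by (rule equiv_class_eq[OF equiv_word_rel]) (use that in \<open>simp add: word_rel_def\<close>)
  define x y where "x = c [(Gx, True)]" and "y = c [(Gy, True)]"
  have x: "x \<in> carrier P" and y: "y \<in> carrier P" by (simp_all add: x_def y_def cc)
  have rep: "c (replicate k (Gx, True)) = x [^]\<^bsub>P\<^esub> k" for k
  proof (induction k)
    case (Suc k)
    have "c (replicate (Suc k) (Gx, True)) = x \<otimes>\<^bsub>P\<^esub> x [^]\<^bsub>P\<^esub> k"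
      using c_app[of "[(Gx, True)]" "replicate k (Gx, True)"] Suc by (simp add: x_def)
    then show ?case using P.nat_pow_Suc2[OF x, of k] by simp
  qed (simp add: c_Nil)
  have inv: "c [(g, False)] = inv\<^bsub>P\<^esub> (c [(g, True)])" for g
  proof (rule P.inv_equality[symmetric])
    show "c [(g, False)] \<otimes>\<^bsub>P\<^esub> c [(g, True)] = \<one>\<^bsub>P\<^esub>"
      using c_eq[OF word_eq.cancel[of ?R g False]] by (simp flip: c_app c_Nil)
  qed (rule cc)+
  have x_m: "x [^]\<^bsub>P\<^esub> m = \<one>\<^bsub>P\<^esub>"
    using c_eq[OF word_eq.relation[of "replicate m (Gx, True)" "[]" ?R]]
    by (simp add: rep c_Nil dicyclic_rels_def)
  have yx: "y \<otimes>\<^bsub>P\<^esub> x = inv\<^bsub>P\<^esub> x \<otimes>\<^bsub>P\<^esub> y"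
    using c_eq[OF word_eq.relation[of "[(Gy, True), (Gx, True)]" "[(Gx, False), (Gy, True)]" ?R]]
      c_app[of "[(Gy, True)]" "[(Gx, True)]"] c_app[of "[(Gx, False)]" "[(Gy, True)]"]
    by (simp add: x_def y_def inv dicyclic_rels_def)
  have yy: "y \<otimes>\<^bsub>P\<^esub> y = x [^]\<^bsub>P\<^esub> e"
    using c_eq[OF word_eq.relation[of "[(Gy, True), (Gy, True)]" "replicate e (Gx, True)" ?R]]
      c_app[of "[(Gy, True)]" "[(Gy, True)]"]
    by (simp add: y_def rep dicyclic_rels_def)
  have x_2e: "x [^]\<^bsub>P\<^esub> (e + e) = \<one>\<^bsub>P\<^esub>"
  proof -
    from e obtain k where "e + e = m * k" by (auto simp: mult_2)
    then show ?thesis using x x_m by (simp flip: P.nat_pow_pow)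
  qed
  \<comment> \<open>To contain all classes of words, the set of normal forms only has to be stable
    under left multiplication by the generators and their inverses.\<close>
  define S where "S = range (\<lambda>k::nat. x [^]\<^bsub>P\<^esub> k) \<union> range (\<lambda>k::nat. x [^]\<^bsub>P\<^esub> k \<otimes>\<^bsub>P\<^esub> y)"
  have S_I: "x [^]\<^bsub>P\<^esub> (k::nat) \<in> S" "x [^]\<^bsub>P\<^esub> (k::nat) \<otimes>\<^bsub>P\<^esub> y \<in> S" for k
    unfolding S_def by blast+
  have pow_S: "x [^]\<^bsub>P\<^esub> (i::nat) \<otimes>\<^bsub>P\<^esub> a \<in> S" if "a \<in> S" for a i
    using that S_I x y unfolding S_def by (auto simp: P.nat_pow_mult simp flip: P.m_assoc)
  \<comment> \<open>Writing the inverse as a natural power keeps all exponents in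
    \<open>nat\<close>.\<close>
  have inv_x: "inv\<^bsub>P\<^esub> x = x [^]\<^bsub>P\<^esub> (m - 1)"
  proof (rule P.inv_equality)
    show "x [^]\<^bsub>P\<^esub> (m - 1) \<otimes>\<^bsub>P\<^esub> x = \<one>\<^bsub>P\<^esub>"
      using P.nat_pow_Suc[of x "m - 1"] m x_m by simp
  qed (use x in auto)
  have y_S: "y \<otimes>\<^bsub>P\<^esub> a \<in> S" if "a \<in> S" for a
  proof -
    have 1: "y \<otimes>\<^bsub>P\<^esub> x [^]\<^bsub>P\<^esub> k = x [^]\<^bsub>P\<^esub> ((m - 1) * k) \<otimes>\<^bsub>P\<^esub> y" for k
      using P.dicyclic_pow_swap[OF x y yx] x by (simp add: inv_x P.nat_pow_pow)
    have 2: "y \<otimes>\<^bsub>P\<^esub> (x [^]\<^bsub>P\<^esub> k \<otimes>\<^bsub>P\<^esub> y) = x [^]\<^bsub>P\<^esub> ((m - 1) * k + e)" for k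
      using x y 1[of k] by (simp add: yy P.m_assoc P.nat_pow_mult flip: P.m_assoc[of y]) 
    from that show ?thesis using 1 2 S_I unfolding S_def by auto
  qed
  \<comment> \<open>This is where \<open>m dvd 2 * e\<close> enters: x^(2e) = 1 makes x^e y inverse
    to y.\<close>
  have inv_y: "inv\<^bsub>P\<^esub> y = x [^]\<^bsub>P\<^esub> e \<otimes>\<^bsub>P\<^esub> y"
  proof (rule P.inv_equality)
    show "x [^]\<^bsub>P\<^esub> e \<otimes>\<^bsub>P\<^esub> y \<otimes>\<^bsub>P\<^esub> y = \<one>\<^bsub>P\<^esub>"
      using x y x_2e by (simp add: P.m_assoc yy P.nat_pow_mult)
  qed (use x y in auto)
  have c_S: "c u \<in> S" for u
  proof (induction u)
    case Nil
    show ?case using S_I(1)[of 0] by (simp add: c_Nil)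
  next
    case (Cons a u)
    obtain g b where a: "a = (g, b)" by force
    have "c (a # u) = c [a] \<otimes>\<^bsub>P\<^esub> c u" using c_app[of "[a]" u] by simp
    moreover have "x \<otimes>\<^bsub>P\<^esub> c u \<in> S" using pow_S[OF Cons, of 1] x by simp
    moreover have "inv\<^bsub>P\<^esub> y \<otimes>\<^bsub>P\<^esub> c u \<in> S"
      using pow_S[OF y_S[OF Cons], of e] x y cc by (simp add: inv_y P.m_assoc)
    ultimately show ?case
      using a pow_S[OF Cons] y_S[OF Cons] by (cases g; cases b) (auto simp: inv inv_x simp flip: x_def y_def)
  qed
  have x_mod: "x [^]\<^bsub>P\<^esub> (k::nat) = x [^]\<^bsub>P\<^esub> (k mod m)" for k
    by (rule P.nat_pow_mod[OF x x_m, symmetric])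
  let ?f = "\<lambda>(k, b). if b then x [^]\<^bsub>P\<^esub> (k::nat) else x [^]\<^bsub>P\<^esub> k \<otimes>\<^bsub>P\<^esub> y"
  have sub: "carrier P \<subseteq> ?f ` ({..<m} \<times> UNIV)"
  proof
    fix a assume "a \<in> carrier P"
    then have "a \<in> S" using carr c_S by auto
    then consider k :: nat where "a = x [^]\<^bsub>P\<^esub> k" | k :: nat where "a = x [^]\<^bsub>P\<^esub> k \<otimes>\<^bsub>P\<^esub> y"
      unfolding S_def by blast
    then show "a \<in> ?f ` ({..<m} \<times> UNIV)"
    proof cases
      case 1
      then have "a = ?f (k mod m, True)" using x_mod[of k] by simp
      then show ?thesis using m by (intro image_eqI) auto
    next
      case 2
      then have "a = ?f (k mod m, False)" using x_mod[of k] by simp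
      then show ?thesis using m by (intro image_eqI) auto
    qed
  qed
  then show "finite (carrier (presented_group ?R))"
    unfolding P_def[symmetric] by (rule finite_subset) simp
  have "card (carrier P) \<le> card (?f ` ({..<m} \<times> (UNIV :: bool set)))"
    by (rule card_mono[OF _ sub]) simp
  also have "\<dots> \<le> card ({..<m} \<times> (UNIV :: bool set))" by (rule card_image_le) simp
  finally show "card (carrier (presented_group ?R)) \<le> 2 * m"
    unfolding P_def[symmetric] by (simp add: card_cartesian_product)
qed

text \<open>In the quaternion case the square is some x^j different from the unit with x^(2j) = 1.
  So j is an odd multiple of half the order of \<open>x\<close>, and the square is the only
  involution of \<open>K\<close>.\<close>

lemma (in group) inverted_cyclic_square:
  assumes "finite (carrier G)" "inverted_cyclic q G K" "x \<in> K" "K = range (\<lambda>k::nat. x [^] k)"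
    "ord x = card K" "even (card K)" "y \<in> carrier G" "y \<notin> K"
  shows "y \<otimes> y = x [^] (if q then card K div 2 else 0)"
proof (cases q)
  case True
  have xc: "x \<in> carrier G"
    using assms(3) inverted_cyclicD(1)[OF assms(2)] subgroup.mem_carrier by metis
  obtain j :: nat where j: "y \<otimes> y = x [^] j"
    using inverted_cyclicD(4)[OF assms(2) assms(7,8) assms(7,8)] assms(4) by blast
  have "x [^] (2 * j) = \<one>"
    using inverted_cyclic_pow4[OF assms(2,7,8)] j xc by (simp add: nat_pow_mult mult_2)
  then obtain k where k: "2 * j = card K * k"
    using pow_eq_id[OF xc, of "2 * j"] assms(5) by auto
  have "y \<otimes> y \<noteq> \<one>"
    using inverted_cyclicD(6)[OF assms(2,7,8)] True by simp
  then have "\<not> card K dvd j"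
    using pow_eq_id[OF xc, of j] assms(5) j by simp
  moreover obtain m where m: "card K = 2 * m" using assms(6) by blast
  ultimately have "odd k" using k by auto
  then obtain l where "k = 2 * l + 1" by (rule oddE)
  then have "j = card K div 2 + card K * l" using k m by simp
  then have "x [^] j = x [^] (card K div 2) \<otimes> (x [^] card K) [^] l"
    using xc by (simp add: nat_pow_mult nat_pow_pow)
  also have "x [^] card K = \<one>" using xc by (simp flip: assms(5))
  finally show ?thesis using xc j True by simp
next
  case False
  then show ?thesis using inverted_cyclicD(6)[OF assms(2,7,8)] by simp
qed

text \<open>A generator \<open>x\<close> of \<open>K\<close> and any \<open>y\<close> outside
  satisfy the relations, and the induced map is onto since the group is \<open>K\<close> together
  with the coset \<open>K y\<close>. The order bound for the presentation makes it
  injective.\<close>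

lemma (in group) dicyclic_presentation_iso:
  assumes "finite (carrier G)" "inverted_cyclic q G K" "card K = m" "even m"
  shows "presented_group (dicyclic_rels m (if q then m div 2 else 0)) \<cong> G"
proof -
  define e where "e = (if q then m div 2 else 0)"
  let ?P = "presented_group (dicyclic_rels m e)"
  note K = inverted_cyclicD[OF assms(2)]
  interpret K: subgroup K G by (rule K)
  obtain x where x: "x \<in> K" "K = range (\<lambda>k::nat. x [^] k)" "ord x = card K"
    using inverted_cyclic_generator[OF assms(2,1)] by blast
  have xc: "x \<in> carrier G" using x by simp
  obtain y where y: "y \<in> carrier G" "y \<notin> K" using K(3) by blast
  define \<phi> where "\<phi> g = (case g of Gx \<Rightarrow> x | Gy \<Rightarrow> y)" for g
  have \<phi>: "\<phi> g \<in> carrier G" for g using xc y by (cases g) (auto simp: \<phi>_def)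
  have \<phi>xy: "\<phi> Gx = x" "\<phi> Gy = y" by (simp_all add: \<phi>_def)
  have m: "m > 0" using assms(1,3) K.subset K.one_closed
    by (metis card_gt_0_iff empty_iff finite_subset)
  have "y \<otimes> y = x [^] e"
    unfolding e_def using inverted_cyclic_square[OF assms(1,2) x] assms(3,4) y by simp
  moreover have "x [^] m = \<one>" using x(3) assms(3) xc by auto
  moreover have "y \<otimes> x = inv x \<otimes> y"
  proof -
    have "inv x \<otimes> (x \<otimes> y \<otimes> x) = inv x \<otimes> y"
      using K(5)[OF x(1) y] by simp
    then show ?thesis using xc y by (simp add: m_assoc[symmetric])
  qed
  ultimately have rel: "eval_word G \<phi> u = eval_word G \<phi> v" if "(u, v) \<in> dicyclic_rels m e" for u v
    using that xc y by (auto simp: dicyclic_rels_def eval_word_replicate[OF \<phi>] \<phi>xy)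
  obtain h where h: "h \<in> hom ?P G" "\<And>u. h (word_rel (dicyclic_rels m e) `` {u}) = eval_word G \<phi> u"
    using presented_group_hom[OF \<phi> rel] by blast
  have hI: "eval_word G \<phi> u \<in> h ` carrier ?P" for u
    by (rule image_eqI[where x = "word_rel (dicyclic_rels m e) `` {u}"])
      (simp_all add: h presented_group_def quotientI)
  have "carrier G \<subseteq> h ` carrier ?P"
  proof
    fix g assume g: "g \<in> carrier G"
    have 1: "x [^] (k::nat) \<in> h ` carrier ?P" for k
      using hI[of "replicate k (Gx, True)"] by (simp add: eval_word_replicate[OF \<phi>] \<phi>xy)
    have 2: "x [^] (k::nat) \<otimes> y \<in> h ` carrier ?P" for k
      using hI[of "replicate k (Gx, True) @ [(Gy, True)]"] y
      by (simp add: eval_word_append eval_word_replicate \<phi> \<phi>xy)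
    show "g \<in> h ` carrier ?P"
    proof (cases "g \<in> K")
      case True
      then show ?thesis using 1 x(2) by blast
    next
      case False
      then have "g \<in> (\<lambda>x. x \<otimes> y) ` K"
        using inverted_cyclic_coset[OF assms(2) y] g by blast
      then show ?thesis using 2 x(2) by blast
    qed
  qed
  moreover have "h ` carrier ?P \<subseteq> carrier G" using h(1) by (auto simp: hom_def)
  ultimately have img: "h ` carrier ?P = carrier G" by blast
  have "m dvd 2 * e" using assms(4) by (simp add: e_def)
  note bound = card_dicyclic_presentation[OF m this]
  have "card (h ` carrier ?P) = 2 * m"
    using inverted_cyclic_order[OF assms(2,1)] assms(3) by (simp add: img order_def)
  then have "inj_on h (carrier ?P)"
    using bound card_image_le[OF bound(1), of h] by (intro eq_card_imp_inj_on) auto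
  then have "h \<in> iso ?P G"
    using h(1) img by (simp add: iso_def bij_betw_def)
  then show ?thesis unfolding e_def by (rule is_isoI)
qed

text \<open>The pair \<open>(i, a)\<close> stands for \<open>x\<^sup>i y\<^sup>a\<close>, and \<open>y\<^sup>2 = x\<^sup>e\<close>.\<close>

definition dicyclic_model :: "int \<Rightarrow> int \<Rightarrow> (int \<times> bool) monoid" where
  "dicyclic_model m e =
    \<lparr>carrier = {0..<m} \<times> UNIV,
     monoid.mult = (\<lambda>(i, a) (j, b).
       ((i + (if a then - j else j) + (if a \<and> b then e else 0)) mod m, a \<noteq> b)),
     one = (0, False)\<rparr>"

lemma group_dicyclic_model:
  assumes "m > 0" "m dvd 2 * e"
  shows "group (dicyclic_model m e)"
proof (rule groupI)
  fix x y z
  assume "x \<in> carrier (dicyclic_model m e)" "y \<in> carrier (dicyclic_model m e)"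
    "z \<in> carrier (dicyclic_model m e)"
  obtain i a j b k c where [simp]: "x = (i, a)" "y = (j, b)" "z = (k, c)"
    by (metis surj_pair)
  \<comment> \<open>Needed when all three factors lie outside the cyclic part: the two bracketings
    then differ by 2e in the exponent.\<close>
  have 1: "(e + (i + k) - j) mod m = (i + k - (e + j)) mod m"
    using assms(2) by (simp add: mod_eq_dvd_iff)
  have 2: "(u + v mod m - w) mod m = (u + v - w) mod m" for u v w
    by (metis mod_add_right_eq mod_diff_left_eq)
  show "x \<otimes>\<^bsub>dicyclic_model m e\<^esub> y \<otimes>\<^bsub>dicyclic_model m e\<^esub> z =
      x \<otimes>\<^bsub>dicyclic_model m e\<^esub> (y \<otimes>\<^bsub>dicyclic_model m e\<^esub> z)"
    by (cases a; cases b; cases c)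
      (simp_all add: dicyclic_model_def mod_simps algebra_simps 1, simp_all add: 2 algebra_simps)
next
  fix x assume "x \<in> carrier (dicyclic_model m e)"
  then obtain i a where x: "x = (i, a)" "0 \<le> i" "i < m" by (auto simp: dicyclic_model_def)
  have *: "((i - e) mod m - i + e) mod m = 0"
    using mod_diff_left_eq[of "i - e" m "i - e"] by (simp add: algebra_simps)
  show "\<exists>y\<in>carrier (dicyclic_model m e). y \<otimes>\<^bsub>dicyclic_model m e\<^esub> x = \<one>\<^bsub>dicyclic_model m e\<^esub>"
  proof (cases a)
    case True
    show ?thesis
      \<comment> \<open>From y x^i = x^(-i) y and y^2 = x^e, the product of x^(i-e) y and x^i y is
        x^(i-e-i+e) = 1.\<close>
      by (rule bexI[where x = "((i - e) mod m, True)"])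
        (use * True assms(1) in \<open>simp_all add: x dicyclic_model_def\<close>)
  next
    case False
    show ?thesis
      by (rule bexI[where x = "((- i) mod m, False)"])
        (use False assms(1) in \<open>simp_all add: x dicyclic_model_def mod_simps\<close>)
  qed
qed (use assms in \<open>auto simp: dicyclic_model_def\<close>)

lemma inverted_cyclic_dicyclic_model:
  assumes "m > 0" "m dvd 2 * e" "0 \<le> e" "e < m" "q \<longleftrightarrow> e \<noteq> 0"
  shows "inverted_cyclic q (dicyclic_model m e) ({0..<m} \<times> {False})"
proof -
  let ?G = "dicyclic_model m e"
  interpret G: group ?G by (rule group_dicyclic_model[OF assms(1,2)])
  \<comment> \<open>The reduction \<open>1 mod m\<close> keeps the generator inside the carrier also
    for \<open>m = 1\<close>, where it is 0.\<close>
  have pow: "(1 mod m, False) [^]\<^bsub>?G\<^esub> k = (int k mod m, False)" for k :: nat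
    by (induction k) (simp_all add: dicyclic_model_def mod_simps add.commute)
  show ?thesis
  proof (rule inverted_cyclicI[where x = "(1 mod m, False)"])
    show "subgroup ({0..<m} \<times> {False}) ?G"
    proof (rule G.subgroupI)
      fix a assume "a \<in> {0..<m} \<times> {False}"
      then obtain i where i: "a = (i, False)" "0 \<le> i" "i < m" by auto
      have "inv\<^bsub>?G\<^esub> a = ((- i) mod m, False)"
        by (rule G.inv_equality) (use assms(1) i in \<open>auto simp: dicyclic_model_def mod_simps\<close>)
      then show "inv\<^bsub>?G\<^esub> a \<in> {0..<m} \<times> {False}" using assms(1) by simp
    qed (use assms(1) in \<open>auto simp: dicyclic_model_def\<close>)
    show "\<exists>k::nat. z = (1 mod m, False) [^]\<^bsub>?G\<^esub> k" if z: "z \<in> {0..<m} \<times> {False}" for z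
      unfolding pow using z by (intro exI[where x = "nat (fst z)"]) auto
    show "{0..<m} \<times> {False} \<noteq> carrier ?G"
      using assms(1) by (auto simp: dicyclic_model_def)
  qed (use assms zdvd_not_zless[of e m] in \<open>auto simp: dicyclic_model_def mod_simps\<close>)
qed

section \<open>The groups of the theorem characterised by their order and an inverted cyclic
  subgroup\<close>

definition gen_group :: "bool \<Rightarrow> nat \<Rightarrow> nat \<Rightarrow> gen word set monoid" where
  "gen_group q n s = (if q then gen_quaternion n s else gen_dihedral n s)"

lemma gen_group_dicyclic:
  assumes "n \<ge> 2"
  shows "gen_group q n s =
    presented_group (dicyclic_rels (2 ^ (n - 1) * s) (if q then 2 ^ (n - 1) * s div 2 else 0))"
proof -
  obtain k where "n = Suc (Suc k)" using assms by (metis add_2_eq_Suc le_Suc_ex)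
  then show ?thesis
    by (simp add: gen_group_def gen_quaternion_def gen_dihedral_def dicyclic_rels_def)
qed

lemma group_gen_group: "group (gen_group q n s)"
  by (simp add: gen_group_def gen_quaternion_def gen_dihedral_def group_presented_group)

text \<open>The explicit model shows that the presentation does not collapse, and its cyclic part is
  carried over to \<open>J\<close>; conversely the order of \<open>J\<close> fixes
  \<open>card K\<close>, and with it the presentation. The case \<open>s = 1\<close> describes the
  Sylow 2-subgroups.\<close>

proposition iso_gen_group_iff:
  assumes "group J" "n \<ge> 2" "s > 0"
  shows "J \<cong> gen_group q n s \<longleftrightarrow> order J = 2 ^ n * s \<and> (\<exists>K. inverted_cyclic q J K)"
proof -
  interpret J: group J by fact
  interpret P: group "gen_group q n s" by (rule group_gen_group)
  define m where "m = 2 ^ (n - 1) * s"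
  define e where "e = (if q then m div 2 else 0)"
  have ord: "2 ^ n * s = 2 * m" using assms(2) by (simp add: m_def power_eq_if)
  have m: "m > 0" "even m" using assms(2,3) by (simp_all add: m_def)
  have P: "gen_group q n s = presented_group (dicyclic_rels m e)"
    unfolding m_def e_def by (rule gen_group_dicyclic[OF assms(2)])
  let ?M = "dicyclic_model (int m) (int e)" and ?K = "{0..<int m} \<times> {False}"
  have m2: "m \<ge> 2" using m by presburger
  have e: "int m > 0" "int m dvd 2 * int e" "int e < int m" "q \<longleftrightarrow> int e \<noteq> 0"
    using m m2 by (auto simp: e_def simp flip: of_nat_dvd_iff)
  interpret M: group ?M by (rule group_dicyclic_model[OF e(1,2)])
  have MK: "inverted_cyclic q ?M ?K"
    by (rule inverted_cyclic_dicyclic_model[OF e(1,2) _ e(3,4)]) simp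
  have "finite (carrier ?M)" "order ?M = 2 * m" "card ?K = m"
    by (simp_all add: dicyclic_model_def order_def card_cartesian_product)
  then have PM: "gen_group q n s \<cong> ?M"
    using M.dicyclic_presentation_iso[OF _ MK _ m(2)] unfolding P e_def by blast
  show ?thesis
  proof
    assume "J \<cong> gen_group q n s"
    then have JM: "J \<cong> ?M" using PM iso_trans by blast
    then have "order J = 2 * m" using iso_same_card[OF JM] \<open>order ?M = 2 * m\<close> by (simp add: order_def)
    moreover obtain h where "h \<in> iso ?M J" using J.iso_sym[OF JM] by (auto simp: is_iso_def)
    then have "inverted_cyclic q J (h ` ?K)"
      by (rule M.inverted_cyclic_iso[OF assms(1) _ MK])
    ultimately show "order J = 2 ^ n * s \<and> (\<exists>K. inverted_cyclic q J K)" using ord by auto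
  next
    assume "order J = 2 ^ n * s \<and> (\<exists>K. inverted_cyclic q J K)"
    then obtain K where K: "inverted_cyclic q J K" "order J = 2 * m" using ord by auto
    have fin: "finite (carrier J)" using K(2) m(1) by (simp add: order_def card_ge_0_finite)
    have "card K = m" using J.inverted_cyclic_order[OF K(1) fin] K(2) by simp
    then have "gen_group q n s \<cong> J"
      using J.dicyclic_presentation_iso[OF fin K(1) _ m(2)] unfolding P e_def by blast
    then show "J \<cong> gen_group q n s" by (rule P.iso_sym)
  qed
qed

section \<open>Inverted cyclic subgroups of 2-groups\<close>

context group
begin

lemma nat_pow_two: "x \<in> carrier G \<Longrightarrow> x [^] (2::nat) = x \<otimes> x"
  by (simp add: numeral_eq_Suc)

text \<open>If \<open>K\<close> and \<open>K'\<close> differ, a generator \<open>x\<close> of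
  \<open>K\<close> lies outside \<open>K'\<close>. Then x^4 = 1, and x^2 = 1 exactly in the dihedral
  type, while \<open>x\<close> has order 2^(n-1). This leaves only n = 3 for quaternion and n = 2
  for dihedral type.\<close>

lemma inverted_cyclic_unique:
  assumes "order G = 2 ^ n" "n \<ge> 2" "n \<noteq> (if q then 3 else 2)"
    and K: "inverted_cyclic q G K" and K': "inverted_cyclic q G K'"
  shows "K = K'"
proof (rule ccontr)
  assume ne: "K \<noteq> K'"
  have fin: "finite (carrier G)" using assms(1) by (simp add: order_def card_ge_0_finite)
  have card: "card K = 2 ^ (n - 1)" "card K' = 2 ^ (n - 1)"
    using inverted_cyclic_order[OF K fin] inverted_cyclic_order[OF K' fin] assms(1,2)
    by (simp_all add: power_eq_if)
  obtain x where x: "x \<in> K" "K = range (\<lambda>k::nat. x [^] k)" "ord x = card K"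
    using inverted_cyclic_generator[OF K fin] by blast
  interpret K: subgroup K G using K by (rule inverted_cyclicD)
  interpret K': subgroup K' G using K' by (rule inverted_cyclicD)
  have xc: "x \<in> carrier G" using x by simp
  have "x \<notin> K'"
  proof
    assume x': "x \<in> K'"
    have "x [^] k \<in> K'" for k :: nat by (induction k) (use x' in auto)
    then have "K \<subseteq> K'" using x(2) by blast
    moreover have "finite K'" using K'.subset fin by (rule finite_subset)
    ultimately show False using ne card card_subset_eq by metis
  qed
  have *: "x \<otimes> x = \<one> \<longleftrightarrow> \<not> q" "(x \<otimes> x) \<otimes> (x \<otimes> x) = \<one>"
    using inverted_cyclicD(6)[OF K' xc] inverted_cyclic_pow4[OF K' xc] \<open>x \<notin> K'\<close> by blast+
  have "x [^] (2::nat) = x \<otimes> x" "x [^] (4::nat) = (x \<otimes> x) \<otimes> (x \<otimes> x)"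
    using xc by (simp_all add: numeral_eq_Suc m_assoc)
  then have **: "2 ^ (n - 1) dvd (2::nat) \<longleftrightarrow> \<not> q" "2 ^ (n - 1) dvd (4::nat)"
    using * pow_eq_id[OF xc, of 2] pow_eq_id[OF xc, of 4] x(3) card by simp_all
  have "2 ^ (n - 1) dvd (2 ^ 2 :: nat)" using **(2) by simp
  then have "n - 1 \<le> 2" by (rule power_dvd_imp_le) simp
  then have "n = 2 \<or> n = 3" using assms(2) by auto
  then show False using ** assms(3) by (auto split: if_splits)
qed

section \<open>The exceptional groups: quaternion of order 8 and the Klein four-group\<close>

lemma inverted_cyclic_swap:
  assumes G: "order G = (if q then 8 else 4)"
    and K: "inverted_cyclic q G K"
    and x: "x \<in> K" "K = range (\<lambda>k::nat. x [^] k)" "ord x = card K"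
    and y: "y \<in> carrier G" "y \<notin> K"
  shows "x \<otimes> x = y \<otimes> y" and "inverted_cyclic q G (range (\<lambda>k::nat. y [^] k))"
proof -
  have fin: "finite (carrier G)" using G by (simp add: order_def card_ge_0_finite split: if_splits)
  interpret K: subgroup K G using K by (rule inverted_cyclicD)
  have xc: "x \<in> carrier G" using x by simp
  have cK: "card K = (if q then 4 else 2)"
    using inverted_cyclic_order[OF K fin] G by (simp split: if_splits)
  have xK: "x [^] card K = \<one>" using xc by (simp flip: x(3))
  \<comment> \<open>In order 8 both squares are the involution of \<open>K\<close>; in order 4 both
    are the unit.\<close>
  show sq: "x \<otimes> x = y \<otimes> y"
    using inverted_cyclic_square[OF fin K x _ y] xK xc cK
    by (cases q) (simp_all add: nat_pow_two)
  have y4: "(y \<otimes> y) \<otimes> (y \<otimes> y) = \<one>" by (rule inverted_cyclic_pow4[OF K y])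
  have pow_sq: "x [^] (2 * l) = y [^] (2 * l)" for l :: nat
    using xc y sq by (simp add: nat_pow_two flip: nat_pow_pow)
  let ?K = "range (\<lambda>k::nat. y [^] k)"
  \<comment> \<open>Since even powers of \<open>x\<close> and of \<open>y\<close> agree, every
    element is a power of \<open>y\<close> or \<open>x\<close> times one.\<close>
  have cosets: "\<exists>j::nat. u = x \<otimes> y [^] j" if u: "u \<in> carrier G" "u \<notin> ?K" for u
  proof -
    have split: "x [^] i \<in> ?K \<or> (\<exists>j::nat. x [^] i = x \<otimes> y [^] j)" for i :: nat
    proof (cases "even i")
      case True
      then show ?thesis using pow_sq by (auto elim!: evenE)
    next
      case False
      then obtain l where "i = Suc (2 * l)" by (auto elim!: oddE)
      then have "x [^] i = x \<otimes> y [^] (2 * l)"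
        using nat_pow_Suc2[OF xc, of "2 * l"] pow_sq by simp
      then show ?thesis by blast
    qed
    show ?thesis
    proof (cases "u \<in> K")
      case True
      then show ?thesis using split u x(2) by blast
    next
      case False
      then have "u \<in> (\<lambda>x. x \<otimes> y) ` K"
        using inverted_cyclic_coset[OF K y] u by blast
      then obtain i :: nat where i: "u = x [^] i \<otimes> y" using x(2) by blast
      from split[of i] show ?thesis
      proof
        assume "x [^] i \<in> ?K"
        then obtain j :: nat where "x [^] i = y [^] j" by blast
        then have "u = y [^] Suc j" using i by simp
        then show ?thesis using u by blast
      next
        assume "\<exists>j::nat. x [^] i = x \<otimes> y [^] j"
        then obtain j :: nat where "x [^] i = x \<otimes> y [^] j" by blast
        then have "u = x \<otimes> y [^] Suc j" using i xc y by (simp add: m_assoc)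
        then show ?thesis by blast
      qed
    qed
  qed
  \<comment> \<open>The roles of \<open>x\<close> and \<open>y\<close> are exchanged here: replacing
    the first \<open>y\<close> by \<open>x \<otimes> y \<otimes> x\<close> turns the product into x
    y^4.\<close>
  have yxy: "y \<otimes> x \<otimes> y = x"
  proof -
    have y_eq: "x \<otimes> y \<otimes> x = y" by (rule inverted_cyclicD(5)[OF K x(1) y])
    have "y \<otimes> x \<otimes> y = (x \<otimes> y \<otimes> x) \<otimes> x \<otimes> y" by (simp only: y_eq)
    also have "\<dots> = x \<otimes> y \<otimes> (x \<otimes> x) \<otimes> y" using xc y by (simp add: m_assoc)
    also have "\<dots> = x \<otimes> ((y \<otimes> y) \<otimes> (y \<otimes> y))" using xc y by (simp add: m_assoc sq)
    finally show ?thesis using xc y4 by simp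
  qed
  have yxyj: "y [^] j \<otimes> x \<otimes> y [^] j = x" for j :: nat
  proof (induction j)
    case (Suc j)
    have "y [^] Suc j \<otimes> x \<otimes> y [^] Suc j = (y [^] j \<otimes> y) \<otimes> x \<otimes> (y \<otimes> y [^] j)"
      using nat_pow_Suc2[OF y(1), of j] by simp
    also have "\<dots> = y [^] j \<otimes> (y \<otimes> x \<otimes> y) \<otimes> y [^] j"
      using xc y by (simp add: m_assoc)
    finally have "y [^] Suc j \<otimes> x \<otimes> y [^] Suc j = y [^] j \<otimes> (y \<otimes> x \<otimes> y) \<otimes> y [^] j" .
    then show ?case using Suc yxy by simp
  qed (use xc in simp)
  have xyj: "x \<otimes> y [^] j = inv (y [^] j) \<otimes> x" for j :: nat
  proof -
    have "inv (y [^] j) \<otimes> (y [^] j \<otimes> x \<otimes> y [^] j) = x \<otimes> y [^] j"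
      using xc y by (simp add: m_assoc[symmetric])
    then show ?thesis by (simp add: yxyj)
  qed
  have prod: "(x \<otimes> y [^] j) \<otimes> (x \<otimes> y [^] k) = inv (y [^] j) \<otimes> (y [^] k \<otimes> (y \<otimes> y))" for j k :: nat
  proof -
    have "(x \<otimes> y [^] j) \<otimes> (x \<otimes> y [^] k) = inv (y [^] j) \<otimes> ((x \<otimes> x) \<otimes> y [^] k)"
      using xc y by (simp add: xyj[of j] m_assoc)
    also have "(x \<otimes> x) \<otimes> y [^] k = y [^] k \<otimes> (y \<otimes> y)"
      using y nat_pow_comm[of y 2 k] by (simp add: sq nat_pow_two)
    finally show ?thesis .
  qed
  have sub: "subgroup ?K G"
  proof -
    have "ord y \<noteq> 0" using ord_ge_1[OF fin y(1)] by simp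
    then have "generate G {y} = ?K"
      using generate_pow_nat[OF y(1)] by auto
    moreover have "subgroup (generate G {y}) G"
      using y(1) by (intro generate_is_subgroup) simp
    ultimately show ?thesis by simp
  qed
  then interpret K': subgroup ?K G .
  show "inverted_cyclic q G ?K"
  proof (rule inverted_cyclicI[where x = y])
    have "y = y [^] (1::nat)" using y by simp
    then show "y \<in> ?K" by blast
    \<comment> \<open>The order of \<open>y\<close> is thus at most \<open>card K\<close>, half the
      order of the group, so the powers of \<open>y\<close> form a proper subgroup.\<close>
    have "y [^] card K = \<one>"
      using cK y4 y inverted_cyclicD(6)[OF K y] by (simp add: numeral_eq_Suc m_assoc)
    then have "ord y dvd card K" using pow_eq_id[OF y(1)] by simp
    then have "ord y \<le> card K" using cK by (intro dvd_imp_le) auto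
    moreover have "card ?K = ord y"
      using generate_pow_card[OF y(1)] generate_pow_nat[OF y(1)] ord_ge_1[OF fin y(1)]
      by (simp add: full_SetCompr_eq)
    ultimately show "?K \<noteq> carrier G" using G cK by (auto simp: order_def split: if_splits)
  next
    fix u v assume "u \<in> carrier G" "u \<notin> ?K" "v \<in> carrier G" "v \<notin> ?K"
    then obtain j k :: nat where "u = x \<otimes> y [^] j" "v = x \<otimes> y [^] k" using cosets by meson
    moreover have "y [^] k \<otimes> (y \<otimes> y) = y [^] Suc (Suc k)" using y by (simp add: m_assoc)
    ultimately show "u \<otimes> v \<in> ?K"
      unfolding prod by (metis K'.m_closed K'.m_inv_closed prod rangeI)
  next
    fix a u assume "a \<in> ?K" "u \<in> carrier G" "u \<notin> ?K"
    then obtain j k :: nat where jk: "a = y [^] j" "u = x \<otimes> y [^] k" using cosets by blast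
    have "a \<otimes> u \<otimes> a = y [^] j \<otimes> x \<otimes> (y [^] k \<otimes> y [^] j)"
      using xc y by (simp add: jk m_assoc)
    also have "\<dots> = (y [^] j \<otimes> x \<otimes> y [^] j) \<otimes> y [^] k"
      using xc y nat_pow_comm[of y k j] by (simp add: m_assoc)
    finally show "a \<otimes> u \<otimes> a = u" by (simp add: yxyj jk)
  next
    fix u assume "u \<in> carrier G" "u \<notin> ?K"
    then obtain k :: nat where k: "u = x \<otimes> y [^] k" using cosets by blast
    have "u \<otimes> u = y \<otimes> y" unfolding k prod using y by (simp add: m_assoc[symmetric])
    then show "u \<otimes> u = \<one> \<longleftrightarrow> \<not> q" using inverted_cyclicD(6)[OF K y] by simp
  qed (use sub in auto)
qed

text \<open>The three subgroups are generated by \<open>x\<close>, \<open>y\<close> and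
  \<open>x \<otimes> y\<close>: the groups of i, j, k in the quaternion group, and of the three
  involutions in the Klein group. All have equal order, so containing a generator of another one
  forces equality.\<close>

lemma card_inverted_cyclic:
  assumes G: "order G = (if q then 8 else 4)" and K: "inverted_cyclic q G K"
  shows "card {K. inverted_cyclic q G K} = 3"
proof -
  have fin: "finite (carrier G)" using G by (simp add: order_def card_ge_0_finite split: if_splits)
  interpret K: subgroup K G using K by (rule inverted_cyclicD)
  obtain x where x: "x \<in> K" "K = range (\<lambda>k::nat. x [^] k)" "ord x = card K"
    using inverted_cyclic_generator[OF K fin] by blast
  have xc: "x \<in> carrier G" using x by simp
  obtain y where y: "y \<in> carrier G" "y \<notin> K" using inverted_cyclicD(3)[OF K] by blast
  have "x \<otimes> y \<in> carrier G - K"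
    unfolding inverted_cyclic_coset[OF K y] using x(1) by blast
  then have xy: "x \<otimes> y \<in> carrier G" "x \<otimes> y \<notin> K" by auto
  let ?C = "\<lambda>g. range (\<lambda>k::nat. g [^] k)"
  note y' = inverted_cyclic_swap[OF G K x y] and xy' = inverted_cyclic_swap[OF G K x xy]
  have pow: "g \<in> ?C g" if "g \<in> carrier G" for g
    using that by (metis nat_pow_eone rangeI)
  have eqI: "L = L'" if L: "inverted_cyclic q G L" "inverted_cyclic q G L'" "L = ?C g" "g \<in> L'" for L L' g
  proof -
    interpret L': subgroup L' G using L(2) by (rule inverted_cyclicD)
    have "g [^] k \<in> L'" for k :: nat by (induction k) (use L(4) in auto)
    then have "L \<subseteq> L'" using L(3) by blast
    moreover have "card L = card L'"
      using inverted_cyclic_order[OF L(1) fin] inverted_cyclic_order[OF L(2) fin] by simp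
    moreover have "finite L'" using L'.subset fin by (rule finite_subset)
    ultimately show ?thesis using card_subset_eq by blast
  qed
  have "{K. inverted_cyclic q G K} = {K, ?C y, ?C (x \<otimes> y)}"
  proof (intro equalityI subsetI)
    fix L assume "L \<in> {K. inverted_cyclic q G K}"
    then have L: "inverted_cyclic q G L" by simp
    obtain g where g: "g \<in> L" "L = ?C g" using inverted_cyclic_generator[OF L fin] by blast
    have gc: "g \<in> carrier G"
      using g(1) subgroup.mem_carrier[OF inverted_cyclicD(1)[OF L]] by blast
    show "L \<in> {K, ?C y, ?C (x \<otimes> y)}"
    proof (cases "g \<in> K")
      case True
      then show ?thesis using eqI[OF L K g(2)] by simp
    next
      case False
      then have "g \<in> (\<lambda>x. x \<otimes> y) ` K"
        using inverted_cyclic_coset[OF K y] gc by blast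
      then obtain i :: nat where i: "g = x [^] i \<otimes> y" using x(2) by blast
      \<comment> \<open>Because \<open>x\<close>, \<open>y\<close> and \<open>x \<otimes> y\<close>
        have the same square, the parity of \<open>i\<close> decides whether \<open>g\<close> is a
        power of \<open>y\<close> or of \<open>x \<otimes> y\<close>.\<close>
      have sq: "x [^] (2 * l) = u [^] (2 * l)" if "x \<otimes> x = u \<otimes> u" "u \<in> carrier G" for u and l :: nat
        using xc that by (simp add: nat_pow_two flip: nat_pow_pow)
      show ?thesis
      proof (cases "even i")
        case True
        then obtain l where "i = 2 * l" by (rule evenE)
        then have "g = y [^] Suc (2 * l)" using i sq[OF y'(1) y(1)] by simp
        then have "g \<in> ?C y" by blast
        then show ?thesis using eqI[OF L y'(2) g(2)] by simp
      next
        case False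
        then obtain l where "i = Suc (2 * l)" by (auto elim!: oddE)
        then have "g = x [^] (2 * l) \<otimes> (x \<otimes> y)" using i xc y by (simp add: m_assoc)
        then have "g = (x \<otimes> y) [^] Suc (2 * l)" using sq[OF xy'(1) xy(1)] by simp
        then have "g \<in> ?C (x \<otimes> y)" by blast
        then show ?thesis using eqI[OF L xy'(2) g(2)] by simp
      qed
    qed
  qed (use K y' xy' in auto)
  moreover have "K \<noteq> ?C y" "K \<noteq> ?C (x \<otimes> y)" using y xy pow by blast+
  moreover have "?C y \<noteq> ?C (x \<otimes> y)"
  proof
    assume eq: "?C y = ?C (x \<otimes> y)"
    interpret Y: subgroup "?C y" G using y'(2) by (rule inverted_cyclicD)
    have "(x \<otimes> y) \<otimes> inv y \<in> ?C y" using pow[OF xy(1)] pow[OF y(1)] eq by blast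
    then have "x \<in> ?C y" using xc y by (simp add: m_assoc)
    then have "K = ?C y" using eqI[OF K y'(2) x(2)] by simp
    then show False using pow[OF y(1)] y by blast
  qed
  ultimately show ?thesis by simp
qed

text \<open>\<open>K\<close> has order 2^(n-1) s with s odd, which 2^n does not divide; by Lagrange
  the Sylow subgroup is not contained in \<open>K\<close>, and restriction applies.\<close>

lemma sylow_inverted_cyclic:
  assumes "order G = 2 ^ n * s" "odd s" "n \<ge> 1" "sylow_subgroup 2 G H" "inverted_cyclic q G K"
  shows "order (G\<lparr>carrier := H\<rparr>) = 2 ^ n" "inverted_cyclic q (G\<lparr>carrier := H\<rparr>) (H \<inter> K)"
proof -
  have s: "s > 0" using assms(2) by (cases s) auto
  have fin: "finite (carrier G)"
    using assms(1) s by (simp add: order_def card_ge_0_finite)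
  have "multiplicity 2 (2 ^ n * s) = n"
    using assms(2) s by (subst prime_elem_multiplicity_mult_distrib) (auto simp: not_dvd_imp_multiplicity_0)
  then have H: "subgroup H G" "card H = 2 ^ n"
    using assms(1,4) by (auto simp: sylow_subgroup_def)
  then show "order (G\<lparr>carrier := H\<rparr>) = 2 ^ n" by (simp add: order_def)
  note K = inverted_cyclicD(1)[OF assms(5)]
  have cK: "card K = 2 ^ (n - 1) * s"
    using inverted_cyclic_order[OF assms(5) fin] assms(1,3) by (simp add: power_eq_if)
  have "\<not> H \<subseteq> K"
  proof
    assume "H \<subseteq> K"
    interpret K: group "G\<lparr>carrier := K\<rparr>" using K by (rule subgroup.subgroup_is_group) unfold_locales
    have "subgroup H (G\<lparr>carrier := K\<rparr>)" using H(1) K \<open>H \<subseteq> K\<close> by (rule subgroup_incl)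
    then have "card H dvd card K"
      using K.lagrange[of H] by (simp add: order_def) (metis dvd_triv_right)
    moreover obtain k where "n = Suc k" using assms(3) by (cases n) auto
    ultimately have "2 dvd s" using H cK by (simp add: mult.commute)
    then show False using assms(2) by simp
  qed
  then show "inverted_cyclic q (G\<lparr>carrier := H\<rparr>) (H \<inter> K)"
    using inverted_cyclic_restrict[OF fin assms(5) H(1)] by blast
qed

end

section \<open>Braces on a fixed additive group\<close>

text \<open>The zero and the one of a brace coincide (\<open>one_eq_zero\<close> below), so both are the unit of \<open>N\<close>.\<close>

definition brace_ring :: "('a, 'm) monoid_scheme \<Rightarrow> ('a \<Rightarrow> 'a \<Rightarrow> 'a) \<Rightarrow> 'a ring" where
  "brace_ring N c =
    \<lparr>carrier = carrier N, monoid.mult = c, one = \<one>\<^bsub>N\<^esub>, ring.zero = \<one>\<^bsub>N\<^esub>, ring.add = monoid.mult N\<rparr>"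

lemma brace_ring_simps [simp]:
  "carrier (brace_ring N c) = carrier N" "monoid.mult (brace_ring N c) = c"
  "one (brace_ring N c) = \<one>\<^bsub>N\<^esub>" "ring.zero (brace_ring N c) = \<one>\<^bsub>N\<^esub>"
  "ring.add (brace_ring N c) = monoid.mult N"
  by (simp_all add: brace_ring_def)

text \<open>Extensionality in both arguments makes each operation on the carrier a single function,
  in accordance with the extensional permutations of \<open>holomorph\<close>, so that operations
  can be counted.\<close>

definition brace_ops :: "('a, 'm) monoid_scheme \<Rightarrow> ('a \<Rightarrow> 'a \<Rightarrow> 'a) set" where
  "brace_ops N = {c \<in> carrier N \<rightarrow>\<^sub>E (carrier N \<rightarrow>\<^sub>E carrier N). brace (brace_ring N c)}"

lemma a_inv_brace_ring: "a_inv (brace_ring N c) = m_inv N"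
  by (rule ext) (simp add: a_inv_def m_inv_def)

lemma comm_group_add_monoid_brace_ring:
  assumes "comm_group N"
  shows "comm_group (add_monoid (brace_ring N c))"
proof -
  interpret comm_group N by fact
  show ?thesis
    by (rule comm_groupI) (auto simp: m_assoc intro: m_comm l_inv_ex)
qed

lemma brace_ring_iff:
  assumes "comm_group N"
  shows "brace (brace_ring N c) \<longleftrightarrow> group (brace_ring N c) \<and>
    (\<forall>a\<in>carrier N. \<forall>b\<in>carrier N. \<forall>d\<in>carrier N.
       c a (b \<otimes>\<^bsub>N\<^esub> d) = c a b \<otimes>\<^bsub>N\<^esub> inv\<^bsub>N\<^esub> a \<otimes>\<^bsub>N\<^esub> c a d)"
  using comm_group_add_monoid_brace_ring[OF assms, of c]
  by (auto simp: brace_def brace_axioms_def abelian_group_def abelian_monoid_def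
      abelian_group_axioms_def comm_group.axioms a_minus_def a_inv_brace_ring)

locale brace_operation = comm_group N for N (structure) +
  fixes c
  assumes group_op: "group (brace_ring N c)"
    and op_law: "\<lbrakk>a \<in> carrier N; b \<in> carrier N; d \<in> carrier N\<rbrakk>
      \<Longrightarrow> c a (b \<otimes> d) = c a b \<otimes> inv a \<otimes> c a d"
begin

sublocale C: group "brace_ring N c"
  rewrites "carrier (brace_ring N c) = carrier N" and "monoid.mult (brace_ring N c) = c"
    and "one (brace_ring N c) = \<one>"
  by (rule group_op) simp_all

section \<open>The action of the circle group on the additive group\<close>

definition lam :: "'a \<Rightarrow> 'a \<Rightarrow> 'a" where
  "lam a x = inv a \<otimes> c a x"

lemma lam_closed [simp]: "a \<in> carrier N \<Longrightarrow> x \<in> carrier N \<Longrightarrow> lam a x \<in> carrier N"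
  by (simp add: lam_def)

lemma op_eq_lam: "a \<in> carrier N \<Longrightarrow> x \<in> carrier N \<Longrightarrow> c a x = a \<otimes> lam a x"
  by (simp add: lam_def m_assoc[symmetric])

lemma lam_mult:
  "\<lbrakk>a \<in> carrier N; x \<in> carrier N; y \<in> carrier N\<rbrakk> \<Longrightarrow> lam a (x \<otimes> y) = lam a x \<otimes> lam a y"
  by (simp add: lam_def op_law m_assoc)

text \<open>Associativity of \<open>c\<close>: expand both bracketings of \<open>c a b\<close>
  applied to \<open>x\<close> through \<open>op_eq_lam\<close>, and cancel
  \<open>c a b\<close>.\<close>

lemma lam_op:
  assumes "a \<in> carrier N" "b \<in> carrier N" "x \<in> carrier N"
  shows "lam (c a b) x = lam a (lam b x)"
proof -
  have "c a b \<otimes> lam (c a b) x = c (c a b) x"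
    using assms by (simp add: op_eq_lam)
  also have "\<dots> = c a (c b x)" using assms by (simp add: C.m_assoc)
  also have "\<dots> = a \<otimes> lam a (b \<otimes> lam b x)" using assms by (simp add: op_eq_lam)
  also have "\<dots> = c a b \<otimes> lam a (lam b x)" using assms by (simp add: lam_mult op_eq_lam m_assoc)
  finally show ?thesis using assms by simp
qed

lemma lam_one_left [simp]: "x \<in> carrier N \<Longrightarrow> lam \<one> x = x"
  by (simp add: lam_def)

lemma lam_hom: "a \<in> carrier N \<Longrightarrow> lam a \<in> hom N N"
  by (rule homI) (simp_all add: lam_mult)

lemma lam_one [simp]: "a \<in> carrier N \<Longrightarrow> lam a \<one> = \<one>"
  by (rule hom_one[OF lam_hom]) unfold_locales

lemma lam_pow: "a \<in> carrier N \<Longrightarrow> x \<in> carrier N \<Longrightarrow> lam a (x [^] (k::nat)) = lam a x [^] k"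
  by (induction k) (simp_all add: lam_mult)

lemma bij_op: "a \<in> carrier N \<Longrightarrow> bij_betw (c a) (carrier N) (carrier N)"
  by (rule bij_betw_byWitness[where f' = "c (inv\<^bsub>brace_ring N c\<^esub> a)"])
    (auto simp flip: C.m_assoc)

end

lemma brace_operation_iff:
  assumes "comm_group N"
  shows "brace_operation N c \<longleftrightarrow> brace (brace_ring N c)"
  using assms by (auto simp: brace_operation_def brace_operation_axioms_def brace_ring_iff)

section \<open>Regular subgroups of the holomorph\<close>

text \<open>The holomorph consists of the affine bijections: \<open>g \<one>\<close> is the
  translation part, and removing it leaves an automorphism. For a map sending the unit to
  \<open>a\<close>, the identity is literally the brace law for \<open>c a\<close>.\<close>

lemma (in comm_group) carrier_holomorph:
  "carrier (holomorph G) = {g \<in> Bij (carrier G).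
     \<forall>b\<in>carrier G. \<forall>d\<in>carrier G. g (b \<otimes> d) = g b \<otimes> inv (g \<one>) \<otimes> g d}" (is "_ = ?R")
proof (intro equalityI subsetI)
  fix g assume "g \<in> carrier (holomorph G)"
  then obtain a f where g: "g = (\<lambda>x\<in>carrier G. a \<otimes> f x)" "a \<in> carrier G" "f \<in> auto G"
    by (auto simp: holomorph_def)
  then have f: "f \<in> hom G G" "bij_betw f (carrier G) (carrier G)"
    by (auto simp: auto_def Bij_def)
  have fc: "f x \<in> carrier G" if "x \<in> carrier G" for x using f(1) that by (rule hom_in_carrier)
  have f1: "f \<one> = \<one>" using hom_one[OF f(1)] is_group by blast
  have "bij_betw (\<lambda>y. a \<otimes> y) (carrier G) (carrier G)"
    using g(2) by (intro bij_betw_byWitness[where f' = "\<lambda>y. inv a \<otimes> y"]) (auto simp flip: m_assoc)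
  then have "bij_betw ((\<lambda>y. a \<otimes> y) \<circ> f) (carrier G) (carrier G)"
    by (rule bij_betw_trans[OF f(2)])
  then have "bij_betw g (carrier G) (carrier G)"
    by (rule iffD1[OF bij_betw_cong, rotated]) (simp add: g(1))
  moreover have "g (b \<otimes> d) = g b \<otimes> inv (g \<one>) \<otimes> g d" if "b \<in> carrier G" "d \<in> carrier G" for b d
  proof -
    have "(a \<otimes> f b) \<otimes> inv a \<otimes> (a \<otimes> f d) = a \<otimes> (f b \<otimes> (inv a \<otimes> (a \<otimes> f d)))"
      using g(2) fc that by (simp add: m_assoc)
    also have "inv a \<otimes> (a \<otimes> f d) = f d" using g(2) fc that by (simp add: m_assoc[symmetric])
    finally show ?thesis using that g(2) fc by (simp add: g(1) f1 hom_mult[OF f(1)])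
  qed
  ultimately show "g \<in> ?R" by (simp add: Bij_def g(1))
next
  fix g assume g: "g \<in> ?R"
  then have bij: "bij_betw g (carrier G) (carrier G)" and ext: "g \<in> extensional (carrier G)"
    by (auto simp: Bij_def)
  have gc: "g x \<in> carrier G" if "x \<in> carrier G" for x using bij_betwE[OF bij] that by blast
  define f where "f = (\<lambda>x\<in>carrier G. inv (g \<one>) \<otimes> g x)"
  have "bij_betw (\<lambda>y. inv (g \<one>) \<otimes> y) (carrier G) (carrier G)"
    using gc by (intro bij_betw_byWitness[where f' = "\<lambda>y. g \<one> \<otimes> y"]) (auto simp flip: m_assoc)
  then have "bij_betw ((\<lambda>y. inv (g \<one>) \<otimes> y) \<circ> g) (carrier G) (carrier G)"
    by (rule bij_betw_trans[OF bij])
  then have "bij_betw f (carrier G) (carrier G)"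
    by (rule iffD1[OF bij_betw_cong, rotated]) (simp add: f_def)
  moreover have "f \<in> hom G G"
    by (rule homI) (use g gc in \<open>auto simp: f_def m_assoc\<close>)
  ultimately have "f \<in> auto G" by (simp add: auto_def Bij_def f_def)
  moreover have "g = (\<lambda>x\<in>carrier G. g \<one> \<otimes> f x)"
    using ext gc by (intro extensionalityI[where A = "carrier G"]) (auto simp: f_def simp flip: m_assoc)
  ultimately show "g \<in> carrier (holomorph G)"
    using gc[OF one_closed] by (auto simp: holomorph_def)
qed

text \<open>Affine maps preserve the ternary operation x - y + z with any base point y. In this form
  closure under composition and inverses is a direct substitution.\<close>

lemma (in comm_group) holomorph_heap:
  assumes "g \<in> carrier (holomorph G)" "x \<in> carrier G" "y \<in> carrier G" "z \<in> carrier G"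
  shows "g (x \<otimes> inv y \<otimes> z) = g x \<otimes> inv (g y) \<otimes> g z"
proof -
  have gc: "g u \<in> carrier G" if "u \<in> carrier G" for u
    using assms(1) that Bij_imp_funcset[of g "carrier G"] by (auto simp: carrier_holomorph)
  have split: "g (u \<otimes> v) = g u \<otimes> inv (g \<one>) \<otimes> g v" if "u \<in> carrier G" "v \<in> carrier G" for u v
    using assms(1) that by (simp add: carrier_holomorph)
  have "x = (x \<otimes> inv y) \<otimes> y" using assms by (simp add: m_assoc)
  then have "g x = g (x \<otimes> inv y) \<otimes> inv (g \<one>) \<otimes> g y" using split[of "x \<otimes> inv y" y] assms by simp
  then have "g x \<otimes> inv (g y) = g (x \<otimes> inv y) \<otimes> inv (g \<one>)"
    using gc assms by (simp add: m_assoc)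
  then show ?thesis using split[of "x \<otimes> inv y" z] assms by simp
qed

lemma mult_holomorph:
  "g \<in> Bij (carrier G) \<Longrightarrow> h \<in> Bij (carrier G) \<Longrightarrow> g \<otimes>\<^bsub>holomorph G\<^esub> h = compose (carrier G) g h"
  by (simp add: holomorph_def BijGroup_def)

lemma one_holomorph: "\<one>\<^bsub>holomorph G\<^esub> = (\<lambda>x\<in>carrier G. x)"
  by (simp add: holomorph_def BijGroup_def)

lemma (in comm_group) subgroup_holomorph:
  "subgroup (carrier (holomorph G)) (BijGroup (carrier G))"
proof (rule group.subgroupI[OF group_BijGroup])
  show "carrier (holomorph G) \<subseteq> carrier (BijGroup (carrier G))"
    by (auto simp: carrier_holomorph BijGroup_def)
  have "(\<lambda>x\<in>carrier G. x) \<in> carrier (holomorph G)"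
    by (simp add: carrier_holomorph id_Bij m_assoc)
  then show "carrier (holomorph G) \<noteq> {}" by blast
next
  fix g h assume gh: "g \<in> carrier (holomorph G)" "h \<in> carrier (holomorph G)"
  have B: "g \<in> Bij (carrier G)" "h \<in> Bij (carrier G)" using gh by (auto simp: carrier_holomorph)
  have hc: "h x \<in> carrier G" if "x \<in> carrier G" for x
    using that Bij_imp_funcset[OF B(2)] by auto
  have "g (h (b \<otimes> d)) = g (h b) \<otimes> inv (g (h \<one>)) \<otimes> g (h d)" if "b \<in> carrier G" "d \<in> carrier G" for b d
  proof -
    have "h (b \<otimes> d) = h b \<otimes> inv (h \<one>) \<otimes> h d" using gh that by (simp add: carrier_holomorph)
    then show ?thesis using gh hc that by (simp add: holomorph_heap)
  qed
  then have "compose (carrier G) g h \<in> carrier (holomorph G)"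
    using compose_Bij[OF B] by (simp add: carrier_holomorph compose_eq)
  then show "g \<otimes>\<^bsub>BijGroup (carrier G)\<^esub> h \<in> carrier (holomorph G)"
    using B by (simp add: BijGroup_def)
next
  fix g assume g: "g \<in> carrier (holomorph G)"
  then have B: "g \<in> Bij (carrier G)" by (simp add: carrier_holomorph)
  define k where "k = (\<lambda>x\<in>carrier G. inv_into (carrier G) g x)"
  have k: "k \<in> Bij (carrier G)" unfolding k_def by (rule restrict_inv_into_Bij[OF B])
  have kc: "k x \<in> carrier G" if "x \<in> carrier G" for x
    using that Bij_imp_funcset[OF k] by auto
  have gk: "g (k x) = x" if "x \<in> carrier G" for x
    using B that by (simp add: k_def Bij_def bij_betw_inv_into_right[of g "carrier G" "carrier G"])
  have kg: "k (g x) = x" if "x \<in> carrier G" for x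
    using B that Bij_imp_funcset[OF B] by (auto simp: k_def Bij_def bij_betw_inv_into_left[of g "carrier G" "carrier G"])
  have "k (b \<otimes> d) = k b \<otimes> inv (k \<one>) \<otimes> k d" if "b \<in> carrier G" "d \<in> carrier G" for b d
  proof -
    \<comment> \<open>Applying \<open>g\<close> to the claimed value and using
      \<open>g (k \<one>) = \<one>\<close> reduces the identity for \<open>k\<close> to the one for
      \<open>g\<close>.\<close>
    have "g (k b \<otimes> inv (k \<one>) \<otimes> k d) = b \<otimes> d"
      using that by (simp add: holomorph_heap[OF g] kc gk)
    then show ?thesis using that kc kg[of "k b \<otimes> inv (k \<one>) \<otimes> k d"] by simp
  qed
  then have "k \<in> carrier (holomorph G)" using k by (simp add: carrier_holomorph)
  then show "inv\<^bsub>BijGroup (carrier G)\<^esub> g \<in> carrier (holomorph G)"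
    using inv_BijGroup[OF B] by (simp add: k_def)
qed

lemma (in comm_group) group_holomorph: "group (holomorph G)"
proof -
  have "holomorph G = BijGroup (carrier G) \<lparr>carrier := carrier (holomorph G)\<rparr>"
    by (simp add: holomorph_def)
  then show ?thesis
    using subgroup.subgroup_is_group[OF subgroup_holomorph group_BijGroup] by simp
qed

section \<open>Correspondence between brace operations and regular subgroups\<close>

lemma brace_opsD:
  assumes "comm_group N" "c \<in> brace_ops N"
  shows "brace_operation N c" "c \<in> extensional (carrier N)"
    "\<And>a. a \<in> carrier N \<Longrightarrow> c a \<in> extensional (carrier N)"
  using assms by (auto simp: brace_ops_def brace_operation_iff PiE_def Pi_def)

lemma brace_opsI:
  assumes "brace_operation N c" "c \<in> extensional (carrier N)"
    "\<And>a. a \<in> carrier N \<Longrightarrow> c a \<in> extensional (carrier N)"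
  shows "c \<in> brace_ops N"
proof -
  interpret brace_operation N c by fact
  show ?thesis
    using assms brace_operation_iff[OF comm_group_axioms, of c] by (auto simp: brace_ops_def PiE_def)
qed

context brace_operation
begin

lemma op_in_holomorph:
  assumes "c \<in> brace_ops N" "a \<in> carrier N"
  shows "c a \<in> carrier (holomorph N)"
  using assms bij_op[of a] brace_opsD(3)[OF comm_group_axioms assms]
  by (simp add: carrier_holomorph Bij_def op_law)

lemma mult_holomorph_op:
  assumes "c \<in> brace_ops N" "a \<in> carrier N" "b \<in> carrier N"
  shows "c a \<otimes>\<^bsub>holomorph N\<^esub> c b = c (c a b)"
proof -
  have "c a \<in> Bij (carrier N)" "c b \<in> Bij (carrier N)"
    using op_in_holomorph[OF assms(1)] assms(2,3) by (auto simp: carrier_holomorph)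
  then have "c a \<otimes>\<^bsub>holomorph N\<^esub> c b = compose (carrier N) (c a) (c b)"
    by (rule mult_holomorph)
  also have "\<dots> = c (c a b)"
    using assms brace_opsD(3)[OF comm_group_axioms assms(1), of "c a b"]
    by (intro extensionalityI[where A = "carrier N"]) (auto simp: compose_eq C.m_assoc)
  finally show ?thesis .
qed

text \<open>\<open>c\<close> is Cayley's left regular representation of the circle group; the
  element taking x to y is translation by the circle product of y and the circle inverse of
  x.\<close>

lemma regular_subgroup_op:
  assumes "c \<in> brace_ops N"
  shows "subgroup (c ` carrier N) (holomorph N)" "regular_on (carrier N) (c ` carrier N)"
    and "c \<in> iso (brace_ring N c) ((holomorph N)\<lparr>carrier := c ` carrier N\<rparr>)"
proof -
  interpret H: group "holomorph N" by (rule group_holomorph)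
  have hom: "c \<in> hom (brace_ring N c) (holomorph N)"
    using assms by (intro homI) (simp_all add: op_in_holomorph mult_holomorph_op)
  interpret h: group_hom "brace_ring N c" "holomorph N" c
    by unfold_locales (use hom in simp)
  show "subgroup (c ` carrier N) (holomorph N)"
    using h.img_is_subgroup by simp
  have "inj_on c (carrier N)"
    by (rule inj_onI) (metis C.r_one)
  then show "c \<in> iso (brace_ring N c) ((holomorph N)\<lparr>carrier := c ` carrier N\<rparr>)"
    using assms by (auto simp: iso_def bij_betw_def hom_def mult_holomorph_op)
  show "regular_on (carrier N) (c ` carrier N)"
    unfolding regular_on_def
  proof (intro ballI)
    fix x y assume xy: "x \<in> carrier N" "y \<in> carrier N"
    let ?a = "c y (inv\<^bsub>brace_ring N c\<^esub> x)"
    show "\<exists>!g. g \<in> c ` carrier N \<and> g x = y"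
    proof (rule ex1I[of _ "c ?a"])
      show "c ?a \<in> c ` carrier N \<and> c ?a x = y" using xy by (simp add: C.m_assoc del: h.hom_inv)
    next
      fix g assume "g \<in> c ` carrier N \<and> g x = y"
      then obtain a where "a \<in> carrier N" "g = c a" "c a x = y" by blast
      then show "g = c ?a" using xy by (auto simp: C.m_assoc simp del: h.hom_inv)
    qed
  qed
qed

end

text \<open>Regularity labels each member of \<open>H\<close> by its value at the unit. A composite
  of two members is again in \<open>H\<close>, and its label is \<open>c a b\<close>; uniqueness of
  labels therefore gives associativity.\<close>

lemma (in comm_group) regular_subgroup_obtains_op:
  assumes sub: "subgroup H (holomorph G)" and reg: "regular_on (carrier G) H"
  obtains c where "c \<in> brace_ops G" "H = c ` carrier G"
proof -
  interpret Hol: group "holomorph G" by (rule group_holomorph)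
  interpret H: subgroup H "holomorph G" by fact
  have HB: "g \<in> Bij (carrier G)" if "g \<in> H" for g
    using H.subset that by (auto simp: carrier_holomorph)
  have Hc: "g x \<in> carrier G" if "g \<in> H" "x \<in> carrier G" for g x
    using Bij_imp_funcset[OF HB[OF that(1)]] that(2) by auto
  have ex1: "\<exists>!g. g \<in> H \<and> g x = y" if "x \<in> carrier G" "y \<in> carrier G" for x y
    using reg that by (auto simp: regular_on_def)
  define c where "c = (\<lambda>a\<in>carrier G. THE g. g \<in> H \<and> g \<one> = a)"
  have c: "c a \<in> H" "c a \<one> = a" if "a \<in> carrier G" for a
    using theI'[OF ex1[OF one_closed that]] that by (auto simp: c_def)
  have c_unique: "g = c a" if "g \<in> H" "g \<one> = a" for g a
    using ex1[of \<one> a] c[of a] that Hc by blast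
  have cc: "c a x \<in> carrier G" if "a \<in> carrier G" "x \<in> carrier G" for a x
    using Hc c that by blast
  have comp: "c (c a b) x = c a (c b x)" if "a \<in> carrier G" "b \<in> carrier G" "x \<in> carrier G" for a b x
  proof -
    have "compose (carrier G) (c a) (c b) \<in> H"
      using H.m_closed[OF c(1)[OF that(1)] c(1)[OF that(2)]] HB c that by (simp add: mult_holomorph)
    then have "compose (carrier G) (c a) (c b) = c (c a b)"
      by (rule c_unique) (use that c in \<open>simp add: compose_eq\<close>)
    then show ?thesis using that by (metis compose_eq)
  qed
  have one: "c \<one> x = x" if "x \<in> carrier G" for x
  proof -
    have "(\<lambda>x\<in>carrier G. x) = c \<one>"
      using c_unique[OF H.one_closed, of \<one>] by (simp add: one_holomorph)
    then show ?thesis using that by (metis restrict_apply')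
  qed
  have grp: "group (brace_ring G c)"
  proof (rule groupI)
    fix a assume "a \<in> carrier (brace_ring G c)"
    then have a: "a \<in> carrier G" by simp
    obtain g where g: "g \<in> H" "g a = \<one>" using ex1[OF a one_closed] by blast
    \<comment> \<open>The member of \<open>H\<close> taking \<open>a\<close> to the unit is left
      multiplication by its own label, which is hence a left inverse of \<open>a\<close>.\<close>
    then have "c (g \<one>) a = \<one>" using c_unique[OF g(1)] by metis
    then show "\<exists>b\<in>carrier (brace_ring G c). b \<otimes>\<^bsub>brace_ring G c\<^esub> a = \<one>\<^bsub>brace_ring G c\<^esub>"
      using Hc[OF g(1) one_closed] by auto
  qed (simp_all add: cc comp one)
  have "brace_operation G c"
  proof (rule brace_operation.intro[OF comm_group_axioms brace_operation_axioms.intro])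
    show "group (brace_ring G c)" by (rule grp)
    fix a b d assume "a \<in> carrier G" "b \<in> carrier G" "d \<in> carrier G"
    then show "c a (b \<otimes> d) = c a b \<otimes> inv a \<otimes> c a d"
      using c[of a] H.subset by (auto simp: carrier_holomorph)
  qed
  then have "c \<in> brace_ops G"
  proof (rule brace_opsI)
    show "c \<in> extensional (carrier G)" by (simp add: c_def)
    show "c a \<in> extensional (carrier G)" if "a \<in> carrier G" for a
      using HB[OF c(1)[OF that]] by (rule Bij_imp_extensional)
  qed
  moreover have "H = c ` carrier G"
    using c c_unique Hc by (auto intro!: image_eqI)
  ultimately show ?thesis by (rule that)
qed

proposition num_regular_eq_card_brace_ops:
  fixes N (structure)
  assumes "comm_group N"
  shows "num_regular N J = card {c \<in> brace_ops N. brace_ring N c \<cong> J}"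
proof -
  interpret comm_group N by fact
  let ?A = "{c \<in> brace_ops N. brace_ring N c \<cong> J}"
  let ?B = "{G. subgroup G (holomorph N) \<and> regular_on (carrier N) G
     \<and> (holomorph N)\<lparr>carrier := G\<rparr> \<cong> J}"
  have isoJ: "(holomorph N)\<lparr>carrier := c ` carrier N\<rparr> \<cong> J \<longleftrightarrow> brace_ring N c \<cong> J" if c: "c \<in> brace_ops N" for c
  proof -
    interpret brace_operation N c using brace_opsD(1)[OF assms c] .
    have "brace_ring N c \<cong> (holomorph N)\<lparr>carrier := c ` carrier N\<rparr>"
      using regular_subgroup_op(3)[OF c] by (rule is_isoI)
    then show ?thesis by (meson iso_trans group.iso_sym group_op)
  qed
  have "(\<lambda>c. c ` carrier N) ` ?A = ?B"
  proof (intro equalityI subsetI)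
    fix H assume "H \<in> (\<lambda>c. c ` carrier N) ` ?A"
    then obtain c where c: "c \<in> brace_ops N" "brace_ring N c \<cong> J" "H = c ` carrier N" by blast
    interpret brace_operation N c using brace_opsD(1)[OF assms c(1)] .
    show "H \<in> ?B" using regular_subgroup_op(1,2)[OF c(1)] c isoJ by simp
  next
    fix H assume H: "H \<in> ?B"
    then obtain c where "c \<in> brace_ops N" "H = c ` carrier N"
      using regular_subgroup_obtains_op by blast
    then show "H \<in> (\<lambda>c. c ` carrier N) ` ?A" using H isoJ by blast
  qed
  moreover have "inj_on (\<lambda>c. c ` carrier N) ?A"
  proof (rule inj_onI)
    fix c c' assume c: "c \<in> ?A" "c' \<in> ?A" "c ` carrier N = c' ` carrier N"
    interpret c: brace_operation N c using brace_opsD(1)[OF assms] c by blast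
    interpret c': brace_operation N c' using brace_opsD(1)[OF assms] c by blast
    show "c = c'"
    proof (rule extensionalityI[where A = "carrier N"])
      fix a assume a: "a \<in> carrier N"
      then obtain b where b: "b \<in> carrier N" "c a = c' b" using c(3) by blast
      \<comment> \<open>Evaluation at the unit recovers the label of a permutation, so equal images
        force equal operations.\<close>
      have "a = c a \<one>" using a by simp
      also have "\<dots> = b" using b by simp
      finally show "c a = c' a" using b by simp
    qed (use c brace_opsD(2)[OF assms] in auto)
  qed
  ultimately show ?thesis
    unfolding num_regular_def by (metis (no_types, lifting) card_image)
qed

section \<open>Isomorphism classes of braces\<close>

text \<open>\<open>rel\<close> makes the induced map on classes well defined and injective, and
  \<open>surj\<close> makes it reach every class.\<close>

lemma card_quotient_eq:
  assumes A: "equiv A R" and B: "equiv B S" and f: "\<And>a. a \<in> A \<Longrightarrow> f a \<in> B"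
    and rel: "\<And>a a'. a \<in> A \<Longrightarrow> a' \<in> A \<Longrightarrow> (f a, f a') \<in> S \<longleftrightarrow> (a, a') \<in> R"
    and surj: "\<And>b. b \<in> B \<Longrightarrow> \<exists>a\<in>A. (f a, b) \<in> S"
  shows "card (A // R) = card (B // S)"
proof -
  define g where "g U = S `` (f ` U)" for U
  have g: "g (R `` {a}) = S `` {f a}" if a: "a \<in> A" for a
  proof -
    have "S `` {f b} = S `` {f a}" if "b \<in> R `` {a}" for b
    proof -
      have "b \<in> A" using that equiv_type[OF A] by blast
      then have "(f a, f b) \<in> S" using that rel[OF a] by simp
      then show ?thesis using equiv_class_eq[OF B] by blast
    qed
    moreover have "a \<in> R `` {a}" using A a by (rule equiv_class_self)
    ultimately show ?thesis unfolding g_def by blast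
  qed
  have "bij_betw g (A // R) (B // S)"
  proof (rule bij_betw_imageI)
    show "inj_on g (A // R)"
    proof (rule inj_onI)
      fix U V assume "U \<in> A // R" "V \<in> A // R" and eq: "g U = g V"
      then obtain a b where ab: "a \<in> A" "b \<in> A" "U = R `` {a}" "V = R `` {b}"
        by (auto elim!: quotientE)
      then have "S `` {f a} = S `` {f b}" using g eq by simp
      then have "(f a, f b) \<in> S" using eq_equiv_class[OF _ B] f ab by blast
      then show "U = V" using rel ab equiv_class_eq[OF A] by blast
    qed
    show "g ` (A // R) = B // S"
    proof (intro equalityI subsetI)
      fix Z assume "Z \<in> g ` (A // R)"
      then obtain a where "a \<in> A" "Z = S `` {f a}" using g by (auto elim!: quotientE)
      then show "Z \<in> B // S" using f quotientI by metis
    next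
      fix Z assume "Z \<in> B // S"
      then obtain b where b: "b \<in> B" "Z = S `` {b}" by (rule quotientE)
      then obtain a where a: "a \<in> A" "(f a, b) \<in> S" using surj by blast
      then have "Z = g (R `` {a})" using b g equiv_class_eq[OF B] by metis
      then show "Z \<in> g ` (A // R)" using quotientI[OF a(1)] by (rule image_eqI)
    qed
  qed
  then show ?thesis by (rule bij_betw_same_card)
qed

lemma (in brace) one_eq_zero: "\<one> = \<zero>"
proof -
  have "\<one> \<otimes> (\<zero> \<oplus> \<zero>) = (\<one> \<otimes> \<zero> \<ominus> \<one>) \<oplus> \<one> \<otimes> \<zero>"
    by (rule brace_law) auto
  then have "\<ominus> \<one> = \<zero>" by (simp add: minus_eq)
  then show ?thesis using minus_minus[of \<one>] by simp
qed

lemma ring_iso_sym_brace: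
  assumes "brace B" "h \<in> ring_iso B B'"
  shows "inv_into (carrier B) h \<in> ring_iso B' B"
proof -
  interpret brace B by fact
  let ?g = "inv_into (carrier B) h"
  have h: "bij_betw h (carrier B) (carrier B')" "h \<one>\<^bsub>B\<^esub> = \<one>\<^bsub>B'\<^esub>"
    "\<And>x y. x \<in> carrier B \<Longrightarrow> y \<in> carrier B \<Longrightarrow> h (x \<otimes>\<^bsub>B\<^esub> y) = h x \<otimes>\<^bsub>B'\<^esub> h y"
    "\<And>x y. x \<in> carrier B \<Longrightarrow> y \<in> carrier B \<Longrightarrow> h (x \<oplus>\<^bsub>B\<^esub> y) = h x \<oplus>\<^bsub>B'\<^esub> h y"
    using assms(2) by (auto simp: ring_iso_def ring_hom_def)
  have gc: "?g x \<in> carrier B" and hg: "h (?g x) = x" if "x \<in> carrier B'" for x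
    using that h(1) bij_betw_inv_into_right[OF h(1)] bij_betwE[OF bij_betw_inv_into[OF h(1)]] by auto
  have gh: "?g (h x) = x" if "x \<in> carrier B" for x
    using bij_betw_inv_into_left[OF h(1) that] .
  have "?g (x \<otimes>\<^bsub>B'\<^esub> y) = ?g x \<otimes>\<^bsub>B\<^esub> ?g y" "?g (x \<oplus>\<^bsub>B'\<^esub> y) = ?g x \<oplus>\<^bsub>B\<^esub> ?g y"
    if "x \<in> carrier B'" "y \<in> carrier B'" for x y
    using gh[of "?g x \<otimes>\<^bsub>B\<^esub> ?g y"] gh[of "?g x \<oplus>\<^bsub>B\<^esub> ?g y"] that gc hg by (simp_all add: h)
  moreover have "?g \<one>\<^bsub>B'\<^esub> = \<one>\<^bsub>B\<^esub>" using gh[OF one_closed] by (simp add: h)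
  ultimately show ?thesis
    using bij_betw_inv_into[OF h(1)] gc by (simp add: ring_iso_def ring_hom_def)
qed

lemma is_ring_iso_sym_brace: "brace B \<Longrightarrow> B \<simeq> B' \<Longrightarrow> B' \<simeq> B"
  unfolding is_ring_iso_def using ring_iso_sym_brace by blast

lemma is_ring_iso_trans: "B \<simeq> B' \<Longrightarrow> B' \<simeq> B'' \<Longrightarrow> B \<simeq> B''"
  unfolding is_ring_iso_def using ring_iso_set_trans by blast

lemma equiv_braces:
  assumes "\<And>x. x \<in> A \<Longrightarrow> brace (F x)"
  shows "equiv A {(x, y). x \<in> A \<and> y \<in> A \<and> F x \<simeq> F y}" (is "equiv A ?R")
proof (rule equivI)
  show "refl_on A ?R"
    by (rule refl_onI) (use ring_iso_set_refl in \<open>auto simp: is_ring_iso_def\<close>)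
  show "sym ?R"
    by (rule symI) (use assms is_ring_iso_sym_brace in blast)
  show "trans ?R"
    by (rule transI) (use is_ring_iso_trans in blast)
qed blast

lemma add_monoid_brace_ring_iso: "add_monoid (brace_ring N c) \<cong> N"
proof (rule is_isoI)
  show "id \<in> iso (add_monoid (brace_ring N c)) N"
    unfolding iso_def hom_def by simp
qed

text \<open>Transport of structure along an additive isomorphism: every isomorphism class of braces
  over \<open>N\<close> has a representative whose addition is exactly that of
  \<open>N\<close>.\<close>

lemma brace_transport:
  fixes N :: "('a, 'm) monoid_scheme" and B :: "'b ring"
  assumes N: "comm_group N" and B: "brace B" and h: "h \<in> iso (add_monoid B) N"
  obtains c where "c \<in> brace_ops N" "brace_ring N c \<cong> B" "brace_ring N c \<simeq> B"
proof -
  interpret N: comm_group N by fact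
  interpret B: brace B by fact
  define g where "g = inv_into (carrier B) h"
  have bij: "bij_betw h (carrier B) (carrier N)" and hc: "\<And>x. x \<in> carrier B \<Longrightarrow> h x \<in> carrier N"
    and hadd: "\<And>x y. x \<in> carrier B \<Longrightarrow> y \<in> carrier B \<Longrightarrow> h (x \<oplus>\<^bsub>B\<^esub> y) = h x \<otimes>\<^bsub>N\<^esub> h y"
    using h by (auto simp: iso_def hom_def)
  have gc: "g x \<in> carrier B" and hg: "h (g x) = x" if "x \<in> carrier N" for x
    using that bij_betw_inv_into_right[OF bij] bij_betwE[OF bij_betw_inv_into[OF bij]] by (auto simp: g_def)
  have gh: "g (h x) = x" if "x \<in> carrier B" for x
    unfolding g_def using bij_betw_inv_into_left[OF bij that] .
  have h0: "h \<zero>\<^bsub>B\<^esub> = \<one>\<^bsub>N\<^esub>"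
    using hadd[of "\<zero>\<^bsub>B\<^esub>" "\<zero>\<^bsub>B\<^esub>"] hc[of "\<zero>\<^bsub>B\<^esub>"] by simp
  have hneg: "h (\<ominus>\<^bsub>B\<^esub> x) = inv\<^bsub>N\<^esub> (h x)" if "x \<in> carrier B" for x
    using hadd[of "\<ominus>\<^bsub>B\<^esub> x" x] that hc h0 by (intro N.inv_equality[symmetric]) (auto simp: B.l_neg)
  have g1: "g \<one>\<^bsub>N\<^esub> = \<one>\<^bsub>B\<^esub>" using gh[of "\<zero>\<^bsub>B\<^esub>"] by (simp add: h0 B.one_eq_zero)
  have h1: "h \<one>\<^bsub>B\<^esub> = \<one>\<^bsub>N\<^esub>" by (simp add: B.one_eq_zero h0)
  have gadd: "g (x \<otimes>\<^bsub>N\<^esub> y) = g x \<oplus>\<^bsub>B\<^esub> g y" if "x \<in> carrier N" "y \<in> carrier N" for x y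
    using gh[of "g x \<oplus>\<^bsub>B\<^esub> g y"] that by (simp add: hadd gc hg)
  define c where "c = (\<lambda>a\<in>carrier N. \<lambda>b\<in>carrier N. h (g a \<otimes>\<^bsub>B\<^esub> g b))"
  have c: "c a b = h (g a \<otimes>\<^bsub>B\<^esub> g b)" if "a \<in> carrier N" "b \<in> carrier N" for a b
    using that by (simp add: c_def)
  have "group (brace_ring N c)"
  proof (rule groupI)
    fix a assume "a \<in> carrier (brace_ring N c)"
    then have "h (inv\<^bsub>B\<^esub> (g a)) \<in> carrier N \<and> c (h (inv\<^bsub>B\<^esub> (g a))) a = \<one>\<^bsub>N\<^esub>"
      using hc gc gh by (simp add: c h1)
    then show "\<exists>b\<in>carrier (brace_ring N c). b \<otimes>\<^bsub>brace_ring N c\<^esub> a = \<one>\<^bsub>brace_ring N c\<^esub>"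
      by auto
  qed (simp_all add: c hc gc gh hg g1 B.m_assoc)
  then have "brace_operation N c"
  proof (rule brace_operation.intro[OF N brace_operation_axioms.intro])
    fix a b d assume *: "a \<in> carrier N" "b \<in> carrier N" "d \<in> carrier N"
    then have "c a (b \<otimes>\<^bsub>N\<^esub> d) = h (g a \<otimes>\<^bsub>B\<^esub> (g b \<oplus>\<^bsub>B\<^esub> g d))"
      by (simp add: c gadd)
    also have "\<dots> = c a b \<otimes>\<^bsub>N\<^esub> inv\<^bsub>N\<^esub> a \<otimes>\<^bsub>N\<^esub> c a d"
      using * by (simp add: B.brace_law gc c hadd hneg hg a_minus_def)
    finally show "c a (b \<otimes>\<^bsub>N\<^esub> d) = c a b \<otimes>\<^bsub>N\<^esub> inv\<^bsub>N\<^esub> a \<otimes>\<^bsub>N\<^esub> c a d" .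
  qed
  then have "c \<in> brace_ops N"
    by (rule brace_opsI) (simp_all add: c_def)
  moreover have gbij: "bij_betw g (carrier N) (carrier B)"
    unfolding g_def by (rule bij_betw_inv_into[OF bij])
  then have "g \<in> iso (brace_ring N c) B" "g \<in> ring_iso (brace_ring N c) B"
    using gc g1 by (auto simp: iso_def hom_def ring_iso_def ring_hom_def c gh gadd)
  then have "brace_ring N c \<cong> B" "brace_ring N c \<simeq> B"
    by (auto simp: is_iso_def is_ring_iso_def)
  ultimately show ?thesis by (rule that)
qed

proposition num_braces_eq_card_quotient:
  assumes "comm_group N" and A_def: "A = {c \<in> brace_ops N. brace_ring N c \<cong> J}"
  shows "num_braces N J =
    card (A // {(c, c'). c \<in> A \<and> c' \<in> A \<and> brace_ring N c \<simeq> brace_ring N c'})"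
proof -
  have "card (A // {(c, c'). c \<in> A \<and> c' \<in> A \<and> brace_ring N c \<simeq> brace_ring N c'}) = num_braces N J"
    unfolding num_braces_def
  proof (rule card_quotient_eq[where f = "brace_ring N"])
    show "equiv A {(c, c'). c \<in> A \<and> c' \<in> A \<and> brace_ring N c \<simeq> brace_ring N c'}"
      by (rule equiv_braces) (simp add: A_def brace_ops_def)
    show "equiv (braces N J) {(B, B'). B \<in> braces N J \<and> B' \<in> braces N J \<and> B \<simeq> B'}"
      by (rule equiv_braces) (simp add: braces_def)
    show br: "brace_ring N c \<in> braces N J" if "c \<in> A" for c
      using that add_monoid_brace_ring_iso[of N c] by (auto simp: A_def braces_def brace_ops_def)
    show "(brace_ring N c, brace_ring N c') \<in> {(B, B'). B \<in> braces N J \<and> B' \<in> braces N J \<and> B \<simeq> B'} \<longleftrightarrow>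
        (c, c') \<in> {(c, c'). c \<in> A \<and> c' \<in> A \<and> brace_ring N c \<simeq> brace_ring N c'}"
      if "c \<in> A" "c' \<in> A" for c c'
      using that br by simp
    fix B assume "B \<in> braces N J"
    then obtain h where h: "brace B" "h \<in> iso (add_monoid B) N" "B \<cong> J"
      by (auto simp: braces_def is_iso_def)
    then obtain c where c: "c \<in> brace_ops N" "brace_ring N c \<cong> B" "brace_ring N c \<simeq> B"
      using brace_transport[OF assms(1)] by metis
    then have "c \<in> A" using iso_trans[OF c(2) h(3)] by (simp add: A_def)
    then show "\<exists>c\<in>A. (brace_ring N c, B) \<in> {(B, B'). B \<in> braces N J \<and> B' \<in> braces N J \<and> B \<simeq> B'}"
      using c(3) br \<open>B \<in> braces N J\<close> by auto
  qed
  then show ?thesis by simp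
qed

section \<open>Products of an odd cyclic group and an abelian 2-group\<close>

text \<open>Membership in a subgroup of index 2 behaves like a sign. This is what makes
  \<open>twist\<close> an action of the circle group.\<close>

lemma (in group) inverted_cyclic_mult_iff:
  assumes "inverted_cyclic q G K" "a \<in> carrier G" "b \<in> carrier G"
  shows "a \<otimes> b \<in> K \<longleftrightarrow> (a \<in> K \<longleftrightarrow> b \<in> K)"
proof -
  interpret K: subgroup K G using assms(1) by (rule inverted_cyclicD)
  have "b = inv a \<otimes> (a \<otimes> b)" "a = (a \<otimes> b) \<otimes> inv b"
    using assms(2,3) m_assoc[of "inv a" a b] m_assoc[of a b "inv b"] by simp_all
  then show ?thesis
    using inverted_cyclicD(4)[OF assms(1)] assms(2,3) K.m_closed K.m_inv_closed by metis
qed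

lemma (in group) coprime_pow_eq_one:
  assumes "x \<in> carrier G" "x [^] (a::nat) = \<one>" "x [^] (b::nat) = \<one>" "coprime a b"
  shows "x = \<one>"
proof -
  have "ord x dvd a" "ord x dvd b" using assms pow_eq_id by simp_all
  then have "ord x = 1" using assms(4) by (meson coprime_common_divisor_nat)
  then show ?thesis using ord_eq_1[OF assms(1)] by simp
qed

lemma nat_pow_DirProd:
  "(a, b) [^]\<^bsub>G \<times>\<times> H\<^esub> (k::nat) = (a [^]\<^bsub>G\<^esub> k, b [^]\<^bsub>H\<^esub> k)"
  by (induction k) simp_all

lemma comm_group_DirProd:
  assumes "comm_group G" "comm_group H"
  shows "comm_group (G \<times>\<times> H)"
proof -
  interpret G: comm_group G by fact
  interpret H: comm_group H by fact
  show ?thesis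
    by (rule group.group_comm_groupI[OF DirProd_group])
      (auto simp: G.is_group H.is_group G.m_comm H.m_comm)
qed

section \<open>Twisted products of an odd cyclic group with a brace of 2-power order\<close>

definition twist :: "('a, 'm) monoid_scheme \<Rightarrow> 'b set \<Rightarrow> 'b \<Rightarrow> 'a \<Rightarrow> 'a" where
  "twist G K v u = (if v \<in> K then u else inv\<^bsub>G\<^esub> u)"

text \<open>The circle group is the semidirect product of \<open>G\<close> with the circle group on
  \<open>H\<close>, elements outside \<open>K\<close> acting by inversion. Additively the product
  stays direct.\<close>

definition twisted_op ::
  "('a, 'm) monoid_scheme \<Rightarrow> ('b, 'k) monoid_scheme \<Rightarrow> ('b \<Rightarrow> 'b \<Rightarrow> 'b) \<Rightarrow> 'b set \<Rightarrow>
    'a \<times> 'b \<Rightarrow> 'a \<times> 'b \<Rightarrow> 'a \<times> 'b" where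
  "twisted_op G H c K = (\<lambda>p\<in>carrier (G \<times>\<times> H). \<lambda>p'\<in>carrier (G \<times>\<times> H).
     (fst p \<otimes>\<^bsub>G\<^esub> twist G K (snd p) (fst p'), c (snd p) (snd p')))"

locale odd_cyclic_2_product = S: comm_group Ns + T: comm_group N2
  for Ns :: "('a, 'm) monoid_scheme" and N2 :: "('b, 'k) monoid_scheme" +
  fixes n :: nat
  assumes cyclic: "\<exists>g\<in>carrier Ns. \<forall>u\<in>carrier Ns. \<exists>k::nat. u = g [^]\<^bsub>Ns\<^esub> k"
    and odd_order: "odd (order Ns)" and order_ge_3: "order Ns \<ge> 3" and order_N2: "order N2 = 2 ^ n"
begin

abbreviation "NN \<equiv> Ns \<times>\<times> N2"

sublocale P: comm_group NN
  by (rule comm_group_DirProd) unfold_locales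

lemma finite_Ns: "finite (carrier Ns)" and finite_N2: "finite (carrier N2)"
  using order_ge_3 order_N2 by (auto simp: order_def intro: card_ge_0_finite)

lemma coprime_orders: "coprime (order Ns) (order N2)"
  using odd_order by (simp add: order_N2)

lemma ex_neq_one:
  obtains u where "u \<in> carrier Ns" "u \<noteq> \<one>\<^bsub>Ns\<^esub>"
proof -
  have "\<not> carrier Ns \<subseteq> {\<one>\<^bsub>Ns\<^esub>}"
  proof
    assume "carrier Ns \<subseteq> {\<one>\<^bsub>Ns\<^esub>}"
    then have "card (carrier Ns) \<le> card {\<one>\<^bsub>Ns\<^esub>}" by (intro card_mono) auto
    then show False using order_ge_3 by (simp add: order_def)
  qed
  then show ?thesis using that by blast
qed

lemma neq_inv:
  assumes "u \<in> carrier Ns" "u \<noteq> \<one>\<^bsub>Ns\<^esub>"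
  shows "inv\<^bsub>Ns\<^esub> u \<noteq> u"
proof
  assume "inv\<^bsub>Ns\<^esub> u = u"
  then have "u \<otimes>\<^bsub>Ns\<^esub> u = \<one>\<^bsub>Ns\<^esub>" using S.l_inv[OF assms(1)] by simp
  then have "u [^]\<^bsub>Ns\<^esub> (2::nat) = \<one>\<^bsub>Ns\<^esub>" using assms(1) by (simp add: S.nat_pow_two)
  moreover have "u [^]\<^bsub>Ns\<^esub> order Ns = \<one>\<^bsub>Ns\<^esub>" by (rule S.pow_order_eq_1[OF assms(1)])
  ultimately have "u = \<one>\<^bsub>Ns\<^esub>"
    using assms(1) odd_order by (intro S.coprime_pow_eq_one[of u 2 "order Ns"]) auto
  then show False using assms(2) by simp
qed

text \<open>Orders in the two factors are coprime, so additive homomorphisms respect the factors.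
  This is used for the \<lambda> maps as well as for brace isomorphisms.\<close>

lemma hom_snd:
  assumes "h \<in> hom NN NN" "u \<in> carrier Ns"
  shows "snd (h (u, \<one>\<^bsub>N2\<^esub>)) = \<one>\<^bsub>N2\<^esub>"
proof -
  interpret h: group_hom NN NN h by unfold_locales (rule assms)
  have "h ((u, \<one>\<^bsub>N2\<^esub>) [^]\<^bsub>NN\<^esub> order Ns) = \<one>\<^bsub>NN\<^esub>"
    using assms(2) by (simp add: nat_pow_DirProd S.pow_order_eq_1 flip: one_DirProd)
  then have "h (u, \<one>\<^bsub>N2\<^esub>) [^]\<^bsub>NN\<^esub> order Ns = \<one>\<^bsub>NN\<^esub>"
    using assms(2) by (simp add: h.hom_nat_pow)
  moreover obtain a b where ab: "h (u, \<one>\<^bsub>N2\<^esub>) = (a, b)" by force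
  ultimately have "b [^]\<^bsub>N2\<^esub> order Ns = \<one>\<^bsub>N2\<^esub>" by (simp add: nat_pow_DirProd)
  moreover have "b \<in> carrier N2" using h.hom_closed[of "(u, \<one>\<^bsub>N2\<^esub>)"] ab assms(2) by simp
  ultimately have "b = \<one>\<^bsub>N2\<^esub>"
    using T.coprime_pow_eq_one[OF _ _ T.pow_order_eq_1 coprime_orders] by blast
  then show ?thesis using ab by simp
qed

lemma hom_fst:
  assumes "h \<in> hom NN NN" "v \<in> carrier N2"
  shows "fst (h (\<one>\<^bsub>Ns\<^esub>, v)) = \<one>\<^bsub>Ns\<^esub>"
proof -
  interpret h: group_hom NN NN h by unfold_locales (rule assms)
  have "h ((\<one>\<^bsub>Ns\<^esub>, v) [^]\<^bsub>NN\<^esub> order N2) = \<one>\<^bsub>NN\<^esub>"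
    using assms(2) by (simp add: nat_pow_DirProd T.pow_order_eq_1 flip: one_DirProd)
  then have "h (\<one>\<^bsub>Ns\<^esub>, v) [^]\<^bsub>NN\<^esub> order N2 = \<one>\<^bsub>NN\<^esub>"
    using assms(2) by (simp add: h.hom_nat_pow)
  moreover obtain a b where ab: "h (\<one>\<^bsub>Ns\<^esub>, v) = (a, b)" by force
  ultimately have "a [^]\<^bsub>Ns\<^esub> order N2 = \<one>\<^bsub>Ns\<^esub>" by (simp add: nat_pow_DirProd)
  moreover have "a \<in> carrier Ns" using h.hom_closed[of "(\<one>\<^bsub>Ns\<^esub>, v)"] ab assms(2) by simp
  ultimately have "a = \<one>\<^bsub>Ns\<^esub>"
    using S.coprime_pow_eq_one[OF _ S.pow_order_eq_1 _ coprime_orders] by blast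
  then show ?thesis using ab by simp
qed

subsection \<open>From 2-groups to the product\<close>

lemma twist_closed [simp]: "u \<in> carrier Ns \<Longrightarrow> twist Ns K v u \<in> carrier Ns"
  by (simp add: twist_def)

lemma twist_mult:
  "u \<in> carrier Ns \<Longrightarrow> u' \<in> carrier Ns \<Longrightarrow>
    twist Ns K v (u \<otimes>\<^bsub>Ns\<^esub> u') = twist Ns K v u \<otimes>\<^bsub>Ns\<^esub> twist Ns K v u'"
  by (simp add: twist_def S.inv_mult)

lemma twisted_op_apply [simp]:
  assumes "u \<in> carrier Ns" "v \<in> carrier N2" "u' \<in> carrier Ns" "v' \<in> carrier N2"
  shows "twisted_op Ns N2 c K (u, v) (u', v') = (u \<otimes>\<^bsub>Ns\<^esub> twist Ns K v u', c v v')"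
  using assms by (simp add: twisted_op_def)

text \<open>\<open>c\<close> is visible on the copy of \<open>N2\<close>, and \<open>K\<close> in
  the action on a single nontrivial \<open>u\<close>, which differs from its inverse.\<close>

lemma twisted_op_inj:
  assumes c: "c \<in> brace_ops N2" "c' \<in> brace_ops N2" and K: "K \<subseteq> carrier N2" "K' \<subseteq> carrier N2"
    and eq: "twisted_op Ns N2 c K = twisted_op Ns N2 c' K'"
  shows "c = c'" "K = K'"
proof -
  note D = brace_opsD[OF T.comm_group_axioms c(1)] brace_opsD[OF T.comm_group_axioms c(2)]
  have app: "twisted_op Ns N2 c K (\<one>\<^bsub>Ns\<^esub>, v) (u', v') = twisted_op Ns N2 c' K' (\<one>\<^bsub>Ns\<^esub>, v) (u', v')" for v u' v'
    by (simp only: eq)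
  show "c = c'"
  proof (rule extensionalityI[OF D(2,5)])
    fix v assume v: "v \<in> carrier N2"
    show "c v = c' v"
    proof (rule extensionalityI[OF D(3)[OF v] D(6)[OF v]])
      fix v' assume "v' \<in> carrier N2"
      then show "c v v' = c' v v'" using app[of v "\<one>\<^bsub>Ns\<^esub>" v'] v by simp
    qed
  qed
  obtain u where u: "u \<in> carrier Ns" "u \<noteq> \<one>\<^bsub>Ns\<^esub>" by (rule ex_neq_one)
  have "v \<in> K \<longleftrightarrow> v \<in> K'" if v: "v \<in> carrier N2" for v
    using app[of v u "\<one>\<^bsub>N2\<^esub>"] u v neq_inv[OF u] by (auto simp: twist_def split: if_splits)
  then show "K = K'" using K by blast
qed

lemma twisted_op_brace:
  assumes c: "c \<in> brace_ops N2" and K: "inverted_cyclic q (brace_ring N2 c) K"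
  shows "twisted_op Ns N2 c K \<in> brace_ops NN"
    and "inverted_cyclic q (brace_ring NN (twisted_op Ns N2 c K)) (carrier Ns \<times> K)"
proof -
  interpret c: brace_operation N2 c by (rule brace_opsD(1)[OF T.comm_group_axioms c])
  let ?d = "twisted_op Ns N2 c K"
  let ?B = "brace_ring NN ?d" and ?C = "brace_ring N2 c"
  note K_D = inverted_cyclicD[OF K, simplified]
  interpret K: subgroup K ?C by (rule K_D(1))
  have oneK: "\<one>\<^bsub>N2\<^esub> \<in> K" using K.one_closed by simp
  have Ksub: "v \<in> carrier N2" if "v \<in> K" for v using K.mem_carrier[OF that] by simp
  have mult_iff: "c v v' \<in> K \<longleftrightarrow> (v \<in> K \<longleftrightarrow> v' \<in> K)" if "v \<in> carrier N2" "v' \<in> carrier N2" for v v'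
    using c.C.inverted_cyclic_mult_iff[OF K] that by simp
  have tw_one: "twist Ns K \<one>\<^bsub>N2\<^esub> u = u" for u using oneK by (simp add: twist_def)
  have tw_comp: "twist Ns K (c v v') u = twist Ns K v (twist Ns K v' u)"
    if "v \<in> carrier N2" "v' \<in> carrier N2" "u \<in> carrier Ns" for v v' u
    using that by (simp add: twist_def mult_iff)
  have grp: "group ?B"
  proof (rule groupI)
    fix p assume "p \<in> carrier ?B"
    then obtain u v where p: "p = (u, v)" "u \<in> carrier Ns" "v \<in> carrier N2" by auto
    let ?w = "inv\<^bsub>?C\<^esub> v"
    have "(inv\<^bsub>Ns\<^esub> (twist Ns K ?w u), ?w) \<otimes>\<^bsub>?B\<^esub> p = \<one>\<^bsub>?B\<^esub>"
      using p by simp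
    then show "\<exists>p'\<in>carrier ?B. p' \<otimes>\<^bsub>?B\<^esub> p = \<one>\<^bsub>?B\<^esub>"
      using p by (intro bexI[where x = "(inv\<^bsub>Ns\<^esub> (twist Ns K ?w u), ?w)"]) auto
  qed (auto simp: tw_one tw_comp twist_mult S.m_assoc c.C.m_assoc)
  have law: "?d a (b \<otimes>\<^bsub>NN\<^esub> d) = ?d a b \<otimes>\<^bsub>NN\<^esub> inv\<^bsub>NN\<^esub> a \<otimes>\<^bsub>NN\<^esub> ?d a d"
    if "a \<in> carrier NN" "b \<in> carrier NN" "d \<in> carrier NN" for a b d
  proof -
    obtain u v u1 v1 u2 v2 where [simp]: "a = (u, v)" "b = (u1, v1)" "d = (u2, v2)"
      by (metis surj_pair)
    have "u \<otimes>\<^bsub>Ns\<^esub> x \<otimes>\<^bsub>Ns\<^esub> inv\<^bsub>Ns\<^esub> u \<otimes>\<^bsub>Ns\<^esub> (u \<otimes>\<^bsub>Ns\<^esub> y) = u \<otimes>\<^bsub>Ns\<^esub> (x \<otimes>\<^bsub>Ns\<^esub> y)"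
      if "u \<in> carrier Ns" "x \<in> carrier Ns" "y \<in> carrier Ns" for u x y
    proof -
      have "inv\<^bsub>Ns\<^esub> u \<otimes>\<^bsub>Ns\<^esub> (u \<otimes>\<^bsub>Ns\<^esub> y) = y" using that by (simp flip: S.m_assoc)
      then show ?thesis using that by (simp add: S.m_assoc)
    qed
    then show ?thesis using that
      by (simp add: twist_mult c.op_law inv_DirProd[OF S.is_group T.is_group])
  qed
  have "brace_operation NN ?d"
    by (rule brace_operation.intro[OF P.comm_group_axioms brace_operation_axioms.intro[OF grp law]])
  then show ops: "?d \<in> brace_ops NN"
    by (rule brace_opsI) (simp_all add: twisted_op_def)
  interpret B: group ?B by (rule grp)
  have orderK: "2 * card K = 2 ^ n"
    using c.C.inverted_cyclic_order[OF K] finite_N2 order_N2 by (simp add: order_def)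
  obtain x where x: "x \<in> K" "K = range (\<lambda>k::nat. x [^]\<^bsub>?C\<^esub> k)" "group.ord ?C x = card K"
    using c.C.inverted_cyclic_generator[OF K] finite_N2 by auto
  obtain g where g: "g \<in> carrier Ns" "\<And>u. u \<in> carrier Ns \<Longrightarrow> \<exists>k::nat. u = g [^]\<^bsub>Ns\<^esub> k"
    using cyclic by blast
  have xK: "x [^]\<^bsub>?C\<^esub> (k::nat) \<in> K" for k using x(2) by blast
  \<comment> \<open>Powers are componentwise because \<open>x\<close> lies in \<open>K\<close> and
    acts without twist.\<close>
  have pow: "(g, x) [^]\<^bsub>?B\<^esub> k = (g [^]\<^bsub>Ns\<^esub> k, x [^]\<^bsub>?C\<^esub> k)" for k :: nat
  proof (induction k)
    case (Suc k)
    then show ?case using g(1) x(1) xK[of k] Ksub by (simp add: twist_def)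
  qed simp
  show "inverted_cyclic q ?B (carrier Ns \<times> K)"
  proof (rule inverted_cyclicI[where x = "(g, x)"])
    show "subgroup (carrier Ns \<times> K) ?B"
    proof (rule B.subgroupI)
      fix p assume "p \<in> carrier Ns \<times> K"
      then obtain u v where p: "p = (u, v)" "u \<in> carrier Ns" "v \<in> K" by auto
      have v: "inv\<^bsub>?C\<^esub> v \<in> K" using p by simp
      have "inv\<^bsub>?B\<^esub> p = (inv\<^bsub>Ns\<^esub> u, inv\<^bsub>?C\<^esub> v)"
        by (rule B.inv_equality) (use p v Ksub in \<open>auto simp: twist_def\<close>)
      then show "inv\<^bsub>?B\<^esub> p \<in> carrier Ns \<times> K" using p v by simp
    next
      fix p p' assume "p \<in> carrier Ns \<times> K" "p' \<in> carrier Ns \<times> K"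
      then obtain u v u' v' where p: "p = (u, v)" "u \<in> carrier Ns" "v \<in> K"
        and p': "p' = (u', v')" "u' \<in> carrier Ns" "v' \<in> K" by auto
      then show "p \<otimes>\<^bsub>?B\<^esub> p' \<in> carrier Ns \<times> K"
        using Ksub[OF p(3)] Ksub[OF p'(3)] by (simp add: mult_iff)
    next
      show "carrier Ns \<times> K \<subseteq> carrier ?B" using Ksub by auto
      show "carrier Ns \<times> K \<noteq> {}" using oneK S.one_closed by blast
    qed
    show "(g, x) \<in> carrier Ns \<times> K" using g x by simp
    show "carrier Ns \<times> K \<noteq> carrier ?B" using K_D(3) S.one_closed by auto
  next
    fix p assume "p \<in> carrier Ns \<times> K"
    then obtain i j :: nat where p: "p = (g [^]\<^bsub>Ns\<^esub> i, x [^]\<^bsub>?C\<^esub> j)"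
      using g(2) x(2) by blast
    \<comment> \<open>The Chinese remainder theorem merges the two exponents into one, so
      \<open>(g, x)\<close> generates.\<close>
    have "coprime (order Ns) (2 * card K)" using coprime_orders by (simp add: orderK order_N2)
    then have "coprime (order Ns) (card K)" by simp
    then obtain k where k: "[k = i] (mod order Ns)" "[k = j] (mod card K)"
      using binary_chinese_remainder_nat by blast
    have "g [^]\<^bsub>Ns\<^esub> k = g [^]\<^bsub>Ns\<^esub> i"
      using S.nat_pow_mod[OF g(1) S.pow_order_eq_1[OF g(1)]] k(1) unfolding cong_def by metis
    moreover have "x [^]\<^bsub>?C\<^esub> card K = \<one>\<^bsub>?C\<^esub>"
      using c.C.pow_ord_eq_1[of x] Ksub[OF x(1)] x(3) by simp
    then have "x [^]\<^bsub>?C\<^esub> k = x [^]\<^bsub>?C\<^esub> j"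
      using c.C.nat_pow_mod[of x "card K"] k(2) Ksub[OF x(1)] unfolding cong_def by (metis brace_ring_simps(3))
    ultimately show "\<exists>k::nat. p = (g, x) [^]\<^bsub>?B\<^esub> k" using p pow by metis
  next
    fix y y' assume "y \<in> carrier ?B" "y \<notin> carrier Ns \<times> K" "y' \<in> carrier ?B" "y' \<notin> carrier Ns \<times> K"
    then show "y \<otimes>\<^bsub>?B\<^esub> y' \<in> carrier Ns \<times> K" by (auto simp: mult_iff)
  next
    fix p y assume *: "p \<in> carrier Ns \<times> K" "y \<in> carrier ?B" "y \<notin> carrier Ns \<times> K"
    then obtain u v u' v' where p: "p = (u, v)" "u \<in> carrier Ns" "v \<in> K"
      and y: "y = (u', v')" "u' \<in> carrier Ns" "v' \<in> carrier N2" "v' \<notin> K" by auto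
    have "u \<otimes>\<^bsub>Ns\<^esub> u' \<otimes>\<^bsub>Ns\<^esub> inv\<^bsub>Ns\<^esub> u = u'"
      using p(2) y(2) by (simp add: S.m_comm[of u u'] S.m_assoc)
    then show "p \<otimes>\<^bsub>?B\<^esub> y \<otimes>\<^bsub>?B\<^esub> p = y"
      using p y Ksub[OF p(3)] K_D(5)[OF p(3) y(3,4)] by (simp add: twist_def mult_iff)
  next
    fix y assume "y \<in> carrier ?B" "y \<notin> carrier Ns \<times> K"
    then obtain u v where y: "y = (u, v)" "u \<in> carrier Ns" "v \<in> carrier N2" "v \<notin> K" by auto
    then show "y \<otimes>\<^bsub>?B\<^esub> y = \<one>\<^bsub>?B\<^esub> \<longleftrightarrow> \<not> q"
      using K_D(6)[OF y(3,4)] by (simp add: twist_def)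
  qed
qed

end

context odd_cyclic_2_product
begin

subsection \<open>From the product to 2-groups\<close>

lemma brace_decomposition:
  assumes c: "c \<in> brace_ops NN" and K: "inverted_cyclic q (brace_ring NN c) K"
  obtains c2 K2 where "c2 \<in> brace_ops N2" "inverted_cyclic q (brace_ring N2 c2) K2"
    "c = twisted_op Ns N2 c2 K2"
proof -
  let ?B = "brace_ring NN c"
  let ?e = "\<one>\<^bsub>Ns\<^esub>" and ?f = "\<one>\<^bsub>N2\<^esub>"
  interpret c: brace_operation NN c by (rule brace_opsD(1)[OF P.comm_group_axioms c])
  note K_D = inverted_cyclicD[OF K, simplified]
  interpret K: subgroup K ?B by (rule K_D(1))
  note [simp] = c.C.m_closed[unfolded carrier_DirProd] c.C.inv_closed[unfolded carrier_DirProd]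
    c.C.nat_pow_closed[unfolded carrier_DirProd] c.lam_closed[unfolded carrier_DirProd]
    c.C.l_one[unfolded carrier_DirProd one_DirProd] c.C.r_one[unfolded carrier_DirProd one_DirProd]
    c.C.l_inv[unfolded carrier_DirProd one_DirProd] c.C.r_inv[unfolded carrier_DirProd one_DirProd]
    c.lam_one_left[unfolded carrier_DirProd one_DirProd] c.lam_one[unfolded carrier_DirProd one_DirProd]
  have lam_S: "\<exists>u'\<in>carrier Ns. c.lam p (u, ?f) = (u', ?f)" if "p \<in> carrier NN" "u \<in> carrier Ns" for p u
    using hom_snd[OF c.lam_hom[OF that(1)] that(2)] c.lam_closed[OF that(1), of "(u, ?f)"] that(2)
    by (cases "c.lam p (u, ?f)") auto
  have lam_T: "\<exists>v'\<in>carrier N2. c.lam p (?e, v) = (?e, v')" if "p \<in> carrier NN" "v \<in> carrier N2" for p v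
    using hom_fst[OF c.lam_hom[OF that(1)] that(2)] c.lam_closed[OF that(1), of "(?e, v)"] that(2)
    by (cases "c.lam p (?e, v)") auto
  define D where "D = carrier Ns \<times> {?f}"
  define E where "E = {?e} \<times> carrier N2"
  have DI: "(u, ?f) \<in> D" if "u \<in> carrier Ns" for u using that by (simp add: D_def)
  have EI: "(?e, v) \<in> E" if "v \<in> carrier N2" for v using that by (simp add: E_def)
  have DN: "y \<in> carrier NN" if "y \<in> D" for y using that by (auto simp: D_def)
  have EN: "y \<in> carrier NN" if "y \<in> E" for y using that by (auto simp: E_def)
  have lam_D: "c.lam p y \<in> D" if "p \<in> carrier NN" "y \<in> D" for p y
    using lam_S[OF that(1)] that(2) by (fastforce simp: D_def)
  have lam_E: "c.lam p y \<in> E" if "p \<in> carrier NN" "y \<in> E" for p y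
    using lam_T[OF that(1)] that(2) by (fastforce simp: E_def)
  have split: "a = a' \<and> b = b'" if "a \<otimes>\<^bsub>NN\<^esub> b = b' \<otimes>\<^bsub>NN\<^esub> a'" "a \<in> D" "a' \<in> D" "b \<in> E" "b' \<in> E" for a a' b b'
    using that by (auto simp: D_def E_def)
  have D_mult: "y \<otimes>\<^bsub>NN\<^esub> y' \<in> D" if "y \<in> D" "y' \<in> D" for y y'
    using that by (auto simp: D_def)
  have op_D: "c y y' \<in> D" if "y \<in> D" "y' \<in> D" for y y'
    using that DN lam_D D_mult by (simp add: c.op_eq_lam)
  have inv_D: "inv\<^bsub>?B\<^esub> y \<in> D" if y: "y \<in> D" for y
  proof -
    \<comment> \<open>The equation \<open>c y ?i = \<one>\<close> says that \<lambda>_y maps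
      \<open>?i\<close> to the additive inverse of \<open>y\<close>, so \<open>?i\<close> is the
      \<lambda> image, under \<open>?i\<close> itself, of an element of \<open>D\<close>.\<close>
    let ?i = "inv\<^bsub>?B\<^esub> y"
    have "c y ?i = \<one>\<^bsub>NN\<^esub>" using DN[OF y] by simp
    then have "c.lam y ?i = inv\<^bsub>NN\<^esub> y"
      using P.r_one[OF P.inv_closed[OF DN[OF y]]] by (simp only: c.lam_def)
    moreover have "c.lam ?i (c.lam y ?i) = ?i"
      using DN[OF y] c.lam_op[of ?i y ?i] by simp
    moreover have "inv\<^bsub>NN\<^esub> y \<in> D"
      using y by (auto simp: D_def inv_DirProd[OF S.is_group T.is_group])
    ultimately show ?thesis using lam_D[of ?i "inv\<^bsub>NN\<^esub> y"] DN[OF y] by simp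
  qed
  have subD: "subgroup D ?B"
  proof (rule c.C.subgroupI)
    show "D \<subseteq> carrier NN" using DN by blast
    show "D \<noteq> {}" using DI S.one_closed by blast
  qed (use op_D inv_D in simp_all)
  have cardD: "card D = order Ns" by (simp add: D_def order_def card_cartesian_product)
  have pow_D: "y [^]\<^bsub>?B\<^esub> order Ns = \<one>\<^bsub>?B\<^esub>" if y: "y \<in> D" for y
  proof -
    interpret D: group "?B\<lparr>carrier := D\<rparr>" by (rule subgroup.subgroup_is_group[OF subD c.group_op])
    show ?thesis
      using D.pow_order_eq_1[of y] y cardD by (simp add: order_def flip: c.C.nat_pow_consistent)
  qed
  have D_K: "y \<in> K" if y: "y \<in> D" for y
  proof (rule ccontr)
    assume "y \<notin> K"
    then have "c (c y y) (c y y) = \<one>\<^bsub>NN\<^esub>"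
      using c.C.inverted_cyclic_pow4[OF K, of y] DN[OF y] by simp
    then have "y [^]\<^bsub>?B\<^esub> (4::nat) = \<one>\<^bsub>?B\<^esub>"
      using DN[OF y] by (simp add: numeral_eq_Suc c.C.m_assoc)
    moreover have "coprime 4 (order Ns)"
      using odd_order by (metis coprime_left_2_iff_odd coprime_power_left_iff numeral_Bit0 mult_2 power2_eq_square numeral_times_numeral)
    ultimately have "y = \<one>\<^bsub>NN\<^esub>"
      using c.C.coprime_pow_eq_one[of y 4 "order Ns"] pow_D[OF y] DN[OF y] by simp
    then show False using \<open>y \<notin> K\<close> K.one_closed by simp
  qed
  \<comment> \<open>Write \<open>b \<circ> a = a \<circ> b'\<close> with \<open>b' \<in> D\<close> and compare the two components.\<close>
  have lam_DE: "c.lam b a = a" "c.lam a (if a \<in> K then b else inv\<^bsub>?B\<^esub> b) = b" if b: "b \<in> D" and a: "a \<in> E" for a b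
  proof -
    let ?b' = "if a \<in> K then b else inv\<^bsub>?B\<^esub> b"
    have b': "?b' \<in> D" using b inv_D by simp
    have "c b a = c a ?b'"
    proof (cases "a \<in> K")
      case True
      then show ?thesis using c.C.inverted_cyclic_commute[OF K D_K[OF b] True] by simp
    next
      case False
      then have "c (c b a) b = a" using K_D(5)[OF D_K[OF b] EN[OF a, simplified]] by simp
      then have "c (c (c b a) b) (inv\<^bsub>?B\<^esub> b) = c a (inv\<^bsub>?B\<^esub> b)" by simp
      then show ?thesis using False DN[OF b] EN[OF a] by (simp add: c.C.m_assoc)
    qed
    then have "b \<otimes>\<^bsub>NN\<^esub> c.lam b a = a \<otimes>\<^bsub>NN\<^esub> c.lam a ?b'"
      using DN[OF b] DN[OF b'] EN[OF a] by (simp add: c.op_eq_lam)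
    from split[OF this b lam_D[OF EN[OF a] b'] lam_E[OF DN[OF b] a] a]
    show "c.lam b a = a" "c.lam a ?b' = b" by simp_all
  qed
  have decomp: "(u, v) = c (u, ?f) (?e, v)" if "u \<in> carrier Ns" "v \<in> carrier N2" for u v
    using lam_DE(1)[OF DI EI] that by (simp add: c.op_eq_lam)
  \<comment> \<open>Every pair is a circle product of members of \<open>D\<close> and
    \<open>E\<close>, and \<open>D\<close> lies in \<open>K\<close>; so some inverting element can
    be found in \<open>E\<close>.\<close>
  obtain a where a: "a \<in> E" "a \<notin> K"
  proof -
    have "\<not> E \<subseteq> K"
    proof
      assume "E \<subseteq> K"
      obtain u v where "u \<in> carrier Ns" "v \<in> carrier N2" "(u, v) \<notin> K" using K_D(3) by auto
      moreover have "c (u, ?f) (?e, v) \<in> K" if "u \<in> carrier Ns" "v \<in> carrier N2" for u v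
        using K.m_closed[of "(u, ?f)" "(?e, v)"] D_K[OF DI] EI \<open>E \<subseteq> K\<close> that by auto
      ultimately show False using decomp by metis
    qed
    then show ?thesis using that by blast
  qed
  obtain g where g: "g \<in> carrier Ns" "\<And>u. u \<in> carrier Ns \<Longrightarrow> \<exists>k::nat. u = g [^]\<^bsub>Ns\<^esub> k"
    using cyclic by blast
  have gD: "y \<in> D \<Longrightarrow> \<exists>k::nat. y = (g, ?f) [^]\<^bsub>NN\<^esub> k" for y
    using g(2) by (auto simp: D_def nat_pow_DirProd)
  \<comment> \<open>An additive endomorphism of a cyclic group is determined at the generator, so it
    is a power map; power maps commute.\<close>
  have lam_pow_map: "\<exists>i::nat. \<forall>y\<in>D. c.lam p y = y [^]\<^bsub>NN\<^esub> i" if p: "p \<in> carrier NN" for p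
  proof -
    obtain i :: nat where i: "c.lam p (g, ?f) = (g, ?f) [^]\<^bsub>NN\<^esub> i"
      using gD lam_D[OF p DI[OF g(1)]] by blast
    have "c.lam p y = y [^]\<^bsub>NN\<^esub> i" if "y \<in> D" for y
    proof -
      obtain k :: nat where k: "y = (g, ?f) [^]\<^bsub>NN\<^esub> k" using gD[OF \<open>y \<in> D\<close>] by blast
      have "c.lam p y = ((g, ?f) [^]\<^bsub>NN\<^esub> i) [^]\<^bsub>NN\<^esub> k"
        using p DN[OF DI[OF g(1)]] by (simp only: k c.lam_pow i)
      also have "\<dots> = y [^]\<^bsub>NN\<^esub> i"
        using DN[OF DI[OF g(1)]] by (simp only: k P.nat_pow_pow mult.commute)
      finally show ?thesis .
    qed
    then show ?thesis by blast
  qed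
  have lam_comm: "c.lam p (c.lam p' y) = c.lam p' (c.lam p y)"
    if p: "p \<in> carrier NN" "p' \<in> carrier NN" and y: "y \<in> D" for p p' y
  proof -
    obtain i j :: nat where i: "\<forall>y\<in>D. c.lam p y = y [^]\<^bsub>NN\<^esub> i" and j: "\<forall>y\<in>D. c.lam p' y = y [^]\<^bsub>NN\<^esub> j"
      using lam_pow_map p by meson
    have "c.lam p (c.lam p' y) = (y [^]\<^bsub>NN\<^esub> j) [^]\<^bsub>NN\<^esub> i" "c.lam p' (c.lam p y) = (y [^]\<^bsub>NN\<^esub> i) [^]\<^bsub>NN\<^esub> j"
      using i j lam_D[OF p(1) y] lam_D[OF p(2) y] y by simp_all
    then show ?thesis using DN[OF y] by (simp only: P.nat_pow_pow mult.commute)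
  qed
  \<comment> \<open>\<open>b \<circ> a \<circ> b = a\<close> gives \<open>\<lambda>\<^sub>b \<lambda>\<^sub>a \<lambda>\<^sub>b = \<lambda>\<^sub>a\<close>, and these maps commute on \<open>D\<close>.\<close>
  have lam_sq: "c.lam b (c.lam b y) = y" if b: "b \<in> D" and y: "y \<in> D" for b y
  proof -
    note cl = DN[OF b] DN[OF y] EN[OF a(1)]
    have "c (c b a) b = a" using K_D(5)[OF D_K[OF b] EN[OF a(1), simplified] a(2)] by simp
    then have "c.lam b (c.lam a (c.lam b y)) = c.lam a y"
      using cl c.lam_op[of "c b a" b y] c.lam_op[of b a "c.lam b y"] by simp
    then have "c.lam a (c.lam b (c.lam b y)) = c.lam a y"
      using lam_comm[OF cl(1,3) lam_D[OF cl(1) y]] by simp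
    moreover have "c.lam (inv\<^bsub>?B\<^esub> a) (c.lam a z) = z" if "z \<in> carrier NN" for z
      using that cl c.lam_op[of "inv\<^bsub>?B\<^esub> a" a z] by simp
    ultimately show ?thesis using c.lam_closed cl by metis
  qed
  have lam_DD: "c.lam b y = y" if b: "b \<in> D" and y: "y \<in> D" for b y
  proof -
    \<comment> \<open>By \<open>lam_sq\<close> the circle square of \<open>b\<close> acts trivially
      on \<open>D\<close>. With \<open>order Ns = 2 * t + 1\<close>, the power \<open>t + 1\<close>
      of that square is \<open>b\<close> itself.\<close>
    let ?d = "c b b"
    have d: "?d \<in> carrier NN" using DN[OF b] by simp
    have dk: "c.lam (?d [^]\<^bsub>?B\<^esub> k) z = z" if z: "z \<in> D" for z and k :: nat
    proof (induction k)
      case (Suc k)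
      have "c.lam (?d [^]\<^bsub>?B\<^esub> Suc k) z = c.lam (?d [^]\<^bsub>?B\<^esub> k) (c.lam ?d z)"
        using c.lam_op[of "?d [^]\<^bsub>?B\<^esub> k" ?d z] d DN[OF z] c.C.nat_pow_closed[of ?d k] by simp
      then show ?case using Suc lam_sq[OF b z] c.lam_op[of b b z] DN[OF b] DN[OF z] by simp
    qed (use DN[OF z] in simp)
    obtain t where t: "order Ns = 2 * t + 1" using odd_order by (rule oddE)
    have "?d [^]\<^bsub>?B\<^esub> (t + 1) = (b [^]\<^bsub>?B\<^esub> (2::nat)) [^]\<^bsub>?B\<^esub> (t + 1)"
      using DN[OF b] c.C.nat_pow_two[of b] by simp
    also have "\<dots> = b [^]\<^bsub>?B\<^esub> (order Ns + 1)"
      using DN[OF b] t c.C.nat_pow_pow[of b 2 "t + 1"] by simp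
    also have "\<dots> = b" using pow_D[OF b] DN[OF b] by simp
    finally show ?thesis using dk[OF y, of "t + 1"] by simp
  qed
  \<comment> \<open>With trivial \<lambda> the two operations agree on \<open>D\<close>, hence so do
    the inverses.\<close>
  have inv_D_eq: "inv\<^bsub>?B\<^esub> (u, ?f) = (inv\<^bsub>Ns\<^esub> u, ?f)" if "u \<in> carrier Ns" for u
    using that lam_DD[OF DI DI] by (intro c.C.inv_equality) (auto simp: c.op_eq_lam)
  have lam_D_id: "c.lam b p = p" if b: "b \<in> D" and p: "p \<in> carrier NN" for b p
  proof -
    obtain u v where uv: "p = (u, v)" "u \<in> carrier Ns" "v \<in> carrier N2" using p by auto
    then have "p = (u, ?f) \<otimes>\<^bsub>NN\<^esub> (?e, v)" by simp
    then show ?thesis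
      using uv lam_DD[OF b DI] lam_DE(1)[OF b EI] c.lam_mult[OF DN[OF b], of "(u, ?f)" "(?e, v)"] by simp
  qed
  define K2 where "K2 = {v \<in> carrier N2. (?e, v) \<in> K}"
  define c2 where "c2 = (\<lambda>v\<in>carrier N2. \<lambda>v'\<in>carrier N2. snd (c (?e, v) (?e, v')))"
  have formula: "c (u, v) (u', v') = (u \<otimes>\<^bsub>Ns\<^esub> twist Ns K2 v u', c2 v v')"
    if cl: "u \<in> carrier Ns" "v \<in> carrier N2" "u' \<in> carrier Ns" "v' \<in> carrier N2" for u v u' v'
  proof -
    have v: "(?e, v) \<in> carrier NN" and u: "(u, ?f) \<in> carrier NN" using cl by auto
    have tw: "c.lam (?e, v) (u', ?f) = (twist Ns K2 v u', ?f)"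
    proof (cases "(?e, v) \<in> K")
      case True
      then show ?thesis using lam_DE(2)[OF DI[OF cl(3)] EI[OF cl(2)]] cl by (simp add: twist_def K2_def)
    next
      \<comment> \<open>\<open>lam_DE(2)\<close> gives the value at a circle inverse, so it is
        applied to the inverse of \<open>u'\<close>.\<close>
      case False
      then show ?thesis
        using lam_DE(2)[OF DI[of "inv\<^bsub>Ns\<^esub> u'"] EI[OF cl(2)]] cl inv_D_eq[of "inv\<^bsub>Ns\<^esub> u'"]
        by (simp add: twist_def K2_def)
    qed
    obtain w where w: "w \<in> carrier N2" "c.lam (?e, v) (?e, v') = (?e, w)"
      using lam_T[OF v cl(4)] by blast
    have "c (?e, v) (?e, v') = (?e, v \<otimes>\<^bsub>N2\<^esub> w)" using cl v w by (simp add: c.op_eq_lam)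
    then have c2: "c2 v v' = v \<otimes>\<^bsub>N2\<^esub> w" using cl by (simp add: c2_def)
    have "(u', v') = (u', ?f) \<otimes>\<^bsub>NN\<^esub> (?e, v')" using cl by simp
    then have "c.lam (?e, v) (u', v') = (twist Ns K2 v u', w)"
      using c.lam_mult[OF v, of "(u', ?f)" "(?e, v')"] cl tw w by simp
    then have 1: "c (?e, v) (u', v') = (twist Ns K2 v u', c2 v v')"
      using cl v w c2 by (simp add: c.op_eq_lam)
    have p: "c (?e, v) (u', v') \<in> carrier NN" using cl by simp
    \<comment> \<open>The factor \<open>(u, ?f)\<close> merely translates, its \<lambda> map being
      the identity on the whole product.\<close>
    have "c (u, v) (u', v') = c (u, ?f) (c (?e, v) (u', v'))"
      using decomp[OF cl(1,2)] c.C.m_assoc[of "(u, ?f)" "(?e, v)" "(u', v')"] cl by simp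
    also have "\<dots> = (u, ?f) \<otimes>\<^bsub>NN\<^esub> c (?e, v) (u', v')"
      by (simp only: c.op_eq_lam[OF u p] lam_D_id[OF DI[OF cl(1)] p])
    also have "\<dots> = (u \<otimes>\<^bsub>Ns\<^esub> twist Ns K2 v u', c2 v v')"
      using 1 cl w c2 by simp
    finally show ?thesis .
  qed
  have c2_closed: "c2 v v' \<in> carrier N2" if "v \<in> carrier N2" "v' \<in> carrier N2" for v v'
    using c.C.m_closed[of "(?e, v)" "(?e, v')"] formula[of ?e v ?e v'] that by simp
  have one: "twist Ns K2 v ?e = ?e" for v by (simp add: twist_def)
  have c_E: "c (?e, v) (?e, v') = (?e, c2 v v')" if "v \<in> carrier N2" "v' \<in> carrier N2" for v v'
    using formula[of ?e v ?e v'] that by (simp add: one)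
  have grp2: "group (brace_ring N2 c2)"
  proof (rule groupI)
    fix x y z assume "x \<in> carrier (brace_ring N2 c2)" "y \<in> carrier (brace_ring N2 c2)" "z \<in> carrier (brace_ring N2 c2)"
    then show "x \<otimes>\<^bsub>brace_ring N2 c2\<^esub> y \<otimes>\<^bsub>brace_ring N2 c2\<^esub> z = x \<otimes>\<^bsub>brace_ring N2 c2\<^esub> (y \<otimes>\<^bsub>brace_ring N2 c2\<^esub> z)"
      using c.C.m_assoc[of "(?e, x)" "(?e, y)" "(?e, z)"] c2_closed by (simp add: c_E)
  next
    fix x assume "x \<in> carrier (brace_ring N2 c2)"
    then have x: "x \<in> carrier N2" by simp
    show "\<one>\<^bsub>brace_ring N2 c2\<^esub> \<otimes>\<^bsub>brace_ring N2 c2\<^esub> x = x"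
      using c.C.l_one[of "(?e, x)"] x by (simp add: c_E)
    obtain u w where uw: "inv\<^bsub>?B\<^esub> (?e, x) = (u, w)" by force
    then have "u \<in> carrier Ns" "w \<in> carrier N2" using c.C.inv_closed[of "(?e, x)"] x by simp_all
    moreover have "c (u, w) (?e, x) = (?e, ?f)" using c.C.l_inv[of "(?e, x)"] x uw by simp
    ultimately show "\<exists>y\<in>carrier (brace_ring N2 c2). y \<otimes>\<^bsub>brace_ring N2 c2\<^esub> x = \<one>\<^bsub>brace_ring N2 c2\<^esub>"
      using formula[of u w ?e x] x by auto
  qed (use c2_closed in auto)
  have "brace_operation N2 c2"
  proof (rule brace_operation.intro[OF T.comm_group_axioms brace_operation_axioms.intro[OF grp2]])
    fix x y z assume xyz: "x \<in> carrier N2" "y \<in> carrier N2" "z \<in> carrier N2"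
    then show "c2 x (y \<otimes>\<^bsub>N2\<^esub> z) = c2 x y \<otimes>\<^bsub>N2\<^esub> inv\<^bsub>N2\<^esub> x \<otimes>\<^bsub>N2\<^esub> c2 x z"
      using c.op_law[of "(?e, x)" "(?e, y)" "(?e, z)"]
      by (simp add: c_E inv_DirProd[OF S.is_group T.is_group])
  qed
  then have "c2 \<in> brace_ops N2"
    by (rule brace_opsI) (simp_all add: c2_def)
  moreover have "inverted_cyclic q (brace_ring N2 c2) K2"
  proof -
    interpret T2: group "brace_ring N2 c2" by (rule grp2)
    interpret i: group_hom "brace_ring N2 c2" ?B "\<lambda>v. (?e, v)"
      by unfold_locales (auto intro!: homI simp: c_E)
    have "(\<lambda>v. (?e, v)) ` carrier (brace_ring N2 c2) = E" by (auto simp: E_def)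
    then have subE: "subgroup E ?B" using i.img_is_subgroup by simp
    have fin: "finite (carrier ?B)" using finite_Ns finite_N2 by simp
    have "\<not> E \<subseteq> K" using a by blast
    note E = c.C.inverted_cyclic_restrict[OF _ K subE this]
    interpret EG: group "?B\<lparr>carrier := E\<rparr>" by (rule subgroup.subgroup_is_group[OF subE c.group_op])
    \<comment> \<open>The second projection identifies the circle subgroup \<open>E\<close> with the
      induced operation, so the restriction of \<open>K\<close> to \<open>E\<close> can be
      transported.\<close>
    have "snd \<in> iso (?B\<lparr>carrier := E\<rparr>) (brace_ring N2 c2)"
    proof (rule isoI)
      show "snd \<in> hom (?B\<lparr>carrier := E\<rparr>) (brace_ring N2 c2)"
        by (rule homI) (auto simp: E_def c_E)
      show "bij_betw snd (carrier (?B\<lparr>carrier := E\<rparr>)) (carrier (brace_ring N2 c2))"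
        by (rule bij_betw_imageI) (auto simp: E_def inj_on_def)
    qed
    then have "inverted_cyclic q (brace_ring N2 c2) (snd ` (E \<inter> K))"
      using EG.inverted_cyclic_iso[OF grp2] E fin by simp
    moreover have "snd ` (E \<inter> K) = K2" by (force simp: E_def K2_def)
    ultimately show ?thesis by simp
  qed
  moreover have "c = twisted_op Ns N2 c2 K2"
  proof (rule extensionalityI[where A = "carrier NN"])
    show "c \<in> extensional (carrier NN)" by (rule brace_opsD(2)[OF P.comm_group_axioms c])
    show "twisted_op Ns N2 c2 K2 \<in> extensional (carrier NN)" by (simp add: twisted_op_def)
    fix p assume p: "p \<in> carrier NN"
    show "c p = twisted_op Ns N2 c2 K2 p"
    proof (rule extensionalityI[where A = "carrier NN"])
      show "c p \<in> extensional (carrier NN)" by (rule brace_opsD(3)[OF P.comm_group_axioms c p])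
      show "twisted_op Ns N2 c2 K2 p \<in> extensional (carrier NN)" using p by (simp add: twisted_op_def)
      fix p' assume "p' \<in> carrier NN"
      then show "c p p' = twisted_op Ns N2 c2 K2 p p'" using p by (auto simp: formula)
    qed
  qed
  ultimately show ?thesis by (rule that)
qed

subsection \<open>Isomorphisms\<close>

text \<open>Extend \<open>f\<close> by the identity on \<open>Ns\<close>; it respects the twist
  because it matches \<open>K\<close> with \<open>K'\<close>.\<close>

lemma twisted_op_iso:
  assumes c: "c \<in> brace_ops N2" "c' \<in> brace_ops N2" and K: "K \<subseteq> carrier N2" "K' \<subseteq> carrier N2"
    and f: "f \<in> ring_iso (brace_ring N2 c) (brace_ring N2 c')" "f ` K = K'"
  shows "brace_ring NN (twisted_op Ns N2 c K) \<simeq> brace_ring NN (twisted_op Ns N2 c' K')"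
proof -
  interpret c: brace_operation N2 c by (rule brace_opsD(1)[OF T.comm_group_axioms c(1)])
  let ?h = "\<lambda>(u, v). (u, f v)"
  have bij: "bij_betw f (carrier N2) (carrier N2)" and f_op: "\<And>v v'. v \<in> carrier N2 \<Longrightarrow> v' \<in> carrier N2 \<Longrightarrow> f (c v v') = c' (f v) (f v')"
    and f_mult: "\<And>v v'. v \<in> carrier N2 \<Longrightarrow> v' \<in> carrier N2 \<Longrightarrow> f (v \<otimes>\<^bsub>N2\<^esub> v') = f v \<otimes>\<^bsub>N2\<^esub> f v'"
    and f_one: "f \<one>\<^bsub>N2\<^esub> = \<one>\<^bsub>N2\<^esub>" and fc: "\<And>v. v \<in> carrier N2 \<Longrightarrow> f v \<in> carrier N2"
    using f(1) by (auto simp: ring_iso_def ring_hom_def)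
  have "f v \<in> K' \<longleftrightarrow> v \<in> K" if "v \<in> carrier N2" for v
    using inj_on_image_mem_iff[OF bij_betw_imp_inj_on[OF bij] that K(1)] f(2) by simp
  then have tw: "twist Ns K' (f v) u = twist Ns K v u" if "v \<in> carrier N2" for u v
    using that by (simp add: twist_def)
  have "bij_betw ?h (carrier NN) (carrier NN)"
    unfolding bij_betw_def
  proof (intro conjI inj_onI equalityI subsetI)
    show "p = p'" if "p \<in> carrier NN" "p' \<in> carrier NN" "?h p = ?h p'" for p p'
      using that bij_betw_imp_inj_on[OF bij] by (auto simp: inj_on_def)
    show "p \<in> carrier NN" if "p \<in> ?h ` carrier NN" for p using that fc by auto
    show "p \<in> ?h ` carrier NN" if p: "p \<in> carrier NN" for p
    proof -
      obtain v where "v \<in> carrier N2" "snd p = f v"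
        using p bij_betw_imp_surj_on[OF bij] by (cases p) auto
      then have "p = ?h (fst p, v)" "(fst p, v) \<in> carrier NN" using p by auto
      then show ?thesis by (rule image_eqI)
    qed
  qed
  then have "?h \<in> ring_iso (brace_ring NN (twisted_op Ns N2 c K)) (brace_ring NN (twisted_op Ns N2 c' K'))"
    by (auto simp: ring_iso_def ring_hom_def tw fc f_op f_mult f_one)
  then show ?thesis by (auto simp: is_ring_iso_def)
qed

text \<open>By coprimality an isomorphism splits into maps \<open>hs\<close> and \<open>f\<close> of
  the factors. Compatibility with the twist on one nontrivial element then forces \<open>f\<close>
  to match the subgroups.\<close>

lemma twisted_op_iso_imp:
  assumes c: "c \<in> brace_ops N2" "c' \<in> brace_ops N2" and K: "K \<subseteq> carrier N2" "K' \<subseteq> carrier N2"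
    and iso: "brace_ring NN (twisted_op Ns N2 c K) \<simeq> brace_ring NN (twisted_op Ns N2 c' K')"
  obtains f where "f \<in> ring_iso (brace_ring N2 c) (brace_ring N2 c')" "f ` K = K'"
proof -
  interpret c: brace_operation N2 c by (rule brace_opsD(1)[OF T.comm_group_axioms c(1)])
  interpret c': brace_operation N2 c' by (rule brace_opsD(1)[OF T.comm_group_axioms c(2)])
  let ?e = "\<one>\<^bsub>Ns\<^esub>" and ?f = "\<one>\<^bsub>N2\<^esub>"
  let ?d = "twisted_op Ns N2 c K" and ?d' = "twisted_op Ns N2 c' K'"
  obtain h where "h \<in> ring_iso (brace_ring NN ?d) (brace_ring NN ?d')"
    using iso by (auto simp: is_ring_iso_def)
  then have h: "h \<in> hom NN NN" "inj_on h (carrier NN)"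
    and h_op: "\<And>p p'. p \<in> carrier NN \<Longrightarrow> p' \<in> carrier NN \<Longrightarrow> h (?d p p') = ?d' (h p) (h p')"
    by (auto simp: ring_iso_def ring_hom_def hom_def bij_betw_def)
  define hs where "hs u = fst (h (u, ?f))" for u
  define f where "f v = snd (h (?e, v))" for v
  have hs: "h (u, ?f) = (hs u, ?f)" if "u \<in> carrier Ns" for u
    using hom_snd[OF h(1) that] by (simp add: hs_def prod_eq_iff)
  have f: "h (?e, v) = (?e, f v)" if "v \<in> carrier N2" for v
    using hom_fst[OF h(1) that] by (simp add: f_def prod_eq_iff)
  have hsc: "hs u \<in> carrier Ns" if "u \<in> carrier Ns" for u
    using hom_in_carrier[OF h(1), of "(u, ?f)"] that by (simp add: hs)
  have fc: "f v \<in> carrier N2" if "v \<in> carrier N2" for v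
    using hom_in_carrier[OF h(1), of "(?e, v)"] that by (simp add: f)
  have h_eq: "h (u, v) = (hs u, f v)" if "u \<in> carrier Ns" "v \<in> carrier N2" for u v
    using hom_mult[OF h(1), of "(u, ?f)" "(?e, v)"] that by (simp add: hs f hsc fc)
  have hs_mult: "hs (u \<otimes>\<^bsub>Ns\<^esub> u') = hs u \<otimes>\<^bsub>Ns\<^esub> hs u'" if "u \<in> carrier Ns" "u' \<in> carrier Ns" for u u'
    using hom_mult[OF h(1), of "(u, ?f)" "(u', ?f)"] that by (simp add: hs)
  have f_mult: "f (v \<otimes>\<^bsub>N2\<^esub> v') = f v \<otimes>\<^bsub>N2\<^esub> f v'" if "v \<in> carrier N2" "v' \<in> carrier N2" for v v'
    using hom_mult[OF h(1), of "(?e, v)" "(?e, v')"] that by (simp add: f)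
  have "h \<one>\<^bsub>NN\<^esub> = \<one>\<^bsub>NN\<^esub>" by (rule hom_one[OF h(1)]) unfold_locales
  then have hs_one: "hs ?e = ?e" and f_one: "f ?f = ?f" by (simp_all add: hs_def f_def)
  have f_op: "f (c v v') = c' (f v) (f v')" if "v \<in> carrier N2" "v' \<in> carrier N2" for v v'
  proof -
    have "twist Ns L w ?e = ?e" for L :: "'b set" and w by (simp add: twist_def)
    then show ?thesis using h_op[of "(?e, v)" "(?e, v')"] that by (simp add: f fc)
  qed
  have inj: "inj_on f (carrier N2)"
  proof (rule inj_onI)
    fix v w assume vw: "v \<in> carrier N2" "w \<in> carrier N2" "f v = f w"
    then have "h (?e, v) = h (?e, w)" by (simp add: f)
    then show "v = w" using inj_onD[OF h(2)] vw by fastforce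
  qed
  then have surj: "f ` carrier N2 = carrier N2"
    using fc by (intro endo_inj_surj[OF finite_N2]) auto
  obtain u where u: "u \<in> carrier Ns" "u \<noteq> ?e" by (rule ex_neq_one)
  have hu: "hs u \<noteq> ?e"
  proof
    assume "hs u = ?e"
    then have "h (u, ?f) = h (?e, ?f)" using u by (simp add: hs hs_one)
    then show False using inj_onD[OF h(2)] u by fastforce
  qed
  have hs_inv: "hs (inv\<^bsub>Ns\<^esub> u) = inv\<^bsub>Ns\<^esub> (hs u)"
    using hs_mult[of "inv\<^bsub>Ns\<^esub> u" u] u hsc by (intro S.inv_equality[symmetric]) (auto simp: hs_one)
  \<comment> \<open>If just one of \<open>v\<close> and \<open>f v\<close> inverted,
    \<open>hs u\<close> would equal its own inverse.\<close>
  have mem: "f v \<in> K' \<longleftrightarrow> v \<in> K" if v: "v \<in> carrier N2" for v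
  proof -
    have "h (?d (?e, v) (u, ?f)) = ?d' (?e, f v) (hs u, ?f)"
      using h_op[of "(?e, v)" "(u, ?f)"] u v by (simp add: f hs)
    then have "hs (twist Ns K v u) = twist Ns K' (f v) (hs u)"
      using u v by (simp add: h_eq hsc fc)
    then show ?thesis
      using neq_inv[OF hsc[OF u(1)] hu] by (auto simp: twist_def hs_inv split: if_splits)
  qed
  have "f ` K = K'"
  proof (intro equalityI subsetI)
    fix w assume "w \<in> K'"
    then obtain v where "v \<in> carrier N2" "w = f v" using K(2) surj by blast
    then show "w \<in> f ` K" using mem \<open>w \<in> K'\<close> by blast
  qed (use mem K(1) in auto)
  moreover have "f \<in> ring_iso (brace_ring N2 c) (brace_ring N2 c')"
    using inj surj by (auto simp: ring_iso_def ring_hom_def bij_betw_def fc f_op f_mult f_one)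
  ultimately show ?thesis by (rule that[rotated])
qed

end

section \<open>Counting\<close>

definition brace_pairs :: "bool \<Rightarrow> ('b, 'k) monoid_scheme \<Rightarrow> (('b \<Rightarrow> 'b \<Rightarrow> 'b) \<times> 'b set) set" where
  "brace_pairs q M = {(c, K). c \<in> brace_ops M \<and> inverted_cyclic q (brace_ring M c) K}"

definition brace_pair_iso ::
  "bool \<Rightarrow> ('b, 'k) monoid_scheme \<Rightarrow> ((('b \<Rightarrow> 'b \<Rightarrow> 'b) \<times> 'b set) \<times> (('b \<Rightarrow> 'b \<Rightarrow> 'b) \<times> 'b set)) set" where
  "brace_pair_iso q M = {(x, y). x \<in> brace_pairs q M \<and> y \<in> brace_pairs q M \<and>
     (\<exists>f\<in>ring_iso (brace_ring M (fst x)) (brace_ring M (fst y)). f ` snd x = snd y)}"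

lemma brace_pairsD:
  assumes "comm_group M" "(c, K) \<in> brace_pairs q M"
  shows "c \<in> brace_ops M" "inverted_cyclic q (brace_ring M c) K" "K \<subseteq> carrier M"
proof -
  show "c \<in> brace_ops M" and K: "inverted_cyclic q (brace_ring M c) K"
    using assms(2) by (simp_all add: brace_pairs_def)
  show "K \<subseteq> carrier M"
    using subgroup.subset[OF inverted_cyclicD(1)[OF K]] by simp
qed

lemma group_brace_ring: "comm_group M \<Longrightarrow> c \<in> brace_ops M \<Longrightarrow> group (brace_ring M c)"
  using brace_opsD(1)[of M c] by (simp add: brace_operation_def brace_operation_axioms_def)

lemma finite_brace_ops: "finite (carrier M) \<Longrightarrow> finite (brace_ops M)"
  unfolding brace_ops_def by (rule finite_subset[OF Collect_restrict]) (intro finite_PiE)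

lemma brace_ring_iso_gen_group_iff:
  assumes "comm_group M" "order M = 2 ^ n * s" "n \<ge> 2" "s > 0" "group J" "J \<cong> gen_group q n s"
    and "c \<in> brace_ops M"
  shows "brace_ring M c \<cong> J \<longleftrightarrow> (\<exists>K. inverted_cyclic q (brace_ring M c) K)"
proof -
  have grp: "group (brace_ring M c)" by (rule group_brace_ring[OF assms(1,7)])
  have "brace_ring M c \<cong> J \<longleftrightarrow> brace_ring M c \<cong> gen_group q n s"
    using iso_trans[OF _ assms(6)] iso_trans[OF _ group.iso_sym[OF assms(5,6)]] by blast
  moreover have "order (brace_ring M c) = 2 ^ n * s" using assms(2) by (simp add: order_def)
  ultimately show ?thesis using iso_gen_group_iff[OF grp assms(3,4)] by simp
qed

context odd_cyclic_2_product
begin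

lemma bij_betw_twisted_op:
  "bij_betw (\<lambda>(c, K). twisted_op Ns N2 c K) (brace_pairs q N2)
    {c \<in> brace_ops NN. \<exists>K. inverted_cyclic q (brace_ring NN c) K}"
  unfolding bij_betw_def
proof (intro conjI inj_onI equalityI subsetI)
  fix x y assume xy: "x \<in> brace_pairs q N2" "y \<in> brace_pairs q N2"
    "(case x of (c, K) \<Rightarrow> twisted_op Ns N2 c K) = (case y of (c, K) \<Rightarrow> twisted_op Ns N2 c K)"
  obtain c K c' K' where [simp]: "x = (c, K)" "y = (c', K')" by force
  note x = brace_pairsD[OF T.comm_group_axioms xy(1)[simplified]]
  note y = brace_pairsD[OF T.comm_group_axioms xy(2)[simplified]]
  show "x = y"
    using twisted_op_inj[OF x(1) y(1) x(3) y(3)] xy(3) by simp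
next
  fix d assume "d \<in> (\<lambda>(c, K). twisted_op Ns N2 c K) ` brace_pairs q N2"
  then obtain c K where "(c, K) \<in> brace_pairs q N2" "d = twisted_op Ns N2 c K" by auto
  then show "d \<in> {c \<in> brace_ops NN. \<exists>K. inverted_cyclic q (brace_ring NN c) K}"
    using twisted_op_brace brace_pairsD[OF T.comm_group_axioms] by blast
next
  fix d assume "d \<in> {c \<in> brace_ops NN. \<exists>K. inverted_cyclic q (brace_ring NN c) K}"
  then obtain L where "d \<in> brace_ops NN" "inverted_cyclic q (brace_ring NN d) L" by blast
  then obtain c K where "c \<in> brace_ops N2" "inverted_cyclic q (brace_ring N2 c) K" "d = twisted_op Ns N2 c K"
    by (rule brace_decomposition)
  then show "d \<in> (\<lambda>(c, K). twisted_op Ns N2 c K) ` brace_pairs q N2"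
    by (intro image_eqI[of _ _ "(c, K)"]) (simp_all add: brace_pairs_def)
qed

lemma brace_pair_iso_iff:
  assumes "x \<in> brace_pairs q N2" "y \<in> brace_pairs q N2"
  shows "(x, y) \<in> brace_pair_iso q N2 \<longleftrightarrow>
    brace_ring NN (case x of (c, K) \<Rightarrow> twisted_op Ns N2 c K) \<simeq>
    brace_ring NN (case y of (c, K) \<Rightarrow> twisted_op Ns N2 c K)"
proof -
  obtain c K c' K' where [simp]: "x = (c, K)" "y = (c', K')" by force
  note x = brace_pairsD[OF T.comm_group_axioms assms(1)[simplified]]
  note y = brace_pairsD[OF T.comm_group_axioms assms(2)[simplified]]
  have "(\<exists>f\<in>ring_iso (brace_ring N2 c) (brace_ring N2 c'). f ` K = K') \<longleftrightarrow>
      brace_ring NN (twisted_op Ns N2 c K) \<simeq> brace_ring NN (twisted_op Ns N2 c' K')"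
    using twisted_op_iso[OF x(1) y(1) x(3) y(3)] twisted_op_iso_imp[OF x(1) y(1) x(3) y(3)] by blast
  then show ?thesis using assms by (simp add: brace_pair_iso_def)
qed

text \<open>\<open>brace_pair_iso\<close> does not mention \<open>Ns\<close>: this is why \<open>Ns\<close> may be replaced by the cyclic group
  of order 3.\<close>

lemma equiv_brace_pair_iso: "equiv (brace_pairs q N2) (brace_pair_iso q N2)"
proof -
  let ?F = "\<lambda>x. brace_ring NN (case x of (c, K) \<Rightarrow> twisted_op Ns N2 c K)"
  have "brace_pair_iso q N2 = {(x, y). x \<in> brace_pairs q N2 \<and> y \<in> brace_pairs q N2 \<and> ?F x \<simeq> ?F y}"
  proof (rule Set.set_eqI)
    fix z :: "(('b \<Rightarrow> 'b \<Rightarrow> 'b) \<times> 'b set) \<times> (('b \<Rightarrow> 'b \<Rightarrow> 'b) \<times> 'b set)"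
    obtain x y where z: "z = (x, y)" by (cases z)
    show "z \<in> brace_pair_iso q N2 \<longleftrightarrow>
        z \<in> {(x, y). x \<in> brace_pairs q N2 \<and> y \<in> brace_pairs q N2 \<and> ?F x \<simeq> ?F y}"
    proof (cases "x \<in> brace_pairs q N2 \<and> y \<in> brace_pairs q N2")
      case True
      then show ?thesis using brace_pair_iso_iff[of x q y] by (simp add: z)
    next
      case False
      then show ?thesis by (auto simp: z brace_pair_iso_def)
    qed
  qed
  moreover have "brace (?F x)" if "x \<in> brace_pairs q N2" for x
  proof -
    have "(case x of (c, K) \<Rightarrow> twisted_op Ns N2 c K) \<in> brace_ops NN"
      using bij_betwE[OF bij_betw_twisted_op[of q]] that by blast
    then show ?thesis by (simp add: brace_ops_def)
  qed
  ultimately show ?thesis using equiv_braces[of "brace_pairs q N2" ?F] by simp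
qed

lemma
  assumes "n \<ge> 2" "group J" "J \<cong> gen_group q n (order Ns)"
  shows num_regular_product: "num_regular NN J = card (brace_pairs q N2)"
    and num_braces_product: "num_braces NN J = card (brace_pairs q N2 // brace_pair_iso q N2)"
proof -
  let ?A = "{c \<in> brace_ops NN. \<exists>K. inverted_cyclic q (brace_ring NN c) K}"
  let ?F = "\<lambda>(c, K). twisted_op Ns N2 c K"
  have "order NN = 2 ^ n * order Ns"
    using order_N2 by (simp add: order_def card_cartesian_product)
  then have "brace_ring NN c \<cong> J \<longleftrightarrow> (\<exists>K. inverted_cyclic q (brace_ring NN c) K)" if "c \<in> brace_ops NN" for c
    using brace_ring_iso_gen_group_iff[OF P.comm_group_axioms _ assms(1) _ assms(2,3) that] order_ge_3 by simp
  then have A: "{c \<in> brace_ops NN. brace_ring NN c \<cong> J} = ?A" by blast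
  show "num_regular NN J = card (brace_pairs q N2)"
    unfolding num_regular_eq_card_brace_ops[OF P.comm_group_axioms] A
    using bij_betw_same_card[OF bij_betw_twisted_op] by simp
  have brace: "brace (brace_ring NN c)" if "c \<in> ?A" for c using that by (simp add: brace_ops_def)
  have F: "?F x \<in> ?A" if "x \<in> brace_pairs q N2" for x
    using bij_betwE[OF bij_betw_twisted_op] that by blast
  let ?R = "{(c, c'). c \<in> ?A \<and> c' \<in> ?A \<and> brace_ring NN c \<simeq> brace_ring NN c'}"
  have eqA: "equiv ?A ?R" by (rule equiv_braces[OF brace])
  have "card (brace_pairs q N2 // brace_pair_iso q N2) = card (?A // ?R)"
  proof (rule card_quotient_eq[where f = ?F, OF equiv_brace_pair_iso eqA F])
    show "(?F x, ?F y) \<in> ?R \<longleftrightarrow> (x, y) \<in> brace_pair_iso q N2"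
      if "x \<in> brace_pairs q N2" "y \<in> brace_pairs q N2" for x y
      using F[OF that(1)] F[OF that(2)] brace_pair_iso_iff[OF that] by simp
    fix d assume d: "d \<in> ?A"
    then obtain x where "x \<in> brace_pairs q N2" "?F x = d"
      using bij_betw_imp_surj_on[OF bij_betw_twisted_op] by (metis (no_types, lifting) imageE)
    moreover have "(d, d) \<in> ?R" using eqA d by (meson equiv_def refl_onD)
    ultimately show "\<exists>x\<in>brace_pairs q N2. (?F x, d) \<in> ?R" by blast
  qed
  then show "num_braces NN J = card (brace_pairs q N2 // brace_pair_iso q N2)"
    using num_braces_eq_card_quotient[OF P.comm_group_axioms A[symmetric]] by simp
qed

end

section \<open>Forgetting the subgroup in a pair\<close>

lemma card_brace_pairs:
  assumes "finite (carrier M)"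
    and "\<And>c K. (c, K) \<in> brace_pairs q M \<Longrightarrow> card {K. inverted_cyclic q (brace_ring M c) K} = k"
  shows "card (brace_pairs q M) = k * card {c \<in> brace_ops M. \<exists>K. inverted_cyclic q (brace_ring M c) K}"
proof -
  let ?A = "{c \<in> brace_ops M. \<exists>K. inverted_cyclic q (brace_ring M c) K}"
  let ?K = "\<lambda>c. {K. inverted_cyclic q (brace_ring M c) K}"
  have "finite (?K c)" for c
  proof (rule finite_subset)
    show "?K c \<subseteq> Pow (carrier M)"
      using subgroup.subset[OF inverted_cyclicD(1)] by fastforce
    show "finite (Pow (carrier M))" using assms(1) by simp
  qed
  moreover have "finite ?A" using finite_brace_ops[OF assms(1)] by simp
  moreover have "brace_pairs q M = Sigma ?A ?K" by (auto simp: brace_pairs_def)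
  ultimately have "card (brace_pairs q M) = (\<Sum>c\<in>?A. card (?K c))"
    by (simp add: card_SigmaI)
  also have "\<dots> = (\<Sum>c\<in>?A. k)"
    by (rule sum.cong) (auto intro: assms(2) simp: brace_pairs_def)
  finally show ?thesis by simp
qed

text \<open>A brace isomorphism carries the chosen subgroup to an inverted cyclic one; by uniqueness
  this is the chosen one of the target, so both notions of isomorphism agree.\<close>

lemma card_quotient_brace_pairs:
  assumes M: "comm_group M" and eq: "equiv (brace_pairs q M) (brace_pair_iso q M)"
    and unique: "\<And>c K K'. (c, K) \<in> brace_pairs q M \<Longrightarrow> (c, K') \<in> brace_pairs q M \<Longrightarrow> K = K'"
  shows "card (brace_pairs q M // brace_pair_iso q M) =
    card ({c \<in> brace_ops M. \<exists>K. inverted_cyclic q (brace_ring M c) K} //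
      {(c, c'). c \<in> {c \<in> brace_ops M. \<exists>K. inverted_cyclic q (brace_ring M c) K} \<and>
        c' \<in> {c \<in> brace_ops M. \<exists>K. inverted_cyclic q (brace_ring M c) K} \<and>
        brace_ring M c \<simeq> brace_ring M c'})" (is "_ = card (?A // ?R)")
proof (rule card_quotient_eq[where f = fst, OF eq])
  show eqA: "equiv ?A ?R"
    by (rule equiv_braces) (simp add: brace_ops_def)
  show F: "fst x \<in> ?A" if "x \<in> brace_pairs q M" for x
    using that by (auto simp: brace_pairs_def)
  show "(fst x, fst y) \<in> ?R \<longleftrightarrow> (x, y) \<in> brace_pair_iso q M"
    if x: "x \<in> brace_pairs q M" and y: "y \<in> brace_pairs q M" for x y
  proof
    assume "(fst x, fst y) \<in> ?R"
    then obtain f where f: "f \<in> ring_iso (brace_ring M (fst x)) (brace_ring M (fst y))"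
      by (auto simp: is_ring_iso_def)
    have "(fst x, snd x) \<in> brace_pairs q M" "(fst y, snd y) \<in> brace_pairs q M" using x y by simp_all
    note D = brace_pairsD[OF M this(1)] brace_pairsD[OF M this(2)]
    have "f \<in> iso (brace_ring M (fst x)) (brace_ring M (fst y))"
      using f by (auto simp: ring_iso_def ring_hom_def iso_def hom_def)
    then have "inverted_cyclic q (brace_ring M (fst y)) (f ` snd x)"
      using group.inverted_cyclic_iso[OF group_brace_ring[OF M D(1)] group_brace_ring[OF M D(4)]] D(2) by blast
    then have "(fst y, f ` snd x) \<in> brace_pairs q M" using D(4) by (simp add: brace_pairs_def)
    then have "f ` snd x = snd y" using unique y by (metis prod.collapse)
    then show "(x, y) \<in> brace_pair_iso q M" using f x y by (auto simp: brace_pair_iso_def)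
  next
    assume "(x, y) \<in> brace_pair_iso q M"
    then have "brace_ring M (fst x) \<simeq> brace_ring M (fst y)"
      by (auto simp: brace_pair_iso_def is_ring_iso_def)
    then show "(fst x, fst y) \<in> ?R" using F[OF x] F[OF y] by simp
  qed
  fix c assume c: "c \<in> ?A"
  then obtain K where "(c, K) \<in> brace_pairs q M" by (auto simp: brace_pairs_def)
  moreover have "(c, c) \<in> ?R" using eqA c by (meson equiv_def refl_onD)
  ultimately show "\<exists>x\<in>brace_pairs q M. (fst x, c) \<in> ?R" by force
qed

lemma odd_cyclic_2_productI:
  assumes "group Ns" "cyclic_group Ns" "odd (order Ns)" "order Ns \<ge> 3" "comm_group N2" "order N2 = 2 ^ n"
  shows "odd_cyclic_2_product Ns N2 n"
proof -
  interpret Ns: group Ns by fact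
  have fin: "finite (carrier Ns)" using assms(4) by (auto simp: order_def intro: card_ge_0_finite)
  obtain g where g: "g \<in> carrier Ns" "subgroup_generated Ns {g} = Ns"
    using assms(2) by (auto simp: cyclic_group_def)
  have "carrier Ns = generate Ns {g}"
    using carrier_subgroup_generated[of Ns "{g}"] g by simp
  then have "\<forall>u\<in>carrier Ns. \<exists>k::nat. u = g [^]\<^bsub>Ns\<^esub> k"
    using Ns.generate_pow_on_finite_carrier[OF fin g(1)] by blast
  then show ?thesis
    using assms Ns.cyclic_imp_abelian_group g(1)
    by (auto simp: odd_cyclic_2_product_def odd_cyclic_2_product_axioms_def)
qed

lemma odd_cyclic_2_product_Z3:
  assumes "comm_group N2" "order N2 = 2 ^ n"
  shows "odd_cyclic_2_product (integer_mod_group 3) N2 n"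
proof -
  have "\<exists>g\<in>carrier (integer_mod_group 3). \<forall>u\<in>carrier (integer_mod_group 3).
      \<exists>k::nat. u = g [^]\<^bsub>integer_mod_group 3\<^esub> k"
  proof (intro bexI ballI)
    fix u assume "u \<in> carrier (integer_mod_group 3)"
    then have "u = 1 [^]\<^bsub>integer_mod_group 3\<^esub> nat u"
      by (simp add: carrier_integer_mod_group)
    then show "\<exists>k::nat. u = 1 [^]\<^bsub>integer_mod_group 3\<^esub> k" ..
  qed simp
  moreover have "order (integer_mod_group 3) = 3"
    by (simp add: order_def carrier_integer_mod_group)
  ultimately show ?thesis
    using assms by (simp add: odd_cyclic_2_product_def odd_cyclic_2_product_axioms_def)
qed

theorem theorem12p11:
  fixes n s :: nat
    and Ns :: "('a, 'k) monoid_scheme"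
    and N2 :: "('b, 'l) monoid_scheme"
    and N :: "('a \<times> 'b) monoid"
    and J :: "('c, 'm) monoid_scheme"
    and J2 :: "'c set"
  assumes "n \<ge> 2" and "s \<ge> 3" and "odd s"
    and "group Ns" and "cyclic_group Ns" and "order Ns = s"
    and "comm_group N2" and "order N2 = 2 ^ n"
    and "N = Ns \<times>\<times> N2"
    and "group J" and "J \<cong> gen_quaternion n s \<or> J \<cong> gen_dihedral n s"
    and "sylow_subgroup 2 J J2"
  shows "((J \<cong> gen_quaternion n s \<and> n \<noteq> 3) \<or> (J \<cong> gen_dihedral n s \<and> n \<noteq> 2) \<longrightarrow>
           num_regular N J = num_regular N2 (J\<lparr>carrier := J2\<rparr>) \<and>
           num_braces N J = num_braces N2 (J\<lparr>carrier := J2\<rparr>)) \<and>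
         ((J \<cong> gen_quaternion n s \<and> n = 3) \<or> (J \<cong> gen_dihedral n s \<and> n = 2) \<longrightarrow>
           num_regular N J = 3 * num_regular N2 (J\<lparr>carrier := J2\<rparr>)) \<and>
         (n = 3 \<longrightarrow> num_braces N (gen_quaternion 3 s) =
           num_braces (integer_mod_group 3 \<times>\<times> N2) (gen_quaternion 3 3)) \<and>
         (n = 2 \<longrightarrow> num_braces N (gen_dihedral 2 s) =
           num_braces (integer_mod_group 3 \<times>\<times> N2) (gen_dihedral 2 3))"
proof -
  interpret odd_cyclic_2_product Ns N2 n
    using assms by (intro odd_cyclic_2_productI) auto
  interpret J: group J by fact
  interpret Z: odd_cyclic_2_product "integer_mod_group 3" N2 n
    by (rule odd_cyclic_2_product_Z3) fact+
  let ?J2 = "J\<lparr>carrier := J2\<rparr>"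
  let ?A = "\<lambda>q. {c \<in> brace_ops N2. \<exists>K. inverted_cyclic q (brace_ring N2 c) K}"
  have J: "num_regular N J = card (brace_pairs q N2)"
    "num_braces N J = card (brace_pairs q N2 // brace_pair_iso q N2)"
    "{c \<in> brace_ops N2. brace_ring N2 c \<cong> ?J2} = ?A q"
    if iso: "J \<cong> gen_group q n s" for q
  proof -
    show "num_regular N J = card (brace_pairs q N2)"
      "num_braces N J = card (brace_pairs q N2 // brace_pair_iso q N2)"
      using num_regular_product[OF assms(1,10)] num_braces_product[OF assms(1,10)] iso assms(6,9) by simp_all
    have s: "s > 0" using assms(2) by simp
    obtain K where K: "order J = 2 ^ n * s" "inverted_cyclic q J K"
      using iso iso_gen_group_iff[OF assms(10,1) s] by blast
    note syl = J.sylow_inverted_cyclic[OF K(1) assms(3) _ assms(12) K(2)]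
    have grp: "group ?J2"
      using assms(12) J.group_axioms by (auto simp: sylow_subgroup_def intro: subgroup.subgroup_is_group)
    \<comment> \<open>The Sylow subgroup belongs to the same family with odd part 1, so one
      criterion governs the operations on \<open>N2\<close>.\<close>
    have J2: "?J2 \<cong> gen_group q n 1"
      using iso_gen_group_iff[OF grp assms(1), of 1] syl assms(1) by auto
    show "{c \<in> brace_ops N2. brace_ring N2 c \<cong> ?J2} = ?A q"
      using brace_ring_iso_gen_group_iff[OF assms(7) _ assms(1) _ grp J2] assms(8) by auto
  qed
  have ord: "order (brace_ring N2 c) = 2 ^ n" for c using assms(8) by (simp add: order_def)
  note grp2 = group_brace_ring[OF assms(7)]
  have 1: "num_regular N J = num_regular N2 ?J2 \<and> num_braces N J = num_braces N2 ?J2"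
    if iso: "J \<cong> gen_group q n s" and n: "n \<noteq> (if q then 3 else 2)" for q
  proof -
    have unique: "K = K'" if "(c, K) \<in> brace_pairs q N2" "(c, K') \<in> brace_pairs q N2" for c K K'
      using group.inverted_cyclic_unique[OF grp2 ord assms(1) n] that by (auto simp: brace_pairs_def)
    have one: "card {K. inverted_cyclic q (brace_ring N2 c) K} = 1" if "(c, K) \<in> brace_pairs q N2" for c K
    proof -
      have "{K. inverted_cyclic q (brace_ring N2 c) K} = {K}"
        using unique[OF that] that by (auto simp: brace_pairs_def)
      then show ?thesis by simp
    qed
    have "card (brace_pairs q N2) = 1 * card (?A q)"
      by (rule card_brace_pairs[OF finite_N2 one])
    moreover have "card (brace_pairs q N2 // brace_pair_iso q N2) = num_braces N2 ?J2"
      unfolding num_braces_eq_card_quotient[OF assms(7) J(3)[OF iso, symmetric]]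
      by (rule card_quotient_brace_pairs[OF assms(7) equiv_brace_pair_iso unique])
    ultimately show ?thesis
      using J[OF iso] num_regular_eq_card_brace_ops[OF assms(7), of ?J2] by simp
  qed
  have 2: "num_regular N J = 3 * num_regular N2 ?J2"
    if iso: "J \<cong> gen_group q n s" and n: "n = (if q then 3 else 2)" for q
  proof -
    have "card (brace_pairs q N2) = 3 * card (?A q)"
    proof (rule card_brace_pairs[OF finite_N2])
      fix c K assume "(c, K) \<in> brace_pairs q N2"
      then show "card {K. inverted_cyclic q (brace_ring N2 c) K} = 3"
        using group.card_inverted_cyclic[OF grp2] ord n by (auto simp: brace_pairs_def split: if_splits)
    qed
    then show ?thesis
      using J[OF iso] num_regular_eq_card_brace_ops[OF assms(7), of ?J2] by simp
  qed
  have Z3: "order (integer_mod_group 3) = 3" by (simp add: order_def carrier_integer_mod_group)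
  \<comment> \<open>Both sides count the same classes of pairs over \<open>N2\<close>.\<close>
  have 3: "num_braces N (gen_group q n s) = num_braces (integer_mod_group 3 \<times>\<times> N2) (gen_group q n 3)" for q
    using num_braces_product[OF assms(1) group_gen_group iso_refl, of q]
      Z.num_braces_product[OF assms(1) group_gen_group iso_refl, of q] assms(6,9) Z3 by simp
  show ?thesis
    using 1[of True] 1[of False] 2[of True] 2[of False] 3[of True] 3[of False]
    by (auto simp: gen_group_def)
qed

end
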